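(* Let $G$ be a finite group such that $22 \leq Sub(G) \leq 24$. Then $G$ is supersolvable.
   Context: For a finite group $G$, $Sub(G)$ denotes the number of subgroups of $G$, including the trivial subgroup and $G$ itself (subgroups are counted as subsets, not up to conjugacy or isomorphism). A group is supersolvable if it has a finite series of subgroups, from the trivial subgroup to the whole group, each normal in the whole group and with cyclic successive quotients. *)

theory Defs
  imports "HOL-Algebra.Algebra"
begin

definition Sub :: "('a, 'b) monoid_scheme \<Rightarrow> nat"
  where "Sub G = card {H. subgroup H G}"

text \<open>
  The trivial group is supersolvable, via the series of length 0. Repetitions
  \<open>H i = H (Suc i)\<close> are permitted; they have trivial, hence cyclic, quotient.
\<close>

definition supersolvable :: "('a, 'b) monoid_scheme \<Rightarrow> bool"
  where "supersolvable G \<longleftrightarrow>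
    (\<exists>(n::nat) (H :: nat \<Rightarrow> 'a set).
       H 0 = {\<one>\<^bsub>G\<^esub>} \<and> H n = carrier G \<and>
       (\<forall>i\<le>n. H i \<lhd> G) \<and>
       (\<forall>i<n. H i \<subseteq> H (Suc i) \<and> cyclic_group ((G\<lparr>carrier := H (Suc i)\<rparr>) Mod H i)))"

end

theory Submission
  imports Defs
begin

text \<open>
  If a finite group \<open>G\<close> is not supersolvable, let \<open>N\<close> be a largest normal subgroup that can be
  reached from the trivial group by a series of normal subgroups of \<open>G\<close> with cyclic factors. Then
  \<open>G Mod N\<close> is non-trivial and has no normal subgroup of prime order, since the preimage of such a
  subgroup would prolong the series. By the correspondence theorem it has at most as many subgroups
  as \<open>G\<close>. The proof has two halves.

  The first half (\<open>few_subgroups.order_12\<close>) shows that a non-trivial group with at most 24 subgroups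
  and without normal subgroups of prime order has order 12; it is then the alternating group of
  degree 4, which has 10 subgroups. The argument is a count of subgroups. For each prime \<open>p\<close> dividing
  the order, the number \<open>n\<^sub>p\<close> of subgroups of order \<open>p\<close> is 1 modulo \<open>p\<close> (\<open>subs_prime_mod\<close>) but is not
  1, so it is at least \<open>p + 1\<close>. If \<open>p < q\<close> are two such primes, a subgroup of order \<open>q\<close> permutes the
  \<open>n\<^sub>p\<close> subgroups of order \<open>p\<close> by conjugation and fixes only those that it centralizes, so it
  centralizes at least \<open>n\<^sub>p mod q\<close> of them; and each pair of subgroups of orders \<open>p\<close> and \<open>q\<close> that
  commute elementwise gives a subgroup of order \<open>p * q\<close>, which determines the pair. So either \<open>q\<close>
  divides \<open>n\<^sub>p\<close> or there are many subgroups of order \<open>p * q\<close>. Played off against the bound 24, these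
  facts exclude all primes beyond 3, as well as 9 and 24, as divisors of the order.

  The second half (\<open>a4_image_not_22_to_24\<close>) shows that a finite group \<open>G\<close> which maps onto the
  alternating group never has 22, 23 or 24 subgroups. If \<open>G\<close> has at most 24 subgroups and is not
  itself the alternating group, the first half provides a normal subgroup \<open>L\<close> of prime order; it lies
  in the kernel, and \<open>Sub G\<close> exceeds \<open>Sub (G Mod L)\<close> by the number of subgroups of \<open>G\<close> that do not
  contain \<open>L\<close>. At least five such subgroups come from lifting the subgroups of prime power order
  coprime to \<open>card L\<close>. Hence three steps above the alternating group there are at least
  \<open>10 + 3 * 5 = 25\<close> subgroups. For fewer steps there is a dichotomy. After one step the total is at
  most 20 if \<open>L\<close> is central and the only subgroup of its order, and at least 25 otherwise
  (\<open>a4_extension.not_21_to_24\<close>). After two steps it is at most 21 if both kernels have order 2 or 3 and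
  are the only subgroups of their orders, and at least 25 otherwise
  (\<open>a4_double_extension.not_22_to_24\<close>).
\<close>

(* The prime numbers are meant by "prime" throughout, and X is a variable. *)

hide_const (open) Divisibility.prime
no_notation var (\<open>X\<index>\<close>)

section \<open>Actions and conjugation\<close>

text \<open>
  \<^const>\<open>group_action\<close> asks for a homomorphism into the group of extensional bijections of \<open>E\<close>.
  For a plain function the two action laws suffice, because the inverse of \<open>f g\<close> is \<open>f (inv g)\<close>.
\<close>

lemma (in group) action_by_function:
  assumes closed: "\<And>g x. g \<in> carrier G \<Longrightarrow> x \<in> E \<Longrightarrow> f g x \<in> E"
    and one: "\<And>x. x \<in> E \<Longrightarrow> f \<one> x = x"
    and mult: "\<And>g h x. g \<in> carrier G \<Longrightarrow> h \<in> carrier G \<Longrightarrow> x \<in> E \<Longrightarrow> f (g \<otimes> h) x = f g (f h x)"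
  shows "group_action G E (\<lambda>g. \<lambda>x\<in>E. f g x)"
proof -
  have bij: "(\<lambda>x\<in>E. f g x) \<in> Bij E" if g: "g \<in> carrier G" for g
  proof -
    have "bij_betw (f g) E E"
    proof (rule bij_betw_byWitness[where f' = "f (inv g)"])
      show "\<forall>x\<in>E. f (inv g) (f g x) = x"
        using g by (metis inv_closed l_inv mult one)
      show "\<forall>x\<in>E. f g (f (inv g) x) = x"
        using g by (metis inv_closed r_inv mult one)
    qed (use g closed in auto)
    then show ?thesis
      by (simp add: Bij_def bij_betw_def inj_on_def)
  qed
  have "(\<lambda>g. \<lambda>x\<in>E. f g x) \<in> hom G (BijGroup E)"
  proof (rule homI)
    fix g h assume g: "g \<in> carrier G" and h: "h \<in> carrier G"
    show "(\<lambda>x\<in>E. f (g \<otimes> h) x) = (\<lambda>x\<in>E. f g x) \<otimes>\<^bsub>BijGroup E\<^esub> (\<lambda>x\<in>E. f h x)"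
      using bij[OF g] bij[OF h] g h mult closed by (auto simp: BijGroup_def compose_def fun_eq_iff)
  qed (use bij in \<open>simp add: BijGroup_def\<close>)
  then show ?thesis
    unfolding group_action_def group_hom_def group_hom_axioms_def
    by (simp add: group_BijGroup)
qed

lemma (in group) card_orbit_mult_card_stabilizer:
  assumes closed: "\<And>g x. g \<in> carrier G \<Longrightarrow> x \<in> E \<Longrightarrow> f g x \<in> E"
    and one: "\<And>x. x \<in> E \<Longrightarrow> f \<one> x = x"
    and mult: "\<And>g h x. g \<in> carrier G \<Longrightarrow> h \<in> carrier G \<Longrightarrow> x \<in> E \<Longrightarrow> f (g \<otimes> h) x = f g (f h x)"
    and x: "x \<in> E"
  shows "card ((\<lambda>g. f g x) ` carrier G) * card {g \<in> carrier G. f g x = x} = order G"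
proof -
  interpret act: group_action G E "\<lambda>g. \<lambda>x\<in>E. f g x"
    using closed one mult by (rule action_by_function)
  have "orbit G (\<lambda>g. \<lambda>x\<in>E. f g x) x = (\<lambda>g. f g x) ` carrier G"
    using x by (auto simp: orbit_def)
  moreover have "stabilizer G (\<lambda>g. \<lambda>x\<in>E. f g x) x = {g \<in> carrier G. f g x = x}"
    using x by (auto simp: stabilizer_def)
  ultimately show ?thesis
    using act.orbit_stabilizer_theorem[OF x] by simp
qed

text \<open>
  Orbits have lengths that are powers of \<open>p\<close>, and without fixed points none of them has length 1.
\<close>

lemma (in group) p_group_orbit_dvd:
  assumes closed: "\<And>g x. g \<in> carrier G \<Longrightarrow> x \<in> E \<Longrightarrow> f g x \<in> E"
    and one: "\<And>x. x \<in> E \<Longrightarrow> f \<one> x = x"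
    and mult: "\<And>g h x. g \<in> carrier G \<Longrightarrow> h \<in> carrier G \<Longrightarrow> x \<in> E \<Longrightarrow> f (g \<otimes> h) x = f g (f h x)"
    and fin: "finite E" and p: "prime p" "order G = p ^ k"
    and nofix: "\<And>x. x \<in> E \<Longrightarrow> \<exists>g\<in>carrier G. f g x \<noteq> x"
  shows "p dvd card E"
proof -
  let ?\<phi> = "\<lambda>g. \<lambda>x\<in>E. f g x"
  interpret act: group_action G E ?\<phi>
    using closed one mult by (rule action_by_function)
  have "card E = (\<Sum>orb\<in>orbits G E ?\<phi>. card orb)"
    using act.disjoint_sum[OF fin, of "\<lambda>_. 1::nat"] by simp
  moreover have "p dvd card orb" if orb: "orb \<in> orbits G E ?\<phi>" for orb
  proof -
    obtain x where x: "x \<in> E" "orb = orbit G ?\<phi> x"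
      using orb by (auto simp: orbits_def)
    have orb_eq: "orb = (\<lambda>g. f g x) ` carrier G"
      using x by (auto simp: orbit_def)
    have "card orb dvd p ^ k"
      using act.orbit_stabilizer_theorem[OF x(1)] x(2) p(2) by (metis dvd_triv_left)
    then obtain i where i: "card orb = p ^ i"
      using p(1) divides_primepow_nat by blast
    obtain g where g: "g \<in> carrier G" "f g x \<noteq> x"
      using nofix x(1) by blast
    have "x \<in> orb" using act.orbit_refl x by simp
    moreover have "f g x \<in> orb" using g orb_eq by blast
    moreover have "finite orb" using orb_eq x(1) closed fin by (auto intro: finite_subset)
    ultimately have "card orb \<noteq> 1" using g(2) by (metis card_1_singletonE singletonD)
    with i show ?thesis by (cases i) auto
  qed
  ultimately show ?thesis by (simp add: dvd_sum)
qed

text \<open>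
  The points that are not fixed form orbits of length divisible by \<open>p\<close>. Nearly all the counting
  below is an instance of this congruence.
\<close>

lemma (in group) p_subgroup_fixed_points:
  assumes P: "subgroup P G" "card P = p ^ k" "prime p"
    and closed: "\<And>g x. g \<in> P \<Longrightarrow> x \<in> E \<Longrightarrow> f g x \<in> E"
    and one: "\<And>x. x \<in> E \<Longrightarrow> f \<one> x = x"
    and mult: "\<And>g h x. g \<in> P \<Longrightarrow> h \<in> P \<Longrightarrow> x \<in> E \<Longrightarrow> f (g \<otimes> h) x = f g (f h x)"
    and fin: "finite E"
  shows "card E mod p = card {x \<in> E. \<forall>g\<in>P. f g x = x} mod p"
proof -
  let ?F = "{x \<in> E. \<forall>g\<in>P. f g x = x}"
  interpret P: group "G\<lparr>carrier := P\<rparr>"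
    using P(1) by (rule subgroup_imp_group)
  have closed': "f g x \<in> E - ?F" if g: "g \<in> P" and x: "x \<in> E - ?F" for g x
  proof -
    have "f g x \<in> E" using closed g x by simp
    moreover have "f g x \<notin> ?F"
    proof
      assume fx: "f g x \<in> ?F"
      have ig: "inv g \<in> P" "g \<in> carrier G"
        using g P(1) by (auto simp: subgroup.m_inv_closed subgroup.mem_carrier)
      have "f (inv g) (f g x) = f g x" using fx ig by blast
      moreover have "f (inv g) (f g x) = x"
        using mult[OF ig(1) g] x one ig by auto
      ultimately have "f g x = x" by simp
      with fx x show False by simp
    qed
    ultimately show ?thesis by simp
  qed
  have "p dvd card (E - ?F)"
  proof (rule P.p_group_orbit_dvd[where f = f and k = k])
    show "order (G\<lparr>carrier := P\<rparr>) = p ^ k" using P(2) by (simp add: order_def)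
    fix x assume "x \<in> E - ?F"
    then show "\<exists>g\<in>carrier (G\<lparr>carrier := P\<rparr>). f g x \<noteq> x" by auto
  qed (use closed' one mult fin P in auto)
  moreover have "card E = card ?F + card (E - ?F)"
    using fin by (metis (no_types, lifting) card_Diff_subset card_mono finite_subset le_add_diff_inverse mem_Collect_eq subsetI)
  ultimately show ?thesis by (elim dvdE) simp
qed

definition subs :: "('a, 'b) monoid_scheme \<Rightarrow> nat \<Rightarrow> 'a set set"
  where "subs G n = {H. subgroup H G \<and> card H = n}"

lemma subsD: "H \<in> subs G n \<Longrightarrow> subgroup H G" "H \<in> subs G n \<Longrightarrow> card H = n"
  by (auto simp: subs_def)

definition (in group) conjg :: "'a \<Rightarrow> 'a set \<Rightarrow> 'a set"
  where "conjg g H = (\<lambda>h. g \<otimes> h \<otimes> inv g) ` H"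

text \<open>
  The normalizer of \<open>H\<close>, expressed by conjugation of sets rather than as a stabilizer of an
  extensional action, so that membership unfolds to an equation between sets.
\<close>

definition (in group) normzr :: "'a set \<Rightarrow> 'a set"
  where "normzr H = {g \<in> carrier G. conjg g H = H}"

definition (in group) conj_class :: "'a set \<Rightarrow> 'a set set"
  where "conj_class H = (\<lambda>g. conjg g H) ` carrier G"

definition (in group) centralizer :: "'a set \<Rightarrow> 'a set"
  where "centralizer X = {g \<in> carrier G. \<forall>x\<in>X. g \<otimes> x = x \<otimes> g}"

context group begin

lemma conj_mult:
  assumes "g \<in> carrier G" "h \<in> carrier G" "x \<in> carrier G"
  shows "(g \<otimes> h) \<otimes> x \<otimes> inv (g \<otimes> h) = g \<otimes> (h \<otimes> x \<otimes> inv h) \<otimes> inv g"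
  using assms by (simp add: inv_mult_group m_assoc)

lemma conj_hom:
  assumes "g \<in> carrier G" "x \<in> carrier G" "y \<in> carrier G"
  shows "g \<otimes> (x \<otimes> y) \<otimes> inv g = (g \<otimes> x \<otimes> inv g) \<otimes> (g \<otimes> y \<otimes> inv g)"
  using assms by (metis inv_closed inv_solve_right m_assoc m_closed)

lemma conj_eq_iff_commute:
  assumes "g \<in> carrier G" "x \<in> carrier G"
  shows "g \<otimes> x \<otimes> inv g = x \<longleftrightarrow> g \<otimes> x = x \<otimes> g"
  using assms by (metis inv_solve_right m_closed)

lemma conjg_eq_cosets:
  assumes "g \<in> carrier G" "H \<subseteq> carrier G"
  shows "conjg g H = g <# H #> inv g"
  using assms by (auto simp: conjg_def l_coset_def r_coset_def)

lemma conjg_carrier: "g \<in> carrier G \<Longrightarrow> H \<subseteq> carrier G \<Longrightarrow> conjg g H \<subseteq> carrier G"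
  by (auto simp: conjg_def)

lemma conjg_one: "H \<subseteq> carrier G \<Longrightarrow> conjg \<one> H = H"
  by (force simp: conjg_def)

lemma conjg_mult:
  assumes "g \<in> carrier G" "h \<in> carrier G" "H \<subseteq> carrier G"
  shows "conjg (g \<otimes> h) H = conjg g (conjg h H)"
  using assms by (force simp: conjg_def image_image conj_mult subset_eq intro!: image_cong)

lemma conjg_mono: "A \<subseteq> B \<Longrightarrow> conjg g A \<subseteq> conjg g B"
  by (auto simp: conjg_def)

lemma conjg_inv_cancel:
  assumes "g \<in> carrier G" "H \<subseteq> carrier G"
  shows "conjg (inv g) (conjg g H) = H" "conjg g (conjg (inv g) H) = H"
  using assms by (simp_all flip: conjg_mult add: conjg_one)

lemma subgroup_conjg: "g \<in> carrier G \<Longrightarrow> subgroup H G \<Longrightarrow> subgroup (conjg g H) G"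
  using subgroup_conjugation_is_surj2 by (simp add: conjg_eq_cosets subgroup.subset)

lemma inj_on_conj: "g \<in> carrier G \<Longrightarrow> inj_on (\<lambda>h. g \<otimes> h \<otimes> inv g) (carrier G)"
  by (simp add: inj_on_def)

lemma card_conjg: "g \<in> carrier G \<Longrightarrow> H \<subseteq> carrier G \<Longrightarrow> card (conjg g H) = card H"
  unfolding conjg_def using inj_on_conj by (metis card_image inj_on_subset)

lemma conjg_subs: "g \<in> carrier G \<Longrightarrow> H \<in> subs G n \<Longrightarrow> conjg g H \<in> subs G n"
  by (simp add: subs_def subgroup_conjg card_conjg subgroup.subset)

lemma conj_class_subset_subs: "H \<in> subs G n \<Longrightarrow> conj_class H \<subseteq> subs G n"
  by (auto simp: conj_class_def conjg_subs)

lemma conjg_in_class: "g \<in> carrier G \<Longrightarrow> conjg g H \<in> conj_class H"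
  by (simp add: conj_class_def)

lemma self_in_class: "H \<subseteq> carrier G \<Longrightarrow> H \<in> conj_class H"
  by (metis conjg_in_class conjg_one one_closed)

lemma card_class_mult_card_normzr:
  assumes "H \<subseteq> carrier G"
  shows "card (conj_class H) * card (normzr H) = order G"
  unfolding conj_class_def normzr_def
  by (rule card_orbit_mult_card_stabilizer[where E = "Pow (carrier G)" and f = conjg])
     (use assms conjg_carrier conjg_one conjg_mult in auto)

lemma normzr_subgroup: "H \<subseteq> carrier G \<Longrightarrow> subgroup (normzr H) G"
proof -
  assume H: "H \<subseteq> carrier G"
  interpret act: group_action G "Pow (carrier G)" "\<lambda>g. \<lambda>x\<in>Pow (carrier G). conjg g x"
    by (rule action_by_function) (use conjg_carrier conjg_one conjg_mult in auto)
  show ?thesis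
    using act.stabilizer_subgroup[of H] H by (simp add: stabilizer_def normzr_def)
qed

lemma conjg_self:
  assumes "subgroup H G" "g \<in> H" shows "conjg g H = H"
proof -
  have c: "conjg g H \<subseteq> H" if "g \<in> H" for g
    using that assms(1) by (auto simp: conjg_def intro!: subgroup.m_closed subgroup.m_inv_closed)
  have g: "g \<in> carrier G" "inv g \<in> H"
    using assms by (auto simp: subgroup.mem_carrier subgroup.m_inv_closed)
  have "H = conjg g (conjg (inv g) H)"
    using conjg_inv_cancel g assms by (simp add: subgroup.subset)
  also have "\<dots> \<subseteq> conjg g H" using c[OF g(2)] by (rule conjg_mono)
  finally show ?thesis using c[OF assms(2)] by blast
qed

lemma subset_normzr: "subgroup H G \<Longrightarrow> H \<subseteq> normzr H"
  using conjg_self by (auto simp: normzr_def subgroup.mem_carrier)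

lemma normal_iff_conjg:
  "N \<lhd> G \<longleftrightarrow> subgroup N G \<and> (\<forall>g\<in>carrier G. conjg g N = N)"
proof
  assume N: "N \<lhd> G"
  then have sub: "subgroup N G" by (rule normal_imp_subgroup)
  have le: "conjg g N \<subseteq> N" if "g \<in> carrier G" for g
    using normal.inv_op_closed2[OF N] that by (auto simp: conjg_def)
  have "conjg g N = N" if g: "g \<in> carrier G" for g
  proof -
    have "N = conjg g (conjg (inv g) N)"
      using conjg_inv_cancel g sub by (simp add: subgroup.subset)
    also have "\<dots> \<subseteq> conjg g N" using le g by (intro conjg_mono) auto
    finally show ?thesis using le[OF g] by blast
  qed
  with sub show "subgroup N G \<and> (\<forall>g\<in>carrier G. conjg g N = N)" by blast
next
  assume *: "subgroup N G \<and> (\<forall>g\<in>carrier G. conjg g N = N)"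
  then show "N \<lhd> G"
    by (intro normal_invI) (auto simp: conjg_def)
qed

lemma unique_subs_normal:
  assumes "subs G n = {N}" shows "N \<lhd> G"
  using assms conjg_subs[of _ N n] by (auto simp: normal_iff_conjg subs_def)

lemma centralizer_subgroup:
  assumes "X \<subseteq> carrier G" shows "subgroup (centralizer X) G"
proof (rule subgroupI)
  have "\<one> \<in> centralizer X" using assms by (auto simp: centralizer_def subset_eq)
  then show "centralizer X \<noteq> {}" by blast
next
  fix a assume a: "a \<in> centralizer X"
  then have ac: "a \<in> carrier G" by (simp add: centralizer_def)
  have "inv a \<otimes> x = x \<otimes> inv a" if "x \<in> X" for x
  proof -
    have "a \<otimes> x = x \<otimes> a" "x \<in> carrier G" using a that assms by (auto simp: centralizer_def)
    then show ?thesis using ac by (metis inv_closed inv_solve_left inv_solve_right m_assoc m_closed)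
  qed
  then show "inv a \<in> centralizer X" using ac by (simp add: centralizer_def)
next
  fix a b assume ab: "a \<in> centralizer X" "b \<in> centralizer X"
  then have c: "a \<in> carrier G" "b \<in> carrier G" by (auto simp: centralizer_def)
  have "a \<otimes> b \<otimes> x = x \<otimes> (a \<otimes> b)" if "x \<in> X" for x
  proof -
    have x: "x \<in> carrier G" using that assms by auto
    have "a \<otimes> x = x \<otimes> a" "b \<otimes> x = x \<otimes> b" using ab that by (auto simp: centralizer_def)
    then show ?thesis using c x by (metis m_assoc)
  qed
  then show "a \<otimes> b \<in> centralizer X" using c by (simp add: centralizer_def)
qed (auto simp: centralizer_def)

lemma subset_centralizer_commute:
  "A \<subseteq> carrier G \<Longrightarrow> B \<subseteq> carrier G \<Longrightarrow> A \<subseteq> centralizer B \<longleftrightarrow> B \<subseteq> centralizer A"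
  by (auto simp: centralizer_def subset_eq)

lemma centralizer_subset_normzr: "X \<subseteq> carrier G \<Longrightarrow> centralizer X \<subseteq> normzr X"
proof
  fix g assume X: "X \<subseteq> carrier G" and g: "g \<in> centralizer X"
  then have "g \<otimes> x \<otimes> inv g = x" if "x \<in> X" for x
    using that X conj_eq_iff_commute[of g x] unfolding centralizer_def by blast
  then show "g \<in> normzr X" using g by (auto simp: normzr_def conjg_def centralizer_def)
qed

text \<open>
  For conjugation of elements, being fixed by \<open>P\<close> means lying in its centralizer.
\<close>

lemma fixed_elements_cong:
  assumes P: "subgroup P G" "card P = p ^ k" "prime p"
    and E: "E \<subseteq> carrier G" "finite E" "\<And>g. g \<in> P \<Longrightarrow> conjg g E \<subseteq> E"
  shows "card E mod p = card (E \<inter> centralizer P) mod p"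
proof -
  have Pc: "P \<subseteq> carrier G" using P(1) by (rule subgroup.subset)
  have "card E mod p = card {x \<in> E. \<forall>g\<in>P. g \<otimes> x \<otimes> inv g = x} mod p"
  proof (rule p_subgroup_fixed_points[OF P, where f = "\<lambda>g x. g \<otimes> x \<otimes> inv g"])
    show "g \<otimes> x \<otimes> inv g \<in> E" if "g \<in> P" "x \<in> E" for g x
      using E(3)[OF that(1)] that(2) by (auto simp: conjg_def)
    show "\<one> \<otimes> x \<otimes> inv \<one> = x" if "x \<in> E" for x
      using that E(1) by auto
    show "g \<otimes> h \<otimes> x \<otimes> inv (g \<otimes> h) = g \<otimes> (h \<otimes> x \<otimes> inv h) \<otimes> inv g"
      if "g \<in> P" "h \<in> P" "x \<in> E" for g h x
      using that E(1) Pc by (intro conj_mult) auto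
  qed (rule E(2))
  also have "{x \<in> E. \<forall>g\<in>P. g \<otimes> x \<otimes> inv g = x} = E \<inter> centralizer P"
    using E(1) Pc conj_eq_iff_commute by (auto simp: centralizer_def subset_eq)
  finally show ?thesis .
qed

text \<open>
  For conjugation of subsets, being fixed by \<open>P\<close> means being normalized by it.
\<close>

lemma fixed_subsets_cong:
  assumes P: "subgroup P G" "card P = p ^ k" "prime p"
    and E: "E \<subseteq> Pow (carrier G)" "finite E" "\<And>g H. g \<in> P \<Longrightarrow> H \<in> E \<Longrightarrow> conjg g H \<in> E"
  shows "card E mod p = card {H \<in> E. P \<subseteq> normzr H} mod p"
proof -
  have Pc: "P \<subseteq> carrier G" using P(1) by (rule subgroup.subset)
  have "card E mod p = card {H \<in> E. \<forall>g\<in>P. conjg g H = H} mod p"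
  proof (rule p_subgroup_fixed_points[OF P, where f = conjg])
    show "conjg \<one> H = H" if "H \<in> E" for H
      using that E(1) by (intro conjg_one) auto
    show "conjg (g \<otimes> h) H = conjg g (conjg h H)" if "g \<in> P" "h \<in> P" "H \<in> E" for g h H
      using that E(1) Pc by (intro conjg_mult) auto
  qed (use E in auto)
  also have "{H \<in> E. \<forall>g\<in>P. conjg g H = H} = {H \<in> E. P \<subseteq> normzr H}"
    using Pc by (auto simp: normzr_def)
  finally show ?thesis .
qed

end

section \<open>Subgroups of a finite group\<close>

locale finite_group = group G for G (structure) + assumes fin: "finite (carrier G)"

lemma (in group) subs_subgroup:
  assumes "subgroup C G"
  shows "subs (G\<lparr>carrier := C\<rparr>) n = {H \<in> subs G n. H \<subseteq> C}"
  using assms incl_subgroup[OF assms] subgroup_incl subgroup.subset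
  by (fastforce simp: subs_def)

context finite_group begin

lemma finite_group_subgroup: "subgroup C G \<Longrightarrow> finite_group (G\<lparr>carrier := C\<rparr>)"
  using fin subgroup_imp_group subgroup.subset finite_subset
  by (fastforce simp: finite_group_def finite_group_axioms_def)

lemma finite_subgroup: "subgroup H G \<Longrightarrow> finite H"
  using fin subgroup.subset finite_subset by blast

lemma finite_subgroups: "finite {H. subgroup H G}"
  by (rule finite_subset[of _ "Pow (carrier G)"]) (use fin subgroup.subset in auto)

lemma finite_subs [simp]: "finite (subs G n)"
  by (rule finite_subset[OF _ finite_subgroups]) (auto simp: subs_def)

lemma subs_in_Pow: "subs G n \<subseteq> Pow (carrier G)"
  using subgroup.subset by (auto simp: subs_def)

lemma card_subgroup_pos: "subgroup H G \<Longrightarrow> 0 < card H"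
  using finite_subgroup subgroup.one_closed by (fastforce simp: card_gt_0_iff)

lemma order_pos: "0 < order G"
  using fin order_gt_0_iff_finite by blast

lemma card_subgroup_dvd: "subgroup H G \<Longrightarrow> card H dvd order G"
  using lagrange_finite fin by (metis dvd_triv_right)

lemma card_subgroup_dvd_subgroup:
  assumes "subgroup A G" "subgroup B G" "A \<subseteq> B" shows "card A dvd card B"
proof -
  interpret B: finite_group "G\<lparr>carrier := B\<rparr>" using assms(2) by (rule finite_group_subgroup)
  show ?thesis
    using B.card_subgroup_dvd[of A] subgroup_incl[OF assms] by (simp add: order_def)
qed

lemma subgroup_card_eq:
  assumes "subgroup A G" "subgroup B G" "A \<subseteq> B" "card B \<le> card A" shows "A = B"
  using assms finite_subgroup by (simp add: card_seteq)

lemma sylow_subs: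
  assumes "prime p" "p ^ k dvd order G" shows "\<exists>P. P \<in> subs G (p ^ k)"
proof -
  obtain m where "order G = p ^ k * m" using assms(2) by blast
  then show ?thesis
    using sylow_thm[OF assms(1) is_group _ fin] by (auto simp: subs_def)
qed

lemma sylow_in_subgroup:
  assumes "subgroup C G" "prime p" "p ^ k dvd card C" shows "\<exists>P \<in> subs G (p ^ k). P \<subseteq> C"
proof -
  interpret C: finite_group "G\<lparr>carrier := C\<rparr>" using assms(1) by (rule finite_group_subgroup)
  show ?thesis
    using C.sylow_subs[OF assms(2), of k] assms(3) by (auto simp: order_def subs_subgroup[OF assms(1)])
qed

lemma cauchy_in_subgroup:
  assumes "subgroup C G" "prime p" "p dvd card C" shows "\<exists>P \<in> subs G p. P \<subseteq> C"
  using sylow_in_subgroup[of C p 1] assms by simp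

lemma pow_card_subgroup:
  assumes "subgroup A G" "a \<in> A" shows "a [^] card A = \<one>"
proof -
  interpret A: finite_group "G\<lparr>carrier := A\<rparr>" using assms(1) by (rule finite_group_subgroup)
  show ?thesis using A.pow_order_eq_1[of a] assms(2) by (simp add: order_def flip: nat_pow_consistent)
qed

text \<open>
  A subgroup of prime order is generated by each of its non-trivial elements.
\<close>

lemma prime_subs_Int:
  assumes A: "A \<in> subs G p" "prime p" and B: "subgroup B G" and x: "x \<in> A" "x \<in> B" "x \<noteq> \<one>"
  shows "A \<subseteq> B"
proof -
  have A': "subgroup A G" "card A = p" using A(1) by (auto simp: subs_def)
  have sub: "subgroup (A \<inter> B) G" using A'(1) B by (rule subgroups_Inter_pair)
  have "card (A \<inter> B) dvd p"
    using card_subgroup_dvd_subgroup[OF sub A'(1)] A'(2) by simp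
  moreover have "card (A \<inter> B) \<noteq> 1"
    using x subgroup.one_closed[OF sub] by (metis IntI card_1_singletonE singletonD)
  ultimately have "card (A \<inter> B) = p" using A(2) by (metis prime_nat_iff)
  then have "A \<inter> B = A" using sub A' by (intro subgroup_card_eq) auto
  then show ?thesis by blast
qed

lemma prime_subs_disjoint:
  assumes "A \<in> subs G p" "prime p" "B \<in> subs G p" "A \<noteq> B" shows "A \<inter> B = {\<one>}"
proof -
  have "x = \<one>" if "x \<in> A" "x \<in> B" for x
    using prime_subs_Int[OF assms(1,2) _ that] prime_subs_Int[OF assms(3,2) _ that(2,1)] assms
    by (auto simp: subs_def)
  then show ?thesis using assms by (auto simp: subs_def subgroup.one_closed)
qed

lemma prime_subs_generate:
  assumes "x \<in> carrier G" "x \<noteq> \<one>" "x [^] p = \<one>" "prime p"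
  shows "generate G {x} \<in> subs G p"
proof -
  have "ord x dvd p" using assms pow_eq_id by blast
  moreover have "ord x \<noteq> 1" using assms ord_eq_1 by blast
  ultimately have "ord x = p" using assms(4) by (metis prime_nat_iff)
  then show ?thesis
    using generate_pow_card[OF assms(1)] generate_is_subgroup[of "{x}"] assms(1) by (simp add: subs_def)
qed

lemma mem_generate: "x \<in> generate G {x}"
  by (simp add: generate.incl)

lemma prime_subs_abelian:
  assumes Y: "Y \<in> subs G p" "prime p" shows "Y \<subseteq> centralizer Y"
proof
  fix u assume u: "u \<in> Y"
  have Ys: "subgroup Y G" "Y \<subseteq> carrier G" using subsD(1)[OF Y(1)] subgroup.subset by auto
  have uc: "u \<in> carrier G" using u Ys by blast
  have cs: "subgroup (centralizer {u}) G" using centralizer_subgroup uc by simp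
  show "u \<in> centralizer Y"
  proof (cases "u = \<one>")
    case True
    then show ?thesis using Ys by (auto simp: centralizer_def subset_eq)
  next
    case False
    have "u \<in> centralizer {u}" using uc by (simp add: centralizer_def)
    then have "Y \<subseteq> centralizer {u}" using prime_subs_Int[OF Y cs u _ False] by simp
    then show ?thesis using uc by (auto simp: centralizer_def)
  qed
qed

lemma card_prime_subs_elements:
  assumes "prime p" shows "card (\<Union>Y\<in>subs G p. Y - {\<one>}) = card (subs G p) * (p - 1)"
proof -
  have "card (\<Union>Y\<in>subs G p. Y - {\<one>}) = (\<Sum>Y\<in>subs G p. card (Y - {\<one>}))"
  proof (rule card_UN_disjoint)
    show "\<forall>A\<in>subs G p. finite (A - {\<one>})" using finite_subgroup by (auto simp: subs_def)
    show "\<forall>A\<in>subs G p. \<forall>B\<in>subs G p. A \<noteq> B \<longrightarrow> (A - {\<one>}) \<inter> (B - {\<one>}) = {}"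
      using prime_subs_disjoint[OF _ assms] by blast
  qed simp
  then show ?thesis by (simp add: subs_def card_Diff_singleton subgroup.one_closed)
qed

text \<open>
  Let \<open>S\<close> be the set of solutions of \<open>x [^] p = \<one>\<close> and \<open>P\<close> a subgroup of order \<open>p\<close>. Modulo \<open>p\<close>,
  conjugation by \<open>P\<close> reduces the size of \<open>S\<close> to that of \<open>S \<inter> centralizer P\<close>. On this set the abelian
  group \<open>P\<close> acts by translations, which have no fixed points. So \<open>p\<close> divides the size of \<open>S\<close>,
  which is \<open>n * (p - 1) + 1\<close> if there are \<open>n\<close> subgroups of order \<open>p\<close>.
\<close>

theorem subs_prime_mod:
  assumes p: "prime p" "p dvd order G" shows "card (subs G p) mod p = 1"
proof -
  define S where "S = {x \<in> carrier G. x [^] p = \<one>}"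
  obtain P where P: "P \<in> subs G p" using sylow_subs[of p 1] p by auto
  have P': "subgroup P G" "card P = p ^ 1" using P by (auto simp: subs_def)
  have Pc: "P \<subseteq> carrier G" using P'(1) by (rule subgroup.subset)
  have finS: "finite S" using fin by (simp add: S_def)
  have "card S mod p = card (S \<inter> centralizer P) mod p"
  proof (rule fixed_elements_cong[OF P' p(1) _ finS])
    fix g assume "g \<in> P"
    then have g: "g \<in> carrier G" using Pc by blast
    have "(g \<otimes> x \<otimes> inv g) [^] n = g \<otimes> x [^] n \<otimes> inv g" if "x \<in> carrier G" for x and n :: nat
      using that g by (induction n) (auto simp: conj_hom)
    then show "conjg g S \<subseteq> S" using g by (auto simp: S_def conjg_def)
  qed (auto simp: S_def)
  also have "card (S \<inter> centralizer P) mod p = card {x \<in> S \<inter> centralizer P. \<forall>u\<in>P. u \<otimes> x = x} mod p"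
  proof (rule p_subgroup_fixed_points[OF P' p(1)])
    fix u x assume u: "u \<in> P" and x: "x \<in> S \<inter> centralizer P"
    have c: "u \<in> carrier G" "x \<in> carrier G" "u \<otimes> x = x \<otimes> u" using u x Pc by (auto simp: centralizer_def S_def)
    have "u [^] p = \<one>" using pow_card_subgroup[OF P'(1) u] P'(2) by simp
    then have "(u \<otimes> x) [^] p = \<one>" using x c by (simp add: pow_mult_distrib S_def)
    moreover have "u \<in> centralizer P" using prime_subs_abelian[OF P p(1)] u by blast
    then have "u \<otimes> x \<in> centralizer P"
      using x subgroup.m_closed[OF centralizer_subgroup[OF Pc]] by blast
    ultimately show "u \<otimes> x \<in> S \<inter> centralizer P" using c by (simp add: S_def)
  next
    fix g h x assume "g \<in> P" "h \<in> P" "x \<in> S \<inter> centralizer P"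
    then show "g \<otimes> h \<otimes> x = g \<otimes> (h \<otimes> x)" using Pc by (intro m_assoc) (auto simp: S_def)
  qed (use finS in \<open>auto simp: S_def\<close>)
  also have "{x \<in> S \<inter> centralizer P. \<forall>u\<in>P. u \<otimes> x = x} = {}"
  proof -
    have "\<exists>v \<in> P. v \<noteq> \<one>"
      using P'(2) p(1) subgroup.one_closed[OF P'(1)] prime_gt_1_nat[OF p(1)]
      by (metis card_le_Suc0_iff_eq finite_subgroup[OF P'(1)] One_nat_def not_le power_one_right)
    then obtain v where v: "v \<in> P" "v \<noteq> \<one>" by blast
    then have "v \<otimes> x \<noteq> x" if "x \<in> carrier G" for x
      using that Pc r_cancel_one[of x v] by blast
    then show ?thesis using v(1) unfolding S_def by blast
  qed
  finally have Sdvd: "p dvd card S" by (simp add: mod_eq_0_iff_dvd)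
  have S_eq: "S - {\<one>} = (\<Union>Y\<in>subs G p. Y - {\<one>})"
  proof
    show "S - {\<one>} \<subseteq> (\<Union>Y\<in>subs G p. Y - {\<one>})"
    proof
      fix x assume x: "x \<in> S - {\<one>}"
      then have "generate G {x} \<in> subs G p" using prime_subs_generate p(1) by (auto simp: S_def)
      then show "x \<in> (\<Union>Y\<in>subs G p. Y - {\<one>})" using mem_generate[of x] x by blast
    qed
    show "(\<Union>Y\<in>subs G p. Y - {\<one>}) \<subseteq> S - {\<one>}"
      using pow_card_subgroup subgroup.mem_carrier by (fastforce simp: subs_def S_def)
  qed
  have "card (S - {\<one>}) = card (subs G p) * (p - 1)"
    unfolding S_eq by (rule card_prime_subs_elements[OF p(1)])
  then have cS: "card S = card (subs G p) * (p - 1) + 1"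
    using finS card.remove[of S \<one>] by (simp add: S_def)
  have "s * (p - 1) + 1 + s = s * p + 1" for s
    using prime_gt_0_nat[OF p(1)] by (simp add: algebra_simps diff_mult_distrib2)
  then have "card S + card (subs G p) = card (subs G p) * p + 1"
    unfolding cS by blast
  moreover obtain c where "card S = p * c" using Sdvd by blast
  ultimately have "(p * c + card (subs G p)) mod p = (1 + card (subs G p) * p) mod p" by simp
  then show ?thesis using prime_gt_1_nat[OF p(1)] by (metis mod_mult_self1 mod_mult_self4 mod_less)
qed

lemma subs_prime_mod_subgroup:
  assumes C: "subgroup C G" and p: "prime p" "p dvd card C"
  shows "card {P \<in> subs G p. P \<subseteq> C} mod p = 1"
proof -
  interpret C: finite_group "G\<lparr>carrier := C\<rparr>" using C by (rule finite_group_subgroup)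
  show ?thesis using C.subs_prime_mod[OF p(1)] p(2) by (simp add: order_def subs_subgroup[OF C])
qed

section \<open>Commuting pairs of subgroups\<close>

lemma prod_subgroup:
  assumes A: "subgroup A G" and B: "subgroup B G" and n: "A \<subseteq> normzr B"
  shows "subgroup (A <#> B) G"
proof (rule subgroupI)
  have Ac: "A \<subseteq> carrier G" and Bc: "B \<subseteq> carrier G" using A B by (auto simp: subgroup.subset)
  show "A <#> B \<subseteq> carrier G" using Ac Bc by (rule set_mult_closed)
  show "A <#> B \<noteq> {}" using A B subgroup.one_closed by (fastforce simp: set_mult_def)
  have swap: "\<exists>b'\<in>B. b \<otimes> a = a \<otimes> b'" if "a \<in> A" "b \<in> B" for a b
  proof -
    have ia: "inv a \<in> A" using that(1) A by (simp add: subgroup.m_inv_closed)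
    then have "conjg (inv a) B = B" using n by (auto simp: normzr_def)
    then have "inv a \<otimes> b \<otimes> inv (inv a) \<in> B" using that(2) by (auto simp: conjg_def)
    then have "inv a \<otimes> b \<otimes> a \<in> B" using that Ac by auto
    moreover have "b \<otimes> a = a \<otimes> (inv a \<otimes> b \<otimes> a)"
      using that Ac Bc by (metis inv_solve_left m_assoc m_closed inv_closed subsetD)
    ultimately show ?thesis by blast
  qed
  show "inv x \<in> A <#> B" if xm: "x \<in> A <#> B" for x
  proof -
    obtain a b where x: "a \<in> A" "b \<in> B" "x = a \<otimes> b" using xm by (auto simp: set_mult_def)
    have "inv x = inv b \<otimes> inv a" using x Ac Bc by (auto simp: inv_mult_group subset_eq)
    moreover have "inv a \<in> A" "inv b \<in> B" using x A B by (auto simp: subgroup.m_inv_closed)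
    ultimately show ?thesis using swap by (fastforce simp: set_mult_def)
  qed
  show "x \<otimes> y \<in> A <#> B" if xy: "x \<in> A <#> B" "y \<in> A <#> B" for x y
  proof -
    obtain a b where x: "a \<in> A" "b \<in> B" "x = a \<otimes> b" using xy(1) by (auto simp: set_mult_def)
    obtain c d where y: "c \<in> A" "d \<in> B" "y = c \<otimes> d" using xy(2) by (auto simp: set_mult_def)
    obtain b' where b': "b' \<in> B" "b \<otimes> c = c \<otimes> b'" using swap x y by blast
    have "x \<otimes> y = a \<otimes> (b \<otimes> c) \<otimes> d" using x y Ac Bc by (auto simp: m_assoc subset_eq)
    also have "\<dots> = (a \<otimes> c) \<otimes> (b' \<otimes> d)" using b' x y Ac Bc by (auto simp: m_assoc subset_eq)
    finally show ?thesis using x y b' A B by (auto simp: set_mult_def intro: subgroup.m_closed)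
  qed
qed

lemma card_prod:
  assumes A: "subgroup A G" and B: "subgroup B G" and i: "A \<inter> B = {\<one>}"
  shows "card (A <#> B) = card A * card B"
proof -
  have Ac: "A \<subseteq> carrier G" and Bc: "B \<subseteq> carrier G" using A B by (auto simp: subgroup.subset)
  have "A <#> B = (\<lambda>(a, b). a \<otimes> b) ` (A \<times> B)" by (auto simp: set_mult_def)
  moreover have "inj_on (\<lambda>(a, b). a \<otimes> b) (A \<times> B)"
  proof (clarsimp simp: inj_on_def)
    fix a b c d assume *: "a \<in> A" "b \<in> B" "c \<in> A" "d \<in> B" "a \<otimes> b = c \<otimes> d"
    have c: "a \<in> carrier G" "b \<in> carrier G" "c \<in> carrier G" "d \<in> carrier G" using * Ac Bc by auto
    have "inv c \<otimes> a = d \<otimes> inv b"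
      using * c by (metis inv_closed inv_solve_left inv_solve_right m_assoc m_closed)
    moreover have "inv c \<otimes> a \<in> A" "d \<otimes> inv b \<in> B"
      using * A B by (auto intro: subgroup.m_closed subgroup.m_inv_closed)
    ultimately have "inv c \<otimes> a = \<one>" using i by auto
    then have "a = c" using c by (metis inv_closed inv_equality inv_inv)
    then show "a = c \<and> b = d" using * c by simp
  qed
  ultimately show ?thesis by (simp add: card_image card_cartesian_product)
qed

lemma subset_prod:
  assumes "subgroup A G" "subgroup B G" shows "A \<subseteq> A <#> B" "B \<subseteq> A <#> B"
proof -
  show "A \<subseteq> A <#> B"
  proof
    fix a assume "a \<in> A"
    moreover have "a = a \<otimes> \<one>" using \<open>a \<in> A\<close> assms(1) by (simp add: subgroup.mem_carrier)
    ultimately show "a \<in> A <#> B" using subgroup.one_closed[OF assms(2)] by (auto simp: set_mult_def)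
  qed
  show "B \<subseteq> A <#> B"
  proof
    fix b assume "b \<in> B"
    moreover have "b = \<one> \<otimes> b" using \<open>b \<in> B\<close> assms(2) by (simp add: subgroup.mem_carrier)
    ultimately show "b \<in> A <#> B" using subgroup.one_closed[OF assms(1)] by (auto simp: set_mult_def)
  qed
qed

lemma coprime_Int:
  assumes "subgroup A G" "subgroup B G" "coprime (card A) (card B)" shows "A \<inter> B = {\<one>}"
proof -
  have sub: "subgroup (A \<inter> B) G" using assms(1,2) by (rule subgroups_Inter_pair)
  have "card (A \<inter> B) dvd card A" "card (A \<inter> B) dvd card B"
    using card_subgroup_dvd_subgroup[OF sub] assms by auto
  then have "card (A \<inter> B) = 1" using assms(3) by (metis coprime_common_divisor_nat)
  then show ?thesis using subgroup.one_closed[OF sub] by (metis card_1_singletonE singletonD)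
qed

text \<open>
  Elements of \<open>A\<close> and \<open>B\<close> commute, so powers of a product are products of powers, and coprimality
  separates the two factors. The factors can therefore be read off from the set \<open>A <#> B\<close> alone,
  which makes different pairs give different subgroups of order \<open>m * n\<close>.
\<close>

lemma commuting_prod_subs:
  assumes A: "A \<in> subs G m" and B: "B \<in> subs G n" and c: "A \<subseteq> centralizer B" and co: "coprime m n"
  shows "A <#> B \<in> subs G (m * n)" "A = {z \<in> A <#> B. z [^] m = \<one>}" "B = {z \<in> A <#> B. z [^] n = \<one>}"
proof -
  have A': "subgroup A G" "card A = m" and B': "subgroup B G" "card B = n" using A B by (auto simp: subs_def)
  have Ac: "A \<subseteq> carrier G" and Bc: "B \<subseteq> carrier G" using A' B' by (auto simp: subgroup.subset)
  have i: "A \<inter> B = {\<one>}" using coprime_Int A' B' co by simp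
  have "subgroup (A <#> B) G" using prod_subgroup A' B' c centralizer_subset_normzr[OF Bc] by blast
  then show "A <#> B \<in> subs G (m * n)" using card_prod[OF A'(1) B'(1) i] A' B' by (simp add: subs_def)
  have pw: "(a \<otimes> b) [^] k = a [^] k \<otimes> b [^] k" if "a \<in> A" "b \<in> B" for a b and k :: nat
    using that c Ac Bc by (intro pow_mult_distrib) (auto simp: centralizer_def)
  have triv: "x = \<one>" if "x \<in> carrier G" "x [^] m = \<one>" "x [^] n = \<one>" for x
    using that co by (metis coprime_common_divisor_nat ord_eq_1 pow_eq_id)
  show "A = {z \<in> A <#> B. z [^] m = \<one>}"
  proof
    show "A \<subseteq> {z \<in> A <#> B. z [^] m = \<one>}"
      using subset_prod[OF A'(1) B'(1)] pow_card_subgroup[OF A'(1)] A'(2) by auto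
    show "{z \<in> A <#> B. z [^] m = \<one>} \<subseteq> A"
    proof clarify
      fix z assume z: "z \<in> A <#> B" "z [^] m = \<one>"
      then obtain a b where ab: "a \<in> A" "b \<in> B" "z = a \<otimes> b" by (auto simp: set_mult_def)
      have "b [^] m = \<one>" using pw[OF ab(1,2), of m] z ab pow_card_subgroup[OF A'(1) ab(1)] A'(2) Bc by auto
      moreover have "b [^] n = \<one>" using pow_card_subgroup[OF B'(1) ab(2)] B'(2) by simp
      ultimately have "b = \<one>" using triv ab Bc by auto
      then show "z \<in> A" using ab Ac by auto
    qed
  qed
  show "B = {z \<in> A <#> B. z [^] n = \<one>}"
  proof
    show "B \<subseteq> {z \<in> A <#> B. z [^] n = \<one>}"
      using subset_prod[OF A'(1) B'(1)] pow_card_subgroup[OF B'(1)] B'(2) by auto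
    show "{z \<in> A <#> B. z [^] n = \<one>} \<subseteq> B"
    proof clarify
      fix z assume z: "z \<in> A <#> B" "z [^] n = \<one>"
      then obtain a b where ab: "a \<in> A" "b \<in> B" "z = a \<otimes> b" by (auto simp: set_mult_def)
      have "a [^] n = \<one>" using pw[OF ab(1,2), of n] z ab pow_card_subgroup[OF B'(1) ab(2)] B'(2) Ac by auto
      moreover have "a [^] m = \<one>" using pow_card_subgroup[OF A'(1) ab(1)] A'(2) by simp
      ultimately have "a = \<one>" using triv ab Ac by auto
      then show "z \<in> B" using ab Bc by auto
    qed
  qed
qed

definition commuting_pairs :: "nat \<Rightarrow> nat \<Rightarrow> ('a set \<times> 'a set) set"
  where "commuting_pairs m n = {(A, B). A \<in> subs G m \<and> B \<in> subs G n \<and> A \<subseteq> centralizer B}"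

lemma finite_commuting_pairs [simp]: "finite (commuting_pairs m n)"
  by (rule finite_subset[of _ "subs G m \<times> subs G n"]) (auto simp: commuting_pairs_def)

lemma card_commuting_pairs_le:
  assumes "coprime m n" shows "card (commuting_pairs m n) \<le> card (subs G (m * n))"
proof (rule card_inj_on_le)
  show "inj_on (\<lambda>(A, B). A <#> B) (commuting_pairs m n)"
  proof (clarsimp simp: inj_on_def commuting_pairs_def)
    fix A B A' B'
    assume *: "A \<in> subs G m" "B \<in> subs G n" "A \<subseteq> centralizer B" "A' \<in> subs G m" "B' \<in> subs G n" "A' \<subseteq> centralizer B'"
      and eq: "A <#> B = A' <#> B'"
    show "A = A' \<and> B = B'"
      using commuting_prod_subs(2,3)[OF *(1-3) assms] commuting_prod_subs(2,3)[OF *(4-6) assms] eq by simp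
  qed
  show "(\<lambda>(A, B). A <#> B) ` commuting_pairs m n \<subseteq> subs G (m * n)"
    using commuting_prod_subs(1)[OF _ _ _ assms] by (auto simp: commuting_pairs_def)
qed simp

lemma card_commuting_pairs_sum:
  "card (commuting_pairs m n) = (\<Sum>B\<in>subs G n. card {A \<in> subs G m. A \<subseteq> centralizer B})"
  "card (commuting_pairs m n) = (\<Sum>A\<in>subs G m. card {B \<in> subs G n. A \<subseteq> centralizer B})"
proof -
  have "commuting_pairs m n = (\<lambda>(B, A). (A, B)) ` (SIGMA B:subs G n. {A \<in> subs G m. A \<subseteq> centralizer B})"
    by (force simp: commuting_pairs_def)
  then show "card (commuting_pairs m n) = (\<Sum>B\<in>subs G n. card {A \<in> subs G m. A \<subseteq> centralizer B})"
    by (simp add: card_image inj_on_def split_beta)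
  have "commuting_pairs m n = (SIGMA A:subs G m. {B \<in> subs G n. A \<subseteq> centralizer B})"
    by (force simp: commuting_pairs_def)
  then show "card (commuting_pairs m n) = (\<Sum>A\<in>subs G m. card {B \<in> subs G n. A \<subseteq> centralizer B})"
    by simp
qed

text \<open>
  The orbits of \<open>Y\<close> on the elements of \<open>X\<close> have length 1 or \<open>q\<close>, and \<open>X\<close> has too few elements for
  an orbit of length \<open>q\<close>.
\<close>

lemma normalizes_imp_commutes:
  assumes X: "X \<in> subs G p" and Y: "Y \<in> subs G q" "prime q" "p < q" and n: "Y \<subseteq> normzr X"
  shows "X \<subseteq> centralizer Y"
proof -
  have X': "subgroup X G" "card X = p" and Y': "subgroup Y G" "card Y = q ^ 1" using X Y by (auto simp: subs_def)
  have fX: "finite X" using finite_subgroup X' by blast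
  have "card X mod q = card (X \<inter> centralizer Y) mod q"
    by (rule fixed_elements_cong[OF Y' Y(2)]) (use X' fX n in \<open>auto simp: normzr_def subgroup.mem_carrier subset_eq\<close>)
  moreover have "card (X \<inter> centralizer Y) \<le> p" using fX X' by (metis Int_lower1 card_mono)
  ultimately have "card (X \<inter> centralizer Y) = card X" using X' Y(3) by simp
  then show ?thesis using fX by (metis Int_lower1 card_subset_eq inf.absorb_iff1)
qed

text \<open>
  Conjugation by \<open>g\<close> permutes the non-trivial elements of \<open>X\<close>, and there is only one.
\<close>

lemma normalizes_involution:
  assumes X: "X \<in> subs G 2" and n: "g \<in> normzr X" shows "g \<in> centralizer X"
proof -
  have X': "subgroup X G" "card X = 2" using X by (auto simp: subs_def)
  have g: "g \<in> carrier G" "conjg g X = X" using n by (auto simp: normzr_def)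
  obtain x where x: "X = {\<one>, x}" "x \<noteq> \<one>"
    using X' subgroup.one_closed[OF X'(1)] by (auto simp: card_2_iff doubleton_eq_iff)
  have xc: "x \<in> carrier G" using x X' subgroup.subset by blast
  have "g \<otimes> x \<otimes> inv g \<in> X" using g x by (auto simp: conjg_def)
  moreover have "g \<otimes> x \<otimes> inv g \<noteq> \<one>" using x(2) xc g(1)
    by (metis inv_solve_right' l_cancel_one one_closed m_closed l_one)
  ultimately have "g \<otimes> x \<otimes> inv g = x" using x by blast
  then have "g \<otimes> x = x \<otimes> g" using conj_eq_iff_commute g xc by blast
  then show ?thesis using g x by (auto simp: centralizer_def)
qed

text \<open>
  The fixed points of \<open>Y\<close> on the subgroups of order \<open>p\<close> are those that it normalizes, hence those
  that it centralizes.
\<close>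

lemma card_commuting_mod:
  assumes Y: "Y \<in> subs G q" "prime q" "p < q"
  shows "card (subs G p) mod q = card {X \<in> subs G p. X \<subseteq> centralizer Y} mod q"
proof -
  have Y': "subgroup Y G" "card Y = q ^ 1" using Y by (auto simp: subs_def)
  have "card (subs G p) mod q = card {H \<in> subs G p. Y \<subseteq> normzr H} mod q"
    by (rule fixed_subsets_cong[OF Y' Y(2)])
      (use subs_in_Pow conjg_subs[OF subgroup.mem_carrier[OF Y'(1)]] in \<open>auto\<close>)
  also have "{H \<in> subs G p. Y \<subseteq> normzr H} = {X \<in> subs G p. X \<subseteq> centralizer Y}"
  proof -
    have "Y \<subseteq> normzr X \<longleftrightarrow> X \<subseteq> centralizer Y" if X: "X \<in> subs G p" for X
    proof -
      have Xc: "X \<subseteq> carrier G" and Yc: "Y \<subseteq> carrier G"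
        using X Y'(1) by (auto simp: subs_def subgroup.subset)
      show ?thesis
        using normalizes_imp_commutes[OF X Y] centralizer_subset_normzr[OF Xc] subset_centralizer_commute[OF Xc Yc] by blast
    qed
    then show ?thesis by blast
  qed
  finally show ?thesis .
qed

lemma subs_carrier: "X \<in> subs G n \<Longrightarrow> X \<subseteq> carrier G"
  by (simp add: subs_def subgroup.subset)

lemma finite_conj_class: "H \<subseteq> carrier G \<Longrightarrow> finite (conj_class H)"
  using fin by (simp add: conj_class_def)

lemma sum_card_subs_le:
  assumes "finite F" shows "(\<Sum>n\<in>F. card (subs G n)) \<le> Sub G"
proof -
  have "(\<Sum>n\<in>F. card (subs G n)) = card (\<Union>n\<in>F. subs G n)"
    using assms by (intro card_UN_disjoint[symmetric] ballI impI finite_subs) (auto simp: subs_def)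
  also have "\<dots> \<le> Sub G"
    unfolding Sub_def by (rule card_mono[OF finite_subgroups]) (auto simp: subs_def)
  finally show ?thesis .
qed

lemma subs_one: "subs G 1 = {{\<one>}}"
proof -
  have "H = {\<one>}" if "H \<in> subs G 1" for H
    using subsD(2)[OF that] subgroup.one_closed[OF subsD(1)[OF that]] by (metis card_1_singletonE singletonD)
  moreover have "{\<one>} \<in> subs G 1" using triv_subgroup by (simp add: subs_def)
  ultimately show ?thesis by blast
qed

lemma subs_order: "subs G (order G) = {carrier G}"
proof -
  have "H = carrier G" if "subgroup H G" "card H = order G" for H
    using that subgroup_card_eq[OF that(1) subgroup_self] subgroup.subset by (auto simp: order_def)
  then show ?thesis using subgroup_self by (auto simp: subs_def order_def)
qed

text \<open>
  The group permutes its subgroups of order \<open>p\<close> by conjugation; their number is 1 modulo \<open>p\<close>, so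
  one of them is fixed.
\<close>

lemma p_group_normal_subgroup:
  assumes "prime p" "order G = p ^ k" "order G \<noteq> 1"
  shows "\<exists>N \<in> subs G p. N \<lhd> G"
proof -
  have pdvd: "p dvd order G" using assms by (cases k) auto
  have c: "subgroup (carrier G) G" "card (carrier G) = p ^ k"
    using subgroup_self assms(2) by (auto simp: order_def)
  have "card (subs G p) mod p = card {H \<in> subs G p. carrier G \<subseteq> normzr H} mod p"
    by (rule fixed_subsets_cong[OF c assms(1) subs_in_Pow]) (auto simp: conjg_subs)
  then have "card {H \<in> subs G p. carrier G \<subseteq> normzr H} mod p = 1"
    using subs_prime_mod[OF assms(1) pdvd] by simp
  then obtain H where "H \<in> subs G p" "carrier G \<subseteq> normzr H"
    by (metis (mono_tags, lifting) card.empty empty_Collect_eq mod_0 zero_neq_one)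
  then show ?thesis by (auto simp: normal_iff_conjg subs_def normzr_def)
qed

text \<open>
  The product of the two subgroups is then a subgroup of order \<open>q * q\<close>.
\<close>

lemma normalizes_distinct_dvd:
  assumes "Y \<in> subs G q" "Z \<in> subs G q" "prime q" "Y \<noteq> Z" "Y \<subseteq> normzr Z"
  shows "q * q dvd order G"
proof -
  have Y: "subgroup Y G" "card Y = q" and Z: "subgroup Z G" "card Z = q"
    using assms by (auto simp: subs_def)
  have "subgroup (Y <#> Z) G" using prod_subgroup Y Z assms(5) by blast
  moreover have "card (Y <#> Z) = q * q"
    using card_prod[OF Y(1) Z(1) prime_subs_disjoint[OF assms(1,3,2,4)]] Y Z by simp
  ultimately show ?thesis using card_subgroup_dvd by metis
qed

lemma conj_class_conjg:
  assumes "A \<in> conj_class H" "g \<in> carrier G" "H \<subseteq> carrier G" shows "conjg g A \<in> conj_class H"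
  using assms by (auto simp: conj_class_def conjg_mult[symmetric])

text \<open>
  Sylow's conjugacy theorem for Sylow subgroups of prime order. The size of the class of \<open>Y\<close>
  divides the index of \<open>Y\<close>, so \<open>q\<close> does not divide it. A subgroup \<open>Z\<close> of order \<open>q\<close> therefore
  normalizes some member of the class, and it must be equal to that member.
\<close>

lemma conj_class_eq_subs:
  assumes q: "prime q" "\<not> q * q dvd order G" and Y: "Y \<in> subs G q"
  shows "conj_class Y = subs G q"
proof (rule ccontr)
  assume "conj_class Y \<noteq> subs G q"
  then obtain Z where Z: "Z \<in> subs G q" "Z \<notin> conj_class Y"
    using conj_class_subset_subs[OF Y] by blast
  have Y': "subgroup Y G" "card Y = q" "Y \<subseteq> carrier G" using Y by (auto simp: subs_def subgroup.subset)
  have Z': "subgroup Z G" "card Z = q ^ 1" using Z by (auto simp: subs_def)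
  have fc: "finite (conj_class Y)" using finite_conj_class Y'(3) .
  have "q dvd card (normzr Y)"
    using card_subgroup_dvd_subgroup[OF Y'(1) normzr_subgroup[OF Y'(3)] subset_normzr[OF Y'(1)]] Y'(2) by simp
  then have nd: "\<not> q dvd card (conj_class Y)"
    using card_class_mult_card_normzr[OF Y'(3)] q(2) by (metis mult_dvd_mono)
  have "card (conj_class Y) mod q = card {H \<in> conj_class Y. Z \<subseteq> normzr H} mod q"
  proof (rule fixed_subsets_cong[OF Z' q(1) _ fc])
    show "conj_class Y \<subseteq> Pow (carrier G)"
      using conj_class_subset_subs[OF Y] subs_in_Pow by blast
    show "conjg g H \<in> conj_class Y" if "g \<in> Z" "H \<in> conj_class Y" for g H
      using that conj_class_conjg Y'(3) Z'(1) subgroup.mem_carrier by metis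
  qed
  then have "card {H \<in> conj_class Y. Z \<subseteq> normzr H} \<noteq> 0" using nd by (metis (no_types, lifting) mod_0 dvd_eq_mod_eq_0)
  then obtain H where H: "H \<in> conj_class Y" "Z \<subseteq> normzr H" by (metis (mono_tags, lifting) card.empty empty_Collect_eq)
  then show False
    using normalizes_distinct_dvd[OF Z(1) _ q(1) _ H(2)] conj_class_subset_subs[OF Y] Z(2) q(2) by blast
qed

lemma conjg_centralizer:
  assumes "A \<subseteq> carrier G" "B \<subseteq> carrier G" "g \<in> carrier G" "A \<subseteq> centralizer B"
  shows "conjg g A \<subseteq> centralizer (conjg g B)"
proof -
  have "(g \<otimes> a \<otimes> inv g) \<otimes> (g \<otimes> b \<otimes> inv g) = (g \<otimes> b \<otimes> inv g) \<otimes> (g \<otimes> a \<otimes> inv g)"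
    if "a \<in> A" "b \<in> B" for a b
  proof -
    have "a \<otimes> b = b \<otimes> a" "a \<in> carrier G" "b \<in> carrier G" using that assms by (auto simp: centralizer_def)
    then show ?thesis using assms(3) by (metis conj_hom)
  qed
  then show ?thesis using assms by (auto simp: conjg_def centralizer_def)
qed

lemma card_centralized_conjg:
  assumes "Y \<subseteq> carrier G" "g \<in> carrier G"
  shows "card {X \<in> subs G p. X \<subseteq> centralizer (conjg g Y)} = card {X \<in> subs G p. X \<subseteq> centralizer Y}"
proof (rule bij_betw_same_card[symmetric])
  show "bij_betw (conjg g) {X \<in> subs G p. X \<subseteq> centralizer Y} {X \<in> subs G p. X \<subseteq> centralizer (conjg g Y)}"
  proof (rule bij_betw_byWitness[where f' = "conjg (inv g)"])
    have "conjg (inv g) (conjg g X) = X" "conjg g (conjg (inv g) X) = X" if "X \<in> subs G p" for X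
      using conjg_inv_cancel[OF assms(2)] subgroup.subset[OF subsD(1)[OF that]] by auto
    then show "\<forall>X\<in>{X \<in> subs G p. X \<subseteq> centralizer Y}. conjg (inv g) (conjg g X) = X"
      "\<forall>X\<in>{X \<in> subs G p. X \<subseteq> centralizer (conjg g Y)}. conjg g (conjg (inv g) X) = X"
      by blast+
    show "conjg g ` {X \<in> subs G p. X \<subseteq> centralizer Y} \<subseteq> {X \<in> subs G p. X \<subseteq> centralizer (conjg g Y)}"
    proof clarify
      fix X assume X: "X \<in> subs G p" "X \<subseteq> centralizer Y"
      have "conjg g X \<subseteq> centralizer (conjg g Y)"
        using X assms subs_carrier[OF X(1)] by (intro conjg_centralizer) auto
      then show "conjg g X \<in> subs G p \<and> conjg g X \<subseteq> centralizer (conjg g Y)"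
        using X assms conjg_subs by auto
    qed
    show "conjg (inv g) ` {X \<in> subs G p. X \<subseteq> centralizer (conjg g Y)} \<subseteq> {X \<in> subs G p. X \<subseteq> centralizer Y}"
    proof clarify
      fix X assume X: "X \<in> subs G p" "X \<subseteq> centralizer (conjg g Y)"
      have "conjg (inv g) X \<subseteq> centralizer (conjg (inv g) (conjg g Y))"
        using X assms conjg_carrier subs_carrier[OF X(1)] by (intro conjg_centralizer) auto
      then show "conjg (inv g) X \<in> subs G p \<and> conjg (inv g) X \<subseteq> centralizer Y"
        using X assms conjg_subs conjg_inv_cancel by auto
    qed
  qed
qed

end

section \<open>Groups without normal subgroups of prime order\<close>

locale group_no_prime_normal = finite_group +
  assumes nontrivial: "order G \<noteq> 1"
    and no_prime_normal: "prime (card N) \<Longrightarrow> \<not> N \<lhd> G"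

context group_no_prime_normal begin

lemma not_prime_power: "prime p \<Longrightarrow> order G \<noteq> p ^ k"
  using p_group_normal_subgroup[of p k] nontrivial no_prime_normal by (auto simp: subs_def)

lemma subs_not_normal: "X \<in> subs G p \<Longrightarrow> prime p \<Longrightarrow> \<not> X \<lhd> G"
  using no_prime_normal by (auto simp: subs_def)

lemma conj_class_ge_2:
  assumes X: "X \<in> subs G p" "prime p" shows "2 \<le> card (conj_class X)"
proof -
  have Xc: "subgroup X G" "X \<subseteq> carrier G" using X by (auto simp: subs_def subgroup.subset)
  obtain g where g: "g \<in> carrier G" "conjg g X \<noteq> X"
    using subs_not_normal[OF X] Xc by (auto simp: normal_iff_conjg)
  have "{X, conjg g X} \<subseteq> conj_class X"
    using g Xc conjg_in_class self_in_class by blast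
  moreover have "finite (conj_class X)" using finite_conj_class Xc(2) .
  ultimately show ?thesis using g(2) by (metis card_2_iff card_mono)
qed

lemma card_subs_ge:
  assumes p: "prime p" "p dvd order G" shows "p + 1 \<le> card (subs G p)" "card (subs G p) mod p = 1"
proof -
  show m: "card (subs G p) mod p = 1" using subs_prime_mod p by blast
  have "card (subs G p) \<noteq> 1"
    using unique_subs_normal subs_not_normal[OF _ p(1)] by (metis card_1_singletonE singletonI)
  then show "p + 1 \<le> card (subs G p)"
    using m by (metis Suc_eq_plus1 linorder_not_less less_Suc_eq_le mod_less mod_self not_less_eq order.strict_iff_order zero_neq_one)
qed

text \<open>
  Otherwise \<open>G\<close> would be the product of a commuting pair, and both factors would be normal.
\<close>

lemma order_ne_prime_mult:
  assumes "commuting_pairs p q \<noteq> {}" "prime p" "prime q" "p \<noteq> q" shows "order G \<noteq> p * q"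
proof
  assume o: "order G = p * q"
  obtain X Y where XY: "X \<in> subs G p" "Y \<in> subs G q" "X \<subseteq> centralizer Y"
    using assms(1) by (auto simp: commuting_pairs_def)
  have X: "subgroup X G" "X \<subseteq> carrier G" "card X = p" and Y: "subgroup Y G" "Y \<subseteq> carrier G"
    using XY by (auto simp: subs_def subgroup.subset)
  have "X <#> Y \<in> subs G (order G)"
    using commuting_prod_subs(1)[OF XY] assms primes_coprime o by auto
  then have car: "X <#> Y = carrier G" using subs_order by auto
  have "X \<subseteq> normzr X" "Y \<subseteq> normzr X"
    using subset_normzr[OF X(1)] subset_centralizer_commute[OF X(2) Y(2)] centralizer_subset_normzr[OF X(2)] XY(3) by blast+
  then have "X <#> Y \<subseteq> normzr X"
    using subgroup.m_closed[OF normzr_subgroup[OF X(2)]] by (auto simp: set_mult_def)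
  then have "X \<lhd> G" using car X(1) by (auto simp: normal_iff_conjg normzr_def)
  then show False using subs_not_normal XY(1) assms(2) by blast
qed

text \<open>
  The basic inequality: the trivial subgroup, \<open>G\<close> itself, the subgroups of orders \<open>p\<close> and \<open>q\<close>, the
  products of commuting pairs and the subgroups of the orders in \<open>D\<close> are all different. The
  products have order \<open>p * q\<close>, which is not the order of \<open>G\<close> as soon as there is a commuting pair.
\<close>

lemma two_primes_bound:
  assumes p: "prime p" "p dvd order G" and q: "prime q" "q dvd order G" and ne: "p \<noteq> q"
    and D: "finite D" "D \<inter> {1, p, q, p * q, order G} = {}"
  shows "2 + card (subs G p) + card (subs G q) + card (commuting_pairs p q) + (\<Sum>d\<in>D. card (subs G d)) \<le> Sub G"
proof -
  let ?s = "\<lambda>n. card (subs G n)"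
  have s1: "?s 1 = 1" "?s (order G) = 1" using subs_one subs_order by auto
  have o: "order G \<noteq> p" "order G \<noteq> q" "order G \<noteq> 1"
    using not_prime_power[of _ 1] p q nontrivial by auto
  have p1: "p \<noteq> 1" "q \<noteq> 1" "p * q \<noteq> 1" "p * q \<noteq> p" "p * q \<noteq> q"
    using p q by (auto simp: prime_nat_iff)
  show ?thesis
  proof (cases "commuting_pairs p q = {}")
    case True
    have "(\<Sum>n\<in>{1, p, q, order G} \<union> D. ?s n) \<le> Sub G" using D by (intro sum_card_subs_le) simp
    also have "(\<Sum>n\<in>{1, p, q, order G} \<union> D. ?s n) = (\<Sum>n\<in>{1, p, q, order G}. ?s n) + (\<Sum>n\<in>D. ?s n)"
      using D by (intro sum.union_disjoint) auto
    finally show ?thesis using True s1 o p1 ne by simp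
  next
    case False
    have o2: "order G \<noteq> p * q" using order_ne_prime_mult[OF False] p q ne by blast
    have "(\<Sum>n\<in>{1, p, q, p * q, order G} \<union> D. ?s n) \<le> Sub G" using D by (intro sum_card_subs_le) simp
    also have "(\<Sum>n\<in>{1, p, q, p * q, order G} \<union> D. ?s n) = (\<Sum>n\<in>{1, p, q, p * q, order G}. ?s n) + (\<Sum>n\<in>D. ?s n)"
      using D by (intro sum.union_disjoint) auto
    moreover have "card (commuting_pairs p q) \<le> ?s (p * q)"
      using card_commuting_pairs_le primes_coprime p q ne by blast
    ultimately show ?thesis using s1 o o2 p1 ne by simp
  qed
qed

lemma commuting_pairs_ge:
  assumes q: "prime q" and pq: "p < q"
  shows "card (subs G q) * (card (subs G p) mod q) \<le> card (commuting_pairs p q)"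
proof -
  have "card (subs G p) mod q \<le> card {A \<in> subs G p. A \<subseteq> centralizer B}" if "B \<in> subs G q" for B
    using card_commuting_mod[OF that q pq] by (metis mod_less_eq_dividend)
  then have "(\<Sum>B\<in>subs G q. card (subs G p) mod q) \<le> card (commuting_pairs p q)"
    unfolding card_commuting_pairs_sum(1) by (intro sum_mono) blast
  then show ?thesis by simp
qed

end

section \<open>Prime divisors of the order are at most 3\<close>

lemma mod_eq_1_ge:
  assumes "2 \<le> n" "n mod q = 1" shows "q + 1 \<le> (n::nat)"
proof (rule ccontr)
  assume "\<not> q + 1 \<le> n"
  then have "n < q \<or> n = q" by linarith
  then show False using assms by auto
qed

lemma not_prime_small: "\<not> prime (4::nat)" "\<not> prime (6::nat)" "\<not> prime (8::nat)" "\<not> prime (9::nat)" "\<not> prime (10::nat)"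
proof -
  have *: "\<not> prime n" if "d dvd n" "1 < d" "d < n" for d n :: nat
    using that by (auto simp: prime_nat_iff)
  show "\<not> prime (4::nat)" "\<not> prime (6::nat)" "\<not> prime (8::nat)" "\<not> prime (9::nat)" "\<not> prime (10::nat)"
    using *[of 2 4] *[of 2 6] *[of 2 8] *[of 3 9] *[of 2 10] by simp_all
qed

lemma prime_less_5: assumes "prime (p::nat)" "p < 5" shows "p = 2 \<or> p = 3"
proof -
  have "p = 0 \<or> p = 1 \<or> p = 2 \<or> p = 3 \<or> p = 4" using assms(2) by linarith
  then show ?thesis using assms(1) not_prime_small by auto
qed

lemma prime_5_to_10: assumes "prime (p::nat)" "5 \<le> p" "p \<le> 10" shows "p = 5 \<or> p = 7"
proof -
  have "p = 5 \<or> p = 6 \<or> p = 7 \<or> p = 8 \<or> p = 9 \<or> p = 10" using assms(2,3) by linarith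
  then show ?thesis using assms(1) not_prime_small by auto
qed

lemma prime_power_split:
  assumes "prime (q::nat)" "0 < n" obtains k m where "n = q ^ k * m" "\<not> q dvd m"
  using multiplicity_decompose'[of n q] assms by (metis not_gr_zero not_prime_unit)

text \<open>
  Here \<open>a\<close> and \<open>b\<close> stand for the numbers of subgroups of orders \<open>q\<close> and \<open>p\<close>, and \<open>a * (b mod q)\<close>
  for the commuting pairs that are forced. If \<open>b mod q\<close> is not 0, the bound 22 leaves only \<open>q = 5\<close>
  and \<open>b = 6\<close>; but 6 is not 1 modulo 2 or 3, the only primes below 5.
\<close>

lemma dvd_if_count_small:
  fixes a b p q :: nat
  assumes a: "q + 1 \<le> a" and b: "p + 1 \<le> b" "b mod p = 1" and le: "a + b + a * (b mod q) \<le> 22"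
    and pq: "p < q" "5 \<le> q" "prime p" "prime q"
  shows "q dvd b"
proof (rule ccontr)
  assume "\<not> q dvd b"
  then have r: "b mod q \<noteq> 0" by (simp add: dvd_eq_mod_eq_0)
  have p2: "2 \<le> p" using pq(3) by (rule prime_ge_2_nat)
  show False
  proof (cases "b < q")
    case True
    then have "b mod q = b" by simp
    then have "a * 3 \<le> a * (b mod q)" using b(1) p2 by (intro mult_left_mono) auto
    then show False using le a pq b p2 by linarith
  next
    case False
    then have bq: "q < b" using r by (metis linorder_neqE_nat mod_self)
    have "a * 1 \<le> a * (b mod q)" using r by (intro mult_left_mono) auto
    then have "q \<le> 10" "q \<noteq> 7" using le a bq by linarith+
    then have q5: "q = 5" using prime_5_to_10 pq by blast
    have "\<not> 2 \<le> b mod q"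
    proof
      assume "2 \<le> b mod q"
      then have "a * 2 \<le> a * (b mod q)" by (intro mult_left_mono) auto
      then show False using le a bq q5 by linarith
    qed
    then have "b mod q = 1" using r by linarith
    then have b1: "b mod 5 = 1" using q5 by simp
    have "b \<le> 10" using \<open>a * 1 \<le> a * (b mod q)\<close> le a q5 by linarith
    then have "b = 6" using b1 bq q5 by presburger
    then show False using prime_less_5[OF pq(3)] pq(1) q5 b(2) by auto
  qed
qed

locale few_subgroups = group_no_prime_normal +
  assumes few: "Sub G \<le> 24"

context few_subgroups begin

lemma obtain_largest_prime:
  obtains q where "prime q" "q dvd order G" "\<And>p. prime p \<Longrightarrow> p dvd order G \<Longrightarrow> p \<le> q"
proof -
  let ?P = "{p. prime p \<and> p dvd order G}"
  have "finite ?P" by (rule finite_subset[of _ "{..order G}"]) (use order_pos in \<open>auto intro: dvd_imp_le\<close>)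
  moreover have "?P \<noteq> {}" using prime_factor_nat[OF nontrivial] by blast
  ultimately have "Max ?P \<in> ?P" "\<And>p. p \<in> ?P \<Longrightarrow> p \<le> Max ?P" by (rule Max_in, simp)
  then show thesis using that by blast
qed

lemma exists_other_prime:
  assumes "prime q" "q dvd order G"
  obtains p where "prime p" "p dvd order G" "p \<noteq> q"
proof -
  obtain k m where km: "order G = q ^ k * m" "\<not> q dvd m"
    using prime_power_split[OF assms(1) order_pos] by blast
  have "m \<noteq> 1"
  proof
    assume "m = 1"
    then have "order G = q ^ k" using km by simp
    then show False using not_prime_power[OF assms(1)] by blast
  qed
  then obtain p where "prime p" "p dvd m" using prime_factor_nat by blast
  then show thesis using that[of p] km by (metis dvd_mult)
qed

lemma exists_order_subs:
  assumes "prime p" "p ^ k dvd order G" shows "1 \<le> card (subs G (p ^ k))"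
proof -
  have "subs G (p ^ k) \<noteq> {}" using sylow_subs[OF assms] by blast
  then show ?thesis by (simp add: Suc_le_eq card_gt_0_iff)
qed

lemma large_prime_dvd:
  assumes q: "prime q" "q dvd order G" "5 \<le> q" and p: "prime p" "p dvd order G" "p < q"
  shows "q dvd card (subs G p)"
proof (rule dvd_if_count_small)
  show "q + 1 \<le> card (subs G q)" "p + 1 \<le> card (subs G p)" "card (subs G p) mod p = 1"
    using card_subs_ge p q by auto
  have "2 + card (subs G p) + card (subs G q) + card (commuting_pairs p q) \<le> Sub G"
    using two_primes_bound[OF p(1,2) q(1,2), of "{}"] p(3) by simp
  then show "card (subs G q) + card (subs G p) + card (subs G q) * (card (subs G p) mod q) \<le> 22"
    using commuting_pairs_ge[OF q(1) p(3)] few by linarith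
qed (use p q in auto)

text \<open>
  Suppose that \<open>q * q\<close> divides the order. Then some \<open>X\<close> of order \<open>p\<close> commutes with some \<open>Y\<close> of order
  \<open>q\<close>: otherwise \<open>q\<close> does not divide the order of the normalizer of \<open>X\<close>, and the class of \<open>X\<close> has
  at least \<open>q * q\<close> members. As \<open>q\<close> divides the number of subgroups of order \<open>p\<close>, a subgroup of order
  \<open>q\<close> that commutes with one of them commutes with at least \<open>q\<close>. Now either some \<open>X\<close> commutes with
  two and hence with at least \<open>q + 1\<close> subgroups of order \<open>q\<close>, which makes \<open>(q + 1) * q\<close> commuting
  pairs, or no subgroup of order \<open>p\<close> commutes both with \<open>Y\<close> and with another conjugate of \<open>Y\<close>, which
  makes at least \<open>2 * q\<close> subgroups of order \<open>p\<close> and as many pairs.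
\<close>

lemma large_prime_square_not_dvd:
  assumes q: "prime q" "q dvd order G" "5 \<le> q" and p: "prime p" "p dvd order G" "p < q"
  shows "\<not> q * q dvd order G"
proof
  assume qq: "q * q dvd order G"
  let ?f = "\<lambda>Y. card {A \<in> subs G p. A \<subseteq> centralizer Y}"
  let ?g = "\<lambda>X. card {B \<in> subs G q. X \<subseteq> centralizer B}"
  have a: "q + 1 \<le> card (subs G q)" using card_subs_ge q by auto
  have p2: "2 \<le> p" "2 \<le> q" using p(1) q(1) prime_ge_2_nat by auto
  have "{q * q} \<inter> {1, p, q, p * q, order G} = {}"
    using not_prime_power[OF q(1), of 2] p(3) p2 by (auto simp: power2_eq_square)
  moreover have "1 \<le> card (subs G (q * q))"
    using exists_order_subs[OF q(1), of 2] qq by (simp add: power2_eq_square)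
  ultimately have bound: "card (subs G p) + card (subs G q) + card (commuting_pairs p q) \<le> 21"
    using two_primes_bound[OF p(1,2) q(1,2), of "{q * q}"] p(3) few by simp
  obtain X0 where X0: "X0 \<in> subs G p" using sylow_subs[of p 1] p by auto
  have "commuting_pairs p q \<noteq> {}"
  proof
    assume e: "commuting_pairs p q = {}"
    have "\<not> q dvd card (normzr X0)"
    proof
      assume "q dvd card (normzr X0)"
      then obtain Y where Y: "Y \<in> subs G q" "Y \<subseteq> normzr X0"
        using cauchy_in_subgroup[OF normzr_subgroup[OF subs_carrier[OF X0]] q(1)] by blast
      then have "(X0, Y) \<in> commuting_pairs p q"
        using normalizes_imp_commutes[OF X0 Y(1) q(1) p(3)] X0 by (simp add: commuting_pairs_def)
      with e show False by blast
    qed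
    then have "coprime (q * q) (card (normzr X0))" using q(1) by (simp add: prime_imp_coprime)
    then have "q * q dvd card (conj_class X0)"
      using qq card_class_mult_card_normzr[OF subs_carrier[OF X0]] by (metis coprime_dvd_mult_left_iff)
    moreover have "card (conj_class X0) \<le> card (subs G p)"
      using conj_class_subset_subs[OF X0] by (simp add: card_mono)
    ultimately have "q * q \<le> card (subs G p)"
      using conj_class_ge_2[OF X0 p(1)] by (meson dvd_imp_le le_trans less_le_trans pos2)
    moreover have "5 * 5 \<le> q * q" using q(3) by (intro mult_mono) auto
    ultimately show False using bound by linarith
  qed
  then obtain X Y where XY: "X \<in> subs G p" "Y \<in> subs G q" "X \<subseteq> centralizer Y" by (auto simp: commuting_pairs_def)
  have f_ge: "q \<le> ?f B" if B: "B \<in> subs G q" "A \<in> subs G p" "A \<subseteq> centralizer B" for A B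
  proof (rule dvd_imp_le)
    show "q dvd ?f B"
      using card_commuting_mod[OF B(1) q(1) p(3)] large_prime_dvd[OF q p] by (simp add: dvd_eq_mod_eq_0)
    show "0 < ?f B" using B by (auto simp: card_gt_0_iff)
  qed
  show False
  proof (cases "\<exists>A\<in>subs G p. 2 \<le> ?g A")
    case True
    then obtain A where A: "A \<in> subs G p" "2 \<le> ?g A" by blast
    have Ac: "subgroup (centralizer A) G" "A \<subseteq> carrier G" using centralizer_subgroup subs_carrier A by auto
    have eq: "{B \<in> subs G q. A \<subseteq> centralizer B} = {B \<in> subs G q. B \<subseteq> centralizer A}"
      using subset_centralizer_commute[OF Ac(2)] subs_carrier by blast
    have "{B \<in> subs G q. A \<subseteq> centralizer B} \<noteq> {}" using A(2) by (metis card.empty not_numeral_le_zero)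
    then obtain B where B: "B \<in> subs G q" "B \<subseteq> centralizer A" unfolding eq by blast
    have "q dvd card (centralizer A)"
      using card_subgroup_dvd_subgroup[OF subsD(1)[OF B(1)] Ac(1) B(2)] subsD(2)[OF B(1)] by simp
    then have "?g A mod q = 1" unfolding eq by (rule subs_prime_mod_subgroup[OF Ac(1) q(1)])
    then have g: "q + 1 \<le> ?g A" using A(2) mod_eq_1_ge by blast
    have "(q + 1) * q \<le> ?g A * q" using g by (rule mult_right_mono) simp
    also have "\<dots> = (\<Sum>B\<in>{B \<in> subs G q. A \<subseteq> centralizer B}. q)" by simp
    also have "\<dots> \<le> (\<Sum>B\<in>{B \<in> subs G q. A \<subseteq> centralizer B}. ?f B)"
      using f_ge A(1) by (intro sum_mono) blast
    also have "\<dots> \<le> (\<Sum>B\<in>subs G q. ?f B)" by (rule sum_mono2) auto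
    also have "\<dots> = card (commuting_pairs p q)" by (simp add: card_commuting_pairs_sum(1))
    finally have "(q + 1) * q \<le> card (commuting_pairs p q)" .
    moreover have "30 \<le> (q + 1) * q" using mult_le_mono[of 6 "q + 1" 5 q] q(3) by simp
    ultimately have "30 \<le> card (commuting_pairs p q)" by (meson le_trans)
    then show False using bound by linarith
  next
    case False
    obtain Y' where Y': "Y' \<in> conj_class Y" "Y' \<noteq> Y"
    proof -
      have "card (conj_class Y) \<le> 1" if "\<forall>Z\<in>conj_class Y. Z = Y"
        using that by (metis card.empty card.insert card_mono empty_iff finite.emptyI finite.insertI insertI1 subsetI One_nat_def)
      then show thesis using that conj_class_ge_2[OF XY(2) q(1)] by fastforce
    qed
    then obtain g where g: "g \<in> carrier G" "Y' = conjg g Y" by (auto simp: conj_class_def)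
    have Y's: "Y' \<in> subs G q" using g conjg_subs XY by blast
    have fY: "q \<le> ?f Y" using f_ge XY by blast
    have fY': "q \<le> ?f Y'" using fY card_centralized_conjg[OF subs_carrier[OF XY(2)] g(1)] g(2) by simp
    have "{A \<in> subs G p. A \<subseteq> centralizer Y} \<inter> {A \<in> subs G p. A \<subseteq> centralizer Y'} = {}"
    proof (rule ccontr)
      assume "{A \<in> subs G p. A \<subseteq> centralizer Y} \<inter> {A \<in> subs G p. A \<subseteq> centralizer Y'} \<noteq> {}"
      then obtain A where A: "A \<in> subs G p" "A \<subseteq> centralizer Y" "A \<subseteq> centralizer Y'" by blast
      then have "{Y, Y'} \<subseteq> {B \<in> subs G q. A \<subseteq> centralizer B}" using XY Y's by blast
      then have "card {Y, Y'} \<le> ?g A" by (intro card_mono) auto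
      then show False using Y'(2) A(1) False by auto
    qed
    then have "?f Y + ?f Y' = card ({A \<in> subs G p. A \<subseteq> centralizer Y} \<union> {A \<in> subs G p. A \<subseteq> centralizer Y'})"
      by (intro card_Un_disjoint[symmetric]) auto
    also have "\<dots> \<le> card (subs G p)" by (rule card_mono) auto
    finally have "2 * q \<le> card (subs G p)" using fY fY' by linarith
    moreover have "(\<Sum>B\<in>{Y, Y'}. ?f B) \<le> (\<Sum>B\<in>subs G q. ?f B)"
      using XY Y's by (intro sum_mono2) auto
    then have "2 * q \<le> card (commuting_pairs p q)"
      using fY fY' Y'(2) by (simp add: card_commuting_pairs_sum(1))
    ultimately show False using bound a q(3) by linarith
  qed
qed

text \<open>
  All subgroups of order \<open>q\<close> are conjugate to \<open>Y\<close>, so each of them lies in some subgroup of order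
  \<open>n\<close>. No two of them lie in the same one, since their product has \<open>q * q\<close> elements.
\<close>

lemma overgroup_count:
  assumes q: "prime q" "\<not> q * q dvd order G" and Y: "Y \<in> subs G q"
    and K: "K \<in> subs G n" "Y \<subseteq> K" and n: "n < q * q"
  shows "card (subs G q) \<le> card (subs G n)"
proof -
  have "\<exists>L \<in> subs G n. Z \<subseteq> L" if Z: "Z \<in> subs G q" for Z
  proof -
    obtain g where "g \<in> carrier G" "Z = conjg g Y"
      using conj_class_eq_subs[OF q Y] Z by (auto simp: conj_class_def)
    then show ?thesis using conjg_subs K conjg_mono by metis
  qed
  then obtain L where L: "\<And>Z. Z \<in> subs G q \<Longrightarrow> L Z \<in> subs G n \<and> Z \<subseteq> L Z" by metis
  have "inj_on L (subs G q)"
  proof (rule inj_onI, rule ccontr)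
    fix Z W assume ZW: "Z \<in> subs G q" "W \<in> subs G q" "L Z = L W" "Z \<noteq> W"
    have sub: "subgroup Z G" "subgroup W G" "card Z = q" "card W = q"
      using subsD[OF ZW(1)] subsD[OF ZW(2)] by auto
    have M: "subgroup (L Z) G" "card (L Z) = n" "Z \<subseteq> L Z" "W \<subseteq> L Z" using L ZW subsD by metis+
    have "Z <#> W \<subseteq> L Z"
      using M subgroup.m_closed[OF M(1)] by (auto simp: set_mult_def)
    then have "card (Z <#> W) \<le> n" using M(2) finite_subgroup[OF M(1)] card_mono by metis
    moreover have "card (Z <#> W) = q * q"
      using card_prod[OF sub(1,2) prime_subs_disjoint[OF ZW(1) q(1) ZW(2,4)]] sub by simp
    ultimately show False using n by simp
  qed
  then show ?thesis by (rule card_inj_on_le) (use L in auto)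
qed

text \<open>
  Let \<open>a\<close> be the number of subgroups of order \<open>q\<close>. They form one class because \<open>q * q\<close> does not
  divide the order, so the order is \<open>a\<close> times that of the normalizer \<open>N\<close> of one of them, \<open>Y\<close>. For
  every other prime divisor \<open>p\<close> of the order, \<open>q\<close> divides the number of subgroups of order \<open>p\<close>.

  If \<open>N\<close> is larger than \<open>Y\<close>, it contains a subgroup of order \<open>r * q\<close> for another prime \<open>r\<close>, and then
  there are at least \<open>a\<close> of this order. That leaves \<open>q = 5\<close> and \<open>a = 6\<close>, so that 2 and 3 divide the
  order, and the at least 10 subgroups of order 3 are too many. If \<open>N = Y\<close>, the order is \<open>a * q\<close>, and
  the bound leaves 30, 55 and 80 for \<open>q = 5\<close> and 56 and 105 for \<open>q = 7\<close>, to be excluded one by one.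
\<close>

theorem largest_prime_le_3:
  assumes q: "prime q" "q dvd order G" and largest: "\<And>p. prime p \<Longrightarrow> p dvd order G \<Longrightarrow> p \<le> q"
  shows "q \<le> 3"
proof (rule ccontr)
  assume "\<not> q \<le> 3"
  moreover have "q \<noteq> 4" using q(1) not_prime_small by blast
  ultimately have q5: "5 \<le> q" by linarith
  obtain p0 where p0: "prime p0" "p0 dvd order G" "p0 \<noteq> q" using exists_other_prime q by metis
  have less: "p < q" if "prime p" "p dvd order G" "p \<noteq> q" for p
    using largest[OF that(1,2)] that(3) by linarith
  have qq: "\<not> q * q dvd order G" using large_prime_square_not_dvd q q5 p0 less by blast
  have s_ge: "q \<le> card (subs G p)" if "prime p" "p dvd order G" "p \<noteq> q" for p
    using large_prime_dvd[OF q q5 that(1,2) less[OF that]] card_subs_ge(1)[OF that(1,2)]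
    by (intro dvd_imp_le) auto
  define a where "a = card (subs G q)"
  have a: "q + 1 \<le> a" "a mod q = 1" using card_subs_ge q by (auto simp: a_def)
  obtain Y where Y: "Y \<in> subs G q" using sylow_subs[of q 1] q by auto
  have Y': "subgroup Y G" "card Y = q" "Y \<subseteq> carrier G" using Y subsD subs_carrier by auto
  define N where "N = normzr Y"
  have N: "subgroup N G" "Y \<subseteq> N" "q dvd card N"
    using normzr_subgroup[OF Y'(3)] subset_normzr[OF Y'(1)] Y'(2)
      card_subgroup_dvd_subgroup[OF Y'(1), of N] by (auto simp: N_def)
  have aN: "a * card N = order G"
    using card_class_mult_card_normzr[OF Y'(3)] conj_class_eq_subs[OF q(1) qq Y] by (simp add: a_def N_def)
  have adiv: "r dvd order G" "r \<noteq> q" if "r dvd a" for r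
  proof -
    show "r dvd order G" using that aN by (metis dvd_mult2)
    show "r \<noteq> q" using that N(3) aN qq by (metis mult_dvd_mono)
  qed
  have s3: "10 \<le> card (subs G 3)" if "3 dvd order G" "q = 5"
  proof -
    have "5 dvd card (subs G 3)" "card (subs G 3) mod 3 = 1" "4 \<le> card (subs G 3)"
      using large_prime_dvd[OF q q5, of 3] card_subs_ge[of 3] that by auto
    then show ?thesis by presburger
  qed
  show False
  proof (cases "card N = q")
    case False
    obtain k where k: "card N = q * k" using N(3) by blast
    then have "k \<noteq> 1" using False by auto
    then obtain r where r: "prime r" "r dvd k" using prime_factor_nat by blast
    have rN: "r dvd card N" using r k by simp
    have ro: "r dvd order G" using rN aN by (metis dvd_mult)
    have rq: "r \<noteq> q" using r(2) k aN qq by (metis dvd_mult dvd_refl mult_dvd_mono)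
    obtain X where X: "X \<in> subs G r" "X \<subseteq> N" using cauchy_in_subgroup[OF N(1) r(1) rN] by blast
    have X': "subgroup X G" "card X = r" using X subsD by auto
    have co: "coprime r q" using primes_coprime r(1) q(1) rq by blast
    have "subgroup (X <#> Y) G" using prod_subgroup[OF X'(1) Y'(1)] X(2) N_def by blast
    moreover have "card (X <#> Y) = r * q"
      using card_prod[OF X'(1) Y'(1) coprime_Int[OF X'(1) Y'(1)]] X' Y' co by simp
    ultimately have "X <#> Y \<in> subs G (r * q)" by (simp add: subs_def)
    then have sa: "a \<le> card (subs G (r * q))"
      unfolding a_def
      by (rule overgroup_count[OF q(1) qq Y _ subset_prod(2)[OF X'(1) Y'(1)]])
        (use less[OF r(1) ro rq] in auto)
    have o_ne: "order G \<noteq> r * q"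
    proof
      assume "order G = r * q"
      then have "card (subs G (r * q)) = 1" using subs_order by simp
      then show False using sa a q5 by linarith
    qed
    have r2: "2 \<le> r" using r(1) by (rule prime_ge_2_nat)
    have rq': "r * q \<noteq> r" "r * q \<noteq> q" "r * q \<noteq> 1" "r \<noteq> 1" "q \<noteq> 1" "order G \<noteq> 1" "order G \<noteq> r" "order G \<noteq> q"
      using r2 q5 nontrivial not_prime_power[OF r(1), of 1] not_prime_power[OF q(1), of 1] by auto
    have "(\<Sum>n\<in>{1, r, q, r * q, order G}. card (subs G n)) \<le> 24"
      using sum_card_subs_le[of "{1, r, q, r * q, order G}"] few by simp
    then have b1: "2 + card (subs G r) + a + card (subs G (r * q)) \<le> 24"
      using rq' rq o_ne subs_one subs_order by (simp add: a_def)
    have "q \<le> card (subs G r)" using s_ge r(1) ro rq by blast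
    then have "3 * q \<le> 20" using b1 sa a by linarith
    then have q_eq: "q = 5" using prime_5_to_10[OF q(1) q5] by auto
    have "a \<le> 8" using b1 sa \<open>q \<le> card (subs G r)\<close> q_eq by linarith
    then have a6: "a = 6" using a q_eq by presburger
    have d23: "2 dvd order G" "3 dvd order G" using adiv a6 by auto
    have s2: "5 \<le> card (subs G 2)" using s_ge[of 2] d23 q_eq by simp
    have s3': "10 \<le> card (subs G 3)" using s3 d23 q_eq by simp
    have r23: "r * q = 10 \<or> r * q = 15" using prime_less_5[OF r(1)] less[OF r(1) ro rq] q_eq by auto
    have o6: "order G = 6 * card N" using aN a6 by simp
    have o12: "12 < order G" using o6 N(3) q_eq order_pos by (auto elim!: dvdE)
    let ?F = "{1, 2, 3, 5, r * q, order G}"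
    have "(\<Sum>n\<in>?F. card (subs G n)) \<le> 24" using sum_card_subs_le[of ?F] few by simp
    moreover have "(\<Sum>n\<in>?F. card (subs G n)) = 2 + card (subs G 2) + card (subs G 3) + a + card (subs G (r * q))"
      using r23 o12 o_ne subs_one subs_order q_eq by (auto simp: a_def)
    ultimately show False using s2 s3' sa a6 by linarith
  next
    case True
    then have o: "order G = a * q" using aN by simp
    have "a \<noteq> 1" using a q5 by linarith
    then obtain r where r: "prime r" "r dvd a" using prime_factor_nat by blast
    have ro: "r dvd order G" "r \<noteq> q" using adiv r by auto
    have rq: "r < q" using less r(1) ro by blast
    have b: "2 + card (subs G r) + a + card (commuting_pairs r q) + (\<Sum>d\<in>D. card (subs G d)) \<le> 24"
      if "finite D" "D \<inter> {1, r, q, r * q, order G} = {}" for D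
      using two_primes_bound[OF r(1) ro(1) q ro(2) that] few by (simp add: a_def)
    have sr: "q \<le> card (subs G r)" using s_ge r(1) ro by blast
    have le: "a + q \<le> 22" using b[of "{}"] sr by simp
    have "q = 5 \<or> q = 7"
    proof -
      have "q \<le> 10" using le a(1) by linarith
      then show ?thesis using prime_5_to_10[OF q(1) q5] by blast
    qed
    then show False
    proof
      assume q_eq: "q = 5"
      then have "a mod 5 = 1" "6 \<le> a" "a \<le> 17" using a le by auto
      then have "a = 6 \<or> a = 11 \<or> a = 16" by presburger
      then show False
      proof (elim disjE)
        assume a6: "a = 6"
        \<comment> \<open>There are 5 subgroups of order 2, so by 5 mod 3 = 2 too many commuting pairs.\<close>
        then have o30: "order G = 30" using o q_eq by simp
        have "2 + card (subs G 2) + card (subs G 3) + card (commuting_pairs 2 3) + a \<le> 24"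
          using two_primes_bound[of 2 3 "{5}"] o30 few q_eq by (simp add: a_def)
        moreover have "10 \<le> card (subs G 3)" using s3 o30 q_eq by simp
        moreover have "5 dvd card (subs G 2)" "5 \<le> card (subs G 2)"
          using large_prime_dvd[OF q q5, of 2] s_ge[of 2] o30 q_eq by auto
        ultimately have s2: "card (subs G 2) = 5" using a6 by presburger
        have "card (subs G 3) * 2 \<le> card (commuting_pairs 2 3)" using commuting_pairs_ge[of 3 2] s2 by simp
        then show False
          using \<open>2 + card (subs G 2) + card (subs G 3) + card (commuting_pairs 2 3) + a \<le> 24\<close>
            \<open>10 \<le> card (subs G 3)\<close> by linarith
      next
        assume "a = 11"
        then have "11 dvd order G" using o by simp
        moreover have "prime (11::nat)" by simp
        ultimately show False using largest q_eq by fastforce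
      next
        assume a16: "a = 16"
        have r2: "r = 2" using r a16 prime_dvd_power[of r 2 4] by (simp add: primes_dvd_imp_eq)
        \<comment> \<open>Subgroups of orders 4, 8 and 16 exist and exceed the bound.\<close>
        have o80: "order G = 80" using o a16 q_eq by simp
        have "1 \<le> card (subs G 4)" "1 \<le> card (subs G 8)" "1 \<le> card (subs G 16)"
          using exists_order_subs[of 2 2] exists_order_subs[of 2 3] exists_order_subs[of 2 4] o80 by auto
        moreover have "2 + card (subs G r) + a + (card (subs G 4) + card (subs G 8) + card (subs G 16)) \<le> 24"
          using b[of "{4, 8, 16}"] r2 q_eq o80 by simp
        ultimately show False using sr q_eq a16 by linarith
      qed
    next
      assume q_eq: "q = 7"
      then have "a mod 7 = 1" "8 \<le> a" "a \<le> 15" using a le by auto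
      then have "a = 8 \<or> a = 15" by presburger
      then show False
      proof
        assume a8: "a = 8"
        have r2: "r = 2" using r a8 prime_dvd_power[of r 2 3] by (simp add: primes_dvd_imp_eq)
        \<comment> \<open>No subgroup of order 4 centralizes \<open>Y\<close>, so their number is a multiple of 7.\<close>
        have o56: "order G = 56" using o a8 q_eq by simp
        have "{F \<in> subs G 4. F \<subseteq> centralizer Y} = {}"
        proof (rule ccontr)
          assume "{F \<in> subs G 4. F \<subseteq> centralizer Y} \<noteq> {}"
          then obtain F where F: "F \<in> subs G 4" "F \<subseteq> centralizer Y" by blast
          then have "F \<subseteq> N" using centralizer_subset_normzr[OF Y'(3)] N_def by blast
          then have "4 dvd card N"
            using card_subgroup_dvd_subgroup[OF subsD(1)[OF F(1)] N(1)] subsD(2)[OF F(1)] by simp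
          then show False using True q_eq by simp
        qed
        then have "card {F \<in> subs G 4. F \<subseteq> centralizer Y} = 0" by (simp only: card.empty)
        moreover have "card (subs G 4) mod q = card {F \<in> subs G 4. F \<subseteq> centralizer Y} mod q"
          using card_commuting_mod[OF Y q(1), of 4] q_eq by simp
        ultimately have "card (subs G 4) mod 7 = 0" using q_eq by (metis mod_0)
        moreover have "1 \<le> card (subs G 4)" "1 \<le> card (subs G 8)"
          using exists_order_subs[of 2 2] exists_order_subs[of 2 3] o56 by auto
        ultimately have "7 \<le> card (subs G 4)" "1 \<le> card (subs G 8)" by (auto intro: dvd_imp_le simp: dvd_eq_mod_eq_0)
        moreover have "2 + card (subs G r) + a + (card (subs G 4) + card (subs G 8)) \<le> 24"
          using b[of "{4, 8}"] r2 q_eq o56 by simp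
        ultimately show False using sr q_eq a8 by linarith
      next
        assume a15: "a = 15"
        \<comment> \<open>The number of subgroups of order 5 is 0 modulo 7 and 1 modulo 5, so at least 21.\<close>
        have o105: "order G = 105" using o a15 q_eq by simp
        have "2 + card (subs G 5) + a \<le> 24"
          using two_primes_bound[of 5 7 "{}"] q o105 q_eq few by (simp add: a_def)
        moreover have "7 dvd card (subs G 5)" "card (subs G 5) mod 5 = 1"
          using large_prime_dvd[OF q q5, of 5] card_subs_ge[of 5] q_eq o105 by auto
        then have "21 \<le> card (subs G 5)" by presburger
        ultimately show False using a15 by linarith
      qed
    qed
  qed
qed

end

section \<open>Sylow 3-subgroups of order 3\<close>

lemma ex_two_elements: "2 \<le> card A \<Longrightarrow> \<exists>a\<in>A. \<exists>b\<in>A. a \<noteq> b"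
  by (metis card.infinite card_le_Suc0_iff_eq not_less_eq_eq numeral_2_eq_2 le_numeral_extra(3) zero_le)

lemma dvd_6_ge_4: "d dvd 6 \<Longrightarrow> 4 \<le> d \<Longrightarrow> d = (6::nat)"
proof -
  assume d: "d dvd 6" "4 \<le> d"
  then have "d \<le> 6" by (intro dvd_imp_le) auto
  then have "d = 4 \<or> d = 5 \<or> d = 6" using d(2) by linarith
  then show ?thesis using d(1) by auto
qed

lemma dvd_8_ge_5: "d dvd 8 \<Longrightarrow> \<not> d \<le> 4 \<Longrightarrow> d = (8::nat)"
proof -
  assume d: "d dvd 8" "\<not> d \<le> 4"
  then have "d \<le> 8" by (intro dvd_imp_le) auto
  then have "d = 5 \<or> d = 6 \<or> d = 7 \<or> d = 8" using d(2) by linarith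
  then show ?thesis using d(1) by auto
qed

lemma (in finite_group) involution_subs:
  assumes "x \<in> carrier G" "x \<noteq> \<one>" "x \<otimes> x = \<one>" shows "{\<one>, x} \<in> subs G 2"
proof -
  have "inv x = x" using assms by (simp add: inv_equality)
  then have "subgroup {\<one>, x} G" using assms by (intro subgroupI) auto
  then show ?thesis using assms by (simp add: subs_def)
qed

lemma (in finite_group) card_involutions_le:
  assumes "S \<subseteq> carrier G" "\<And>x. x \<in> S \<Longrightarrow> x \<noteq> \<one> \<and> x \<otimes> x = \<one>"
  shows "card S \<le> card (subs G 2)"
proof (rule card_inj_on_le)
  show "inj_on (\<lambda>x. {\<one>, x}) S" using assms by (auto simp: inj_on_def doubleton_eq_iff)
  show "(\<lambda>x. {\<one>, x}) ` S \<subseteq> subs G 2" using assms involution_subs by blast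
qed simp

lemma (in finite_group) involution_subsE:
  assumes "X \<in> subs G 2"
  obtains x where "X = {\<one>, x}" "x \<noteq> \<one>" "x \<in> carrier G" "x \<otimes> x = \<one>"
proof -
  have X: "subgroup X G" "card X = 2" using assms subsD by auto
  obtain x where x: "X = {\<one>, x}" "x \<noteq> \<one>"
    using X subgroup.one_closed[OF X(1)] by (auto simp: card_2_iff doubleton_eq_iff)
  have "x \<in> carrier G" using x X subgroup.subset by blast
  moreover have "x \<otimes> x = \<one>"
    using pow_card_subgroup[OF X(1), of x] x X(2) \<open>x \<in> carrier G\<close> by (simp add: numeral_2_eq_2)
  ultimately show thesis using that x by blast
qed

lemma (in finite_group) card_subs_2_le_involutions:
  assumes C: "subgroup C G"
  shows "card {X \<in> subs G 2. X \<subseteq> C} \<le> card {x \<in> C. x \<noteq> \<one> \<and> x \<otimes> x = \<one>}"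
proof (rule surj_card_le)
  show "finite {x \<in> C. x \<noteq> \<one> \<and> x \<otimes> x = \<one>}" using finite_subgroup[OF C] by simp
  show "{X \<in> subs G 2. X \<subseteq> C} \<subseteq> (\<lambda>x. {\<one>, x}) ` {x \<in> C. x \<noteq> \<one> \<and> x \<otimes> x = \<one>}"
  proof
    fix X assume X: "X \<in> {X \<in> subs G 2. X \<subseteq> C}"
    then have X2: "X \<in> subs G 2" by blast
    obtain x where "X = {\<one>, x}" "x \<noteq> \<one>" "x \<otimes> x = \<one>" by (rule involution_subsE[OF X2])
    then show "X \<in> (\<lambda>x. {\<one>, x}) ` {x \<in> C. x \<noteq> \<one> \<and> x \<otimes> x = \<one>}" using X by blast
  qed
qed

lemma (in finite_group) card_subs_2_in:
  assumes C: "subgroup C G" shows "card {X \<in> subs G 2. X \<subseteq> C} + 1 \<le> card C"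
proof -
  have "card {x \<in> C. x \<noteq> \<one> \<and> x \<otimes> x = \<one>} \<le> card (C - {\<one>})"
    using finite_subgroup[OF C] by (intro card_mono) auto
  then show ?thesis
    using card_subs_2_le_involutions[OF C] card_subgroup_pos[OF C] subgroup.one_closed[OF C] finite_subgroup[OF C]
    by (simp add: card_Diff_singleton)
qed

context few_subgroups begin

lemma primes_dvd_order: "prime p \<Longrightarrow> p dvd order G \<Longrightarrow> p = 2 \<or> p = 3"
proof -
  assume p: "prime p" "p dvd order G"
  obtain q where q: "prime q" "q dvd order G" "\<And>p. prime p \<Longrightarrow> p dvd order G \<Longrightarrow> p \<le> q"
    using obtain_largest_prime by blast
  have "p \<le> q" using q(3) p by blast
  also have "q \<le> 3" using largest_prime_le_3[OF q] .
  finally show ?thesis using prime_less_5[OF p(1)] by auto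
qed

lemma two_three_dvd_order: "2 dvd order G" "3 dvd order G"
proof -
  obtain q where q: "prime q" "q dvd order G" using obtain_largest_prime by blast
  obtain p where p: "prime p" "p dvd order G" "p \<noteq> q" using exists_other_prime[OF q] by blast
  show "2 dvd order G" "3 dvd order G"
    using primes_dvd_order[OF p(1,2)] primes_dvd_order[OF q] p q by auto
qed

lemma count_bound:
  assumes "finite D" "D \<inter> {1, 2, 3, 6, order G} = {}"
  shows "card (subs G 2) + card (subs G 3) + card (commuting_pairs 2 3) + (\<Sum>d\<in>D. card (subs G d)) \<le> 22"
  using two_primes_bound[OF _ two_three_dvd_order(1) _ two_three_dvd_order(2), of D] assms few by simp

lemma subs_2_count: "3 \<le> card (subs G 2)" "card (subs G 2) mod 2 = 1"
  and subs_3_count: "4 \<le> card (subs G 3)" "card (subs G 3) mod 3 = 1"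
  using card_subs_ge[of 2] card_subs_ge[of 3] two_three_dvd_order by auto

text \<open>
  Without commuting pairs \<open>Y\<close> normalizes no subgroup of order 2, so its orbits on those in \<open>C\<close> all
  have length 3.
\<close>

lemma three_dvd_subs_2_in:
  assumes no: "commuting_pairs 2 3 = {}" and Y: "Y \<in> subs G 3" and C: "subgroup C G" "Y \<subseteq> normzr C"
  shows "3 dvd card {X \<in> subs G 2. X \<subseteq> C}"
proof -
  have Y': "subgroup Y G" "card Y = 3 ^ 1" using Y subsD by auto
  let ?E = "{X \<in> subs G 2. X \<subseteq> C}"
  have "card ?E mod 3 = card {H \<in> ?E. Y \<subseteq> normzr H} mod 3"
  proof (rule fixed_subsets_cong[OF Y'])
    show "?E \<subseteq> Pow (carrier G)" using subs_carrier by blast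
    fix g H assume g: "g \<in> Y" and H: "H \<in> ?E"
    have "g \<in> carrier G" using g Y'(1) by (rule subgroup.mem_carrier[rotated])
    moreover have "conjg g C = C" using g C(2) by (auto simp: normzr_def)
    ultimately show "conjg g H \<in> ?E" using H conjg_subs conjg_mono by blast
  qed auto
  also have "{H \<in> ?E. Y \<subseteq> normzr H} = {}"
  proof -
    have "(H, Y) \<in> commuting_pairs 2 3" if "H \<in> subs G 2" "Y \<subseteq> normzr H" for H
      using normalizes_imp_commutes[OF that(1) Y _ _ that(2)] that(1) Y by (simp add: commuting_pairs_def)
    then show ?thesis using no by blast
  qed
  finally show ?thesis by (simp add: dvd_eq_mod_eq_0)
qed

text \<open>
  A subgroup of order 3 that acts on 8 elements fixes 2 or 8 of them, since their number is 2
  modulo 3 and divides 8. Hence \<open>Y\<close> would centralize an involution of \<open>E\<close>.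
\<close>

lemma no_fixed_order_8:
  assumes no: "commuting_pairs 2 3 = {}" and Y: "Y \<in> subs G 3" and E: "E \<in> subs G 8"
  shows "\<not> Y \<subseteq> normzr E"
proof
  assume n: "Y \<subseteq> normzr E"
  have Y': "subgroup Y G" "card Y = 3 ^ 1" using Y subsD by auto
  have E': "subgroup E G" "card E = 8" using E subsD by auto
  have sub: "subgroup (E \<inter> centralizer Y) G"
    using E'(1) centralizer_subgroup[OF subs_carrier[OF Y]] by (rule subgroups_Inter_pair)
  have "card E mod 3 = card (E \<inter> centralizer Y) mod 3"
    by (rule fixed_elements_cong[OF Y'])
      (use subs_carrier[OF E] finite_subgroup[OF E'(1)] n in \<open>auto simp: normzr_def\<close>)
  then have m: "card (E \<inter> centralizer Y) mod 3 = 2" using E'(2) by simp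
  have "card (E \<inter> centralizer Y) dvd 2 ^ 3"
    using card_subgroup_dvd_subgroup[OF sub E'(1)] E'(2) by simp
  then obtain i where i: "card (E \<inter> centralizer Y) = 2 ^ i" using divides_primepow_nat two_is_prime_nat by blast
  then have "2 dvd card (E \<inter> centralizer Y)" using m by (cases i) auto
  then obtain X where "X \<in> subs G 2" "X \<subseteq> E \<inter> centralizer Y" using cauchy_in_subgroup[OF sub two_is_prime_nat] by blast
  then have "(X, Y) \<in> commuting_pairs 2 3" using Y by (auto simp: commuting_pairs_def)
  with no show False by blast
qed

lemma three_dvd_subs_8:
  assumes no: "commuting_pairs 2 3 = {}" shows "3 dvd card (subs G 8)"
proof -
  obtain Y where Y: "Y \<in> subs G 3" using sylow_subs[of 3 1] two_three_dvd_order by auto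
  have Y': "subgroup Y G" "card Y = 3 ^ 1" using Y subsD by auto
  have "card (subs G 8) mod 3 = card {H \<in> subs G 8. Y \<subseteq> normzr H} mod 3"
    by (rule fixed_subsets_cong[OF Y' _ subs_in_Pow])
      (use conjg_subs[OF subgroup.mem_carrier[OF Y'(1)]] in auto)
  also have "{H \<in> subs G 8. Y \<subseteq> normzr H} = {}" using no_fixed_order_8[OF no Y] by blast
  finally show ?thesis by (simp add: dvd_eq_mod_eq_0)
qed

lemma three_dvd_subs_2:
  assumes no: "commuting_pairs 2 3 = {}" shows "3 dvd card (subs G 2)"
proof -
  obtain Y where Y: "Y \<in> subs G 3" using sylow_subs[of 3 1] two_three_dvd_order by auto
  have "{X \<in> subs G 2. X \<subseteq> centralizer Y} = {}" using no Y by (auto simp: commuting_pairs_def)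
  then have "card {X \<in> subs G 2. X \<subseteq> centralizer Y} = 0" by (simp only: card.empty)
  moreover have "card (subs G 2) mod 3 = card {X \<in> subs G 2. X \<subseteq> centralizer Y} mod 3"
    using card_commuting_mod[OF Y, of 2] by simp
  ultimately show ?thesis by (metis dvd_eq_mod_eq_0 mod_0)
qed

text \<open>
  \<open>C\<close> is the kernel of the conjugation action on the subgroups of order 3. It contains no such \<open>Z\<close>:
  if \<open>Z\<close> normalized another one, 9 would divide the order. So \<open>C\<close> and \<open>Z\<close> meet trivially, and as
  they normalize each other, all commutators of their elements vanish.
\<close>

lemma subs_3_conj_kernel:
  assumes nine: "\<not> 9 dvd order G"
  defines "C \<equiv> {g \<in> carrier G. \<forall>Z\<in>subs G 3. conjg g Z = Z}"
  shows "C \<lhd> G" "\<And>Z. Z \<in> subs G 3 \<Longrightarrow> \<not> Z \<subseteq> C" "\<And>Z. Z \<in> subs G 3 \<Longrightarrow> C \<subseteq> centralizer Z"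
proof -
  have Zc: "Z \<subseteq> carrier G" if "Z \<in> subs G 3" for Z using subs_carrier that .
  have subC: "subgroup C G"
  proof (rule subgroupI)
    show "C \<subseteq> carrier G" by (auto simp: C_def)
    have "\<one> \<in> C" using conjg_one Zc by (simp add: C_def)
    then show "C \<noteq> {}" by blast
    show "inv a \<in> C" if "a \<in> C" for a
    proof -
      have a: "a \<in> carrier G" using that by (simp add: C_def)
      have "conjg (inv a) Z = Z" if Z: "Z \<in> subs G 3" for Z
        using conjg_inv_cancel(1)[OF a Zc[OF Z]] \<open>a \<in> C\<close> Z by (simp add: C_def)
      then show ?thesis using a by (simp add: C_def)
    qed
    show "a \<otimes> b \<in> C" if "a \<in> C" "b \<in> C" for a b
      using that conjg_mult[of a b] Zc by (auto simp: C_def)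
  qed
  show "C \<lhd> G"
  proof (rule normal_invI[OF subC])
    fix x h assume x: "x \<in> carrier G" and h: "h \<in> C"
    have hc: "h \<in> carrier G" using h by (simp add: C_def)
    have "conjg (x \<otimes> h \<otimes> inv x) Z = Z" if Z: "Z \<in> subs G 3" for Z
    proof -
      have W: "conjg (inv x) Z \<in> subs G 3" using x Z conjg_subs by simp
      have "conjg (x \<otimes> h \<otimes> inv x) Z = conjg x (conjg h (conjg (inv x) Z))"
        using x hc Zc[OF Z] Zc[OF W] by (simp add: conjg_mult)
      also have "\<dots> = Z" using W h x Zc[OF Z] conjg_inv_cancel by (simp add: C_def)
      finally show ?thesis .
    qed
    then show "x \<otimes> h \<otimes> inv x \<in> C" using x hc by (simp add: C_def)
  qed
  note C_normal = this
  show nsub: "\<not> Z \<subseteq> C" if Z: "Z \<in> subs G 3" for Z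
  proof
    assume ZC: "Z \<subseteq> C"
    have "\<exists>W\<in>subs G 3. W \<noteq> Z"
    proof (rule ccontr)
      assume "\<not> (\<exists>W\<in>subs G 3. W \<noteq> Z)"
      then have "subs G 3 = {Z}" using Z by blast
      then show False using subs_3_count(1) by simp
    qed
    then obtain W where W: "W \<in> subs G 3" "W \<noteq> Z" by blast
    have "Z \<subseteq> normzr W" using ZC W(1) by (auto simp: C_def normzr_def)
    then show False using normalizes_distinct_dvd[OF Z W(1) _ _] W(2) nine by simp
  qed
  show "C \<subseteq> centralizer Z" if Z: "Z \<in> subs G 3" for Z
  proof
    fix g assume g: "g \<in> C"
    have gc: "g \<in> carrier G" and gZ: "conjg g Z = Z" using g Z by (auto simp: C_def)
    have Zs: "subgroup Z G" using subsD Z by blast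
    have "g \<otimes> z = z \<otimes> g" if z: "z \<in> Z" for z
    proof -
      have zc: "z \<in> carrier G" using z Zc Z by blast
      define u where "u = g \<otimes> z \<otimes> inv g \<otimes> inv z"
      have "g \<otimes> z \<otimes> inv g \<in> Z" using gZ z by (auto simp: conjg_def)
      then have uZ: "u \<in> Z"
        unfolding u_def by (rule subgroup.m_closed[OF Zs _ subgroup.m_inv_closed[OF Zs z]])
      have "z \<otimes> inv g \<otimes> inv z \<in> C"
        using normal.inv_op_closed2[OF C_normal] zc g subC by (simp add: subgroup.m_inv_closed)
      then have "g \<otimes> (z \<otimes> inv g \<otimes> inv z) \<in> C" by (rule subgroup.m_closed[OF subC g])
      then have uC: "u \<in> C" using gc zc by (simp add: u_def m_assoc)
      have "u = \<one>" using prime_subs_Int[OF Z _ subC uZ uC] nsub[OF Z] by auto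
      then have "g \<otimes> z \<otimes> inv g = z" using gc zc unfolding u_def by (metis inv_closed inv_solve_right' l_one m_closed)
      then show ?thesis using conj_eq_iff_commute gc zc by blast
    qed
    then show "g \<in> centralizer Z" using gc by (simp add: centralizer_def)
  qed
qed

text \<open>
  Suppose that \<open>X\<close> of order 2 commutes with \<open>Y\<close> of order 3. Then \<open>X\<close> permutes the three other
  subgroups of order 3 and normalizes an odd number of them. This number is a multiple of 3 because
  \<open>Y\<close> permutes them without fixed points; so \<open>X\<close> normalizes all three and lies in the kernel \<open>C\<close> of
  the action on the subgroups of order 3. Now \<open>C\<close> is a 2-group with at least three subgroups of order
  2, as a single one would be normal in \<open>G\<close>, and it has a subgroup of order 4. All of these commute
  with the four subgroups of order 3, which gives 12 subgroups of order 6 and 4 of order 12: too many.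
\<close>

lemma no_commuting_pairs:
  assumes nine: "\<not> 9 dvd order G" and n4: "card (subs G 3) = 4" and o: "24 dvd order G"
  shows "commuting_pairs 2 3 = {}"
proof (rule ccontr)
  assume "commuting_pairs 2 3 \<noteq> {}"
  then obtain X Y where XY: "X \<in> subs G 2" "Y \<in> subs G 3" "X \<subseteq> centralizer Y" by (auto simp: commuting_pairs_def)
  define C where "C = {g \<in> carrier G. \<forall>Z\<in>subs G 3. conjg g Z = Z}"
  note C = subs_3_conj_kernel[OF nine, folded C_def]
  have Cs: "subgroup C G" using C(1) by (rule normal_imp_subgroup)
  have X': "subgroup X G" "card X = 2 ^ 1" "X \<subseteq> carrier G" and Y': "subgroup Y G" "card Y = 3 ^ 1" "Y \<subseteq> carrier G"
    using XY subsD subs_carrier by auto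
  let ?E = "subs G 3 - {Y}"
  let ?F = "{H \<in> ?E. X \<subseteq> normzr H}"
  have cE: "card ?E = 3" using n4 XY(2) by simp
  have EP: "?E \<subseteq> Pow (carrier G)" using subs_in_Pow by blast
  have inj: "conjg g H \<in> ?E" if "g \<in> carrier G" "conjg g Y = Y" "H \<in> ?E" for g H
  proof -
    have "H = Y" if "conjg g H = Y"
      using that \<open>conjg g Y = Y\<close> \<open>H \<in> ?E\<close> conjg_inv_cancel(1)[OF \<open>g \<in> carrier G\<close>] subs_carrier Y'(3) by (metis Diff_iff)
    then show ?thesis using that conjg_subs by blast
  qed
  have "card ?E mod 2 = card ?F mod 2"
  proof (rule fixed_subsets_cong[OF X'(1,2) _ EP])
    show "conjg g H \<in> ?E" if "g \<in> X" "H \<in> ?E" for g H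
      using that inj X'(3) XY(3) centralizer_subset_normzr[OF Y'(3)] by (auto simp: normzr_def subset_eq)
  qed auto
  then have F0: "card ?F mod 2 = 1" using cE by simp
  have "card ?F mod 3 = card {H \<in> ?F. Y \<subseteq> normzr H} mod 3"
  proof (rule fixed_subsets_cong[OF Y'(1,2)])
    show "?F \<subseteq> Pow (carrier G)" using EP by blast
    fix g H assume g: "g \<in> Y" and H: "H \<in> ?F"
    have gc: "g \<in> carrier G" using g Y'(3) by blast
    have Hc: "H \<subseteq> carrier G" using H EP by blast
    have 1: "conjg g H \<in> ?E" using inj gc conjg_self[OF Y'(1) g] H by blast
    have "conjg x (conjg g H) = conjg g H" if x: "x \<in> X" for x
    proof -
      have xc: "x \<in> carrier G" "x \<otimes> g = g \<otimes> x" "conjg x H = H"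
        using x X'(3) XY(3) g H by (auto simp: centralizer_def normzr_def)
      then show ?thesis using conjg_mult[OF xc(1) gc Hc] conjg_mult[OF gc xc(1) Hc] by simp
    qed
    then have "X \<subseteq> normzr (conjg g H)" using X'(3) by (auto simp: normzr_def)
    then show "conjg g H \<in> ?F" using 1 by blast
  qed auto
  also have "{H \<in> ?F. Y \<subseteq> normzr H} = {}"
    using normalizes_distinct_dvd[OF XY(2)] nine by fastforce
  finally have "card ?F mod 3 = 0" by (metis card.empty mod_0)
  moreover have "card ?F \<le> card ?E" by (rule card_mono) auto
  ultimately have "card ?F = card ?E" using F0 cE by presburger
  then have "?F = ?E" by (intro card_subset_eq) auto
  then have "X \<subseteq> C"
  proof -
    have "conjg x Z = Z" if x: "x \<in> X" and Z: "Z \<in> subs G 3" for x Z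
    proof (cases "Z = Y")
      case True
      have "x \<in> normzr Y" using x XY(3) centralizer_subset_normzr[OF Y'(3)] by blast
      then show ?thesis using True by (simp add: normzr_def)
    next
      case False
      then have "X \<subseteq> normzr Z" using \<open>?F = ?E\<close> Z by blast
      then show ?thesis using x by (auto simp: normzr_def)
    qed
    then show ?thesis using X'(3) by (auto simp: C_def)
  qed
  then have X_in: "X \<in> {P \<in> subs G 2. P \<subseteq> C}" using XY by blast
  have "2 dvd card C"
    using card_subgroup_dvd_subgroup[OF X'(1) Cs \<open>X \<subseteq> C\<close>] X'(2) by simp
  then have "card {P \<in> subs G 2. P \<subseteq> C} mod 2 = 1" using subs_prime_mod_subgroup[OF Cs] by simp
  moreover have "card {P \<in> subs G 2. P \<subseteq> C} \<noteq> 1"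
  proof
    assume "card {P \<in> subs G 2. P \<subseteq> C} = 1"
    then have eq: "{P \<in> subs G 2. P \<subseteq> C} = {X}" using X_in by (metis card_1_singletonE singletonD)
    have "conjg g X = X" if g: "g \<in> carrier G" for g
    proof -
      have "conjg g X \<subseteq> C" using conjg_mono[OF \<open>X \<subseteq> C\<close>] C(1) g by (metis normal_iff_conjg)
      then show ?thesis using eq conjg_subs[OF g XY(1)] by blast
    qed
    then have "X \<lhd> G" using X'(1) by (simp add: normal_iff_conjg)
    then show False using subs_not_normal[OF XY(1)] by simp
  qed
  ultimately have C2: "3 \<le> card {P \<in> subs G 2. P \<subseteq> C}" by presburger
  have "{P \<in> subs G 2. P \<subseteq> C} \<times> subs G 3 \<subseteq> commuting_pairs 2 3" using C(3) by (auto simp: commuting_pairs_def)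
  then have "card ({P \<in> subs G 2. P \<subseteq> C} \<times> subs G 3) \<le> card (commuting_pairs 2 3)" by (intro card_mono) auto
  then have c12: "12 \<le> card (commuting_pairs 2 3)" using C2 n4 by (simp add: card_cartesian_product)
  have "\<exists>F \<in> subs G 4. F \<subseteq> C"
  proof -
    obtain k m where km: "card C = 2 ^ k * m" "\<not> 2 dvd m"
      using prime_power_split[OF two_is_prime_nat card_subgroup_pos[OF Cs]] by blast
    have m1: "m = 1"
    proof (rule ccontr)
      assume "m \<noteq> 1"
      then obtain r where r: "prime r" "r dvd m" using prime_factor_nat by blast
      then have rC: "r dvd card C" using km by simp
      then have "r dvd order G" using card_subgroup_dvd[OF Cs] dvd_trans by blast
      then have "r = 3" using primes_dvd_order r km(2) by blast
      then obtain Z where "Z \<in> subs G 3" "Z \<subseteq> C" using cauchy_in_subgroup[OF Cs r(1) rC] by blast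
      then show False using C(2) by blast
    qed
    have "4 \<le> card C" using card_subs_2_in[OF Cs] C2 by linarith
    have "\<not> k \<le> 1"
    proof
      assume "k \<le> 1"
      then have "2 ^ k \<le> (2::nat) ^ 1" by (intro power_increasing) auto
      then show False using \<open>4 \<le> card C\<close> km m1 by simp
    qed
    then have "2 \<le> k" by simp
    then have "(2::nat) ^ 2 dvd 2 ^ k" by (rule le_imp_power_dvd)
    then have "2 ^ 2 dvd card C" using km m1 by simp
    then show ?thesis using sylow_in_subgroup[OF Cs two_is_prime_nat, of 2] by simp
  qed
  then obtain F where F: "F \<in> subs G 4" "F \<subseteq> C" by blast
  have "{F} \<times> subs G 3 \<subseteq> commuting_pairs 4 3" using C(3) F by (auto simp: commuting_pairs_def)
  then have "card ({F} \<times> subs G 3) \<le> card (commuting_pairs 4 3)" by (intro card_mono) auto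
  also have "coprime 4 (3::nat)" using coprime_Suc_left_nat[of 3] by simp
  then have "card (commuting_pairs 4 3) \<le> card (subs G 12)" using card_commuting_pairs_le[of 4 3] by simp
  finally have s12: "4 \<le> card (subs G 12)" using n4 by simp
  have s48: "1 \<le> card (subs G 4)" "1 \<le> card (subs G 8)"
    using exists_order_subs[of 2 2] exists_order_subs[of 2 3] o dvd_trans[of 4 24] dvd_trans[of 8 24] by auto
  have "24 \<le> order G" using o order_pos by (rule dvd_imp_le)
  then have "card (subs G 2) + card (subs G 3) + card (commuting_pairs 2 3) + (\<Sum>d\<in>{4, 8, 12}. card (subs G d)) \<le> 22"
    by (intro count_bound) auto
  then show False using s12 s48 c12 n4 subs_2_count by simp
qed

text \<open>
  Otherwise the order of \<open>x\<close> is 4 or 8, and \<open>x\<close> or its square generates a subgroup of order 4 that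
  violates \<open>sq\<close>.
\<close>

lemma square_eq_one_if_no_order_4:
  assumes x: "x \<in> carrier G" "x [^] (8::nat) = \<one>"
    and sq: "\<And>F y. F \<in> subs G 4 \<Longrightarrow> y \<in> F \<Longrightarrow> y \<otimes> y = \<one>"
  shows "x \<otimes> x = \<one>"
proof (rule ccontr)
  assume n: "x \<otimes> x \<noteq> \<one>"
  have "\<exists>u \<in> carrier G. ord u = 4"
  proof -
    have "ord x dvd 2 ^ 3" using pow_eq_id[OF x(1), of 8] x(2) by simp
    then obtain i where i: "ord x = 2 ^ i" "i \<le> 3" using divides_primepow_nat two_is_prime_nat by blast
    have "x [^] (2::nat) \<noteq> \<one>" using n x(1) by (simp add: numeral_2_eq_2)
    then have "\<not> 2 ^ i dvd (2::nat)" using pow_eq_id[OF x(1), of 2] i by simp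
    then have "i \<noteq> 0" "i \<noteq> 1" by (metis one_dvd power_0, metis dvd_refl power_one_right)
    then have "i = 2 \<or> i = 3" using i(2) by linarith
    then show ?thesis
    proof
      assume "i = 2"
      then show ?thesis using i x(1) by auto
    next
      assume "i = 3"
      then have "ord (x [^] (2::nat)) = 4" using ord_pow[OF x(1), of 2] i by simp
      then show ?thesis using x(1) by blast
    qed
  qed
  then obtain u where u: "u \<in> carrier G" "ord u = 4" by blast
  have "generate G {u} \<in> subs G 4"
    using generate_pow_card[OF u(1)] u generate_is_subgroup[of "{u}"] by (simp add: subs_def)
  then have "u \<otimes> u = \<one>" using sq mem_generate by blast
  then have "u [^] (2::nat) = \<one>" using u(1) by (simp add: numeral_2_eq_2)
  then have "4 dvd (2::nat)" using pow_eq_id[OF u(1), of 2] u(2) by simp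
  then show False by simp
qed

text \<open>
  There are no commuting pairs, so the numbers of subgroups of orders 2 and 8 are multiples of 3. The
  normalizer of a subgroup of order 3 has even order, so each of the four lies in a subgroup of order
  6, and there are at least four of those. The bound then leaves 3 or 9 subgroups of order 2.

  If there are three, every subgroup of order 6 contains all of them, so that any two of these
  subgroups coincide and contain two subgroups of order 3, which is absurd. If there are nine, at most
  two subgroups of order 4 remain possible. A subgroup of order 3 normalizes these, which makes them
  elementary abelian; so the subgroups of order 8 have exponent 2 as well, and already two of them
  contain 11 involutions.
\<close>

lemma not_24_dvd:
  assumes nine: "\<not> 9 dvd order G" and n4: "card (subs G 3) = 4"
  shows "\<not> 24 dvd order G"
proof
  assume o: "24 dvd order G"
  note no = no_commuting_pairs[OF nine n4 o]
  obtain Y where Y: "Y \<in> subs G 3" using sylow_subs[of 3 1] two_three_dvd_order by auto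
  have o24: "24 \<le> order G" using o order_pos by (rule dvd_imp_le)
  have s48: "1 \<le> card (subs G 4)" "1 \<le> card (subs G 8)"
    using exists_order_subs[of 2 2] exists_order_subs[of 2 3] o dvd_trans[of 4 24] dvd_trans[of 8 24] by auto
  have s8: "3 \<le> card (subs G 8)" using three_dvd_subs_8[OF no] s48 by (auto intro: dvd_imp_le)
  have six: "\<exists>K \<in> subs G 6. Z \<subseteq> K" if Z: "Z \<in> subs G 3" for Z
  proof -
    have Zs: "subgroup Z G" "card Z = 3" "Z \<subseteq> carrier G" using Z subsD subs_carrier by auto
    have Ns: "subgroup (normzr Z) G" using normzr_subgroup[OF Zs(3)] .
    have "conj_class Z = subs G 3" using conj_class_eq_subs[of 3 Z] nine Z by simp
    then have "4 * card (normzr Z) = order G" using card_class_mult_card_normzr[OF Zs(3)] n4 by simp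
    then have "2 dvd card (normzr Z)" using o by presburger
    then obtain X where X: "X \<in> subs G 2" "X \<subseteq> normzr Z"
      using cauchy_in_subgroup[OF Ns two_is_prime_nat] by blast
    have Xs: "subgroup X G" "card X = 2" using X subsD by auto
    have "subgroup (X <#> Z) G" using prod_subgroup Xs Zs X(2) by blast
    moreover have "coprime 2 (3::nat)" by simp
    then have "card (X <#> Z) = 6"
      using card_prod[OF Xs(1) Zs(1) coprime_Int[OF Xs(1) Zs(1)]] Xs Zs by simp
    ultimately have "X <#> Z \<in> subs G 6" by (simp add: subs_def)
    then show ?thesis using subset_prod(2)[OF Xs(1) Zs(1)] by blast
  qed
  have s6: "4 \<le> card (subs G 6)"
    using six[OF Y] overgroup_count[of 3 Y _ 6] nine Y n4 by auto
  have "(\<Sum>n\<in>{1, 2, 3, 4, 6, 8, order G}. card (subs G n)) \<le> 24"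
    using sum_card_subs_le[of "{1, 2, 3, 4, 6, 8, order G}"] few by simp
  then have b: "card (subs G 2) + card (subs G 4) + card (subs G 6) + card (subs G 8) \<le> 18"
    using o24 subs_one subs_order n4 by simp
  have "3 dvd card (subs G 2)" using three_dvd_subs_2[OF no] .
  then have "card (subs G 2) = 3 \<or> card (subs G 2) = 9" using b s6 s8 s48 subs_2_count by presburger
  then show False
  proof
    assume two3: "card (subs G 2) = 3"
    have full: "{X \<in> subs G 2. X \<subseteq> K} = subs G 2" if K: "K \<in> subs G 6" "Z \<subseteq> K" "Z \<in> subs G 3" for K Z
    proof -
      have Ks: "subgroup K G" "card K = 6" using K subsD by auto
      have "Z \<subseteq> normzr K" using K(2) subset_normzr[OF Ks(1)] by blast
      then have "3 dvd card {X \<in> subs G 2. X \<subseteq> K}" using three_dvd_subs_2_in[OF no K(3) Ks(1)] by blast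
      moreover have "{X \<in> subs G 2. X \<subseteq> K} \<noteq> {}" using cauchy_in_subgroup[OF Ks(1), of 2] Ks(2) by auto
      then have "0 < card {X \<in> subs G 2. X \<subseteq> K}" by (simp add: card_gt_0_iff)
      ultimately have "card (subs G 2) \<le> card {X \<in> subs G 2. X \<subseteq> K}" using two3 dvd_imp_le by metis
      then show ?thesis by (intro card_seteq) auto
    qed
    have "2 \<le> card (subs G 3)" using n4 by simp
    then obtain Z where Z: "Z \<in> subs G 3" "Z \<noteq> Y" using ex_two_elements by metis
    obtain K L where KL: "K \<in> subs G 6" "Y \<subseteq> K" "L \<in> subs G 6" "Z \<subseteq> L" using six Y Z by meson
    have KL': "subgroup K G" "card K = 6" "subgroup L G" "card L = 6"
      by (simp_all add: subsD[OF KL(1)] subsD[OF KL(3)])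
    have i: "subgroup (K \<inter> L) G" using KL' by (intro subgroups_Inter_pair)
    have "{X \<in> subs G 2. X \<subseteq> K \<inter> L} = subs G 2"
      using full[OF KL(1,2) Y] full[OF KL(3,4) Z(1)] by blast
    then have "4 \<le> card (K \<inter> L)" using card_subs_2_in[OF i] two3 by simp
    moreover have "card (K \<inter> L) dvd 6" using card_subgroup_dvd_subgroup[OF i KL'(1)] KL'(2) by simp
    ultimately have c6: "card (K \<inter> L) = 6" using dvd_6_ge_4 by blast
    then have "K \<inter> L = K" using subgroup_card_eq[OF i KL'(1)] KL'(2) by simp
    moreover have "K \<inter> L = L" using subgroup_card_eq[OF i KL'(3)] KL'(4) c6 by simp
    ultimately have "Z \<subseteq> K" using KL by blast
    then have "Y <#> Z \<subseteq> K" using KL(2) subgroup.m_closed[OF KL'(1)] by (auto simp: set_mult_def)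
    then have "card (Y <#> Z) \<le> 6" using KL'(2) finite_subgroup[OF KL'(1)] card_mono by metis
    moreover have "card (Y <#> Z) = 3 * 3"
      using card_prod[OF subsD(1)[OF Y] subsD(1)[OF Z(1)] prime_subs_disjoint[OF Y _ Z(1)]] Z(2)
        subsD(2)[OF Y] subsD(2)[OF Z(1)] by simp
    ultimately show False by simp
  next
    assume two9: "card (subs G 2) = 9"
    have s4: "card (subs G 4) \<le> 2" using b two9 s6 s8 by linarith
    have Y': "subgroup Y G" "card Y = 3 ^ 1" using Y subsD by auto
    have "card (subs G 4) mod 3 = card {F \<in> subs G 4. Y \<subseteq> normzr F} mod 3"
      by (rule fixed_subsets_cong[OF Y' _ subs_in_Pow])
        (use conjg_subs[OF subgroup.mem_carrier[OF Y'(1)]] in auto)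
    moreover have "card {F \<in> subs G 4. Y \<subseteq> normzr F} \<le> card (subs G 4)" by (rule card_mono) auto
    ultimately have "card {F \<in> subs G 4. Y \<subseteq> normzr F} = card (subs G 4)" using s4 by simp
    then have nF: "{F \<in> subs G 4. Y \<subseteq> normzr F} = subs G 4" by (intro card_subset_eq) auto
    have sq4: "y \<otimes> y = \<one>" if F: "F \<in> subs G 4" and y: "y \<in> F" for F y
    proof -
      have Fs: "subgroup F G" "card F = 4" using F subsD by auto
      have "3 dvd card {X \<in> subs G 2. X \<subseteq> F}" using three_dvd_subs_2_in[OF no Y Fs(1)] nF F by blast
      moreover have "{X \<in> subs G 2. X \<subseteq> F} \<noteq> {}" using cauchy_in_subgroup[OF Fs(1), of 2] Fs(2) by auto
      then have "0 < card {X \<in> subs G 2. X \<subseteq> F}" by (simp add: card_gt_0_iff)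
      ultimately have c3: "3 \<le> card {X \<in> subs G 2. X \<subseteq> F}" by (simp add: dvd_imp_le)
      let ?I = "{x \<in> F. x \<noteq> \<one> \<and> x \<otimes> x = \<one>}"
      have "card {X \<in> subs G 2. X \<subseteq> F} \<le> card ?I" using card_subs_2_le_involutions[OF Fs(1)] .
      then have "card (F - {\<one>}) \<le> card ?I"
        using c3 Fs subgroup.one_closed[OF Fs(1)] by (simp add: card_Diff_singleton)
      then have "?I = F - {\<one>}" using finite_subgroup[OF Fs(1)] by (intro card_seteq) auto
      then show ?thesis using y by (cases "y = \<one>") auto
    qed
    have sq8: "y \<otimes> y = \<one>" if E: "E \<in> subs G 8" and y: "y \<in> E" for E y
    proof (rule square_eq_one_if_no_order_4)
      show "y \<in> carrier G" using subs_carrier[OF E] y by blast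
      show "y [^] (8::nat) = \<one>" using pow_card_subgroup[OF subsD(1)[OF E] y] subsD(2)[OF E] by simp
    qed (rule sq4)
    have "2 \<le> card (subs G 8)" using s8 by simp
    then obtain E F where EF: "E \<in> subs G 8" "F \<in> subs G 8" "E \<noteq> F" using ex_two_elements by metis
    have EF': "subgroup E G" "card E = 8" "subgroup F G" "card F = 8"
      by (simp_all add: subsD[OF EF(1)] subsD[OF EF(2)])
    have i: "subgroup (E \<inter> F) G" using EF' by (intro subgroups_Inter_pair)
    have "card (E \<inter> F) \<le> 4"
    proof (rule ccontr)
      assume n: "\<not> card (E \<inter> F) \<le> 4"
      have "card (E \<inter> F) dvd 8" using card_subgroup_dvd_subgroup[OF i EF'(1)] EF'(2) by simp
      then have c8: "card (E \<inter> F) = 8" using dvd_8_ge_5 n by auto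
      then have "E \<inter> F = E" "E \<inter> F = F" using subgroup_card_eq[OF i] EF' by auto
      then show False using EF(3) by simp
    qed
    moreover have "card (E \<union> F) + card (E \<inter> F) = 16"
      using card_Un_Int[of E F] finite_subgroup EF' by simp
    ultimately have "11 \<le> card ((E \<union> F) - {\<one>})"
      using subgroup.one_closed[OF EF'(1)] finite_subgroup EF' by (simp add: card_Diff_singleton)
    also have "\<dots> \<le> card (subs G 2)"
      by (rule card_involutions_le) (use sq8[OF EF(1)] sq8[OF EF(2)] subs_carrier[OF EF(1)] subs_carrier[OF EF(2)] in auto)
    finally show False using two9 by simp
  qed
qed

text \<open>
  Since all subgroups of order 3 are conjugate, their number divides the order, so it has no prime
  factors except 2 and 3. As it is 1 modulo 3 and at most 19, it is 4 or 16. With 4, the order is 12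
  times a factor \<open>k\<close> that neither 3 nor, by the preceding lemma, 2 divides. With 16, the bound leaves
  no commuting pairs and a single subgroup of order 8, but that number is a multiple of 3.
\<close>

lemma order_12_if_not_9_dvd:
  assumes nine: "\<not> 9 dvd order G" shows "order G = 12"
proof -
  obtain Y where Y: "Y \<in> subs G 3" using sylow_subs[of 3 1] two_three_dvd_order by auto
  have Y': "subgroup Y G" "card Y = 3" "Y \<subseteq> carrier G" using Y subsD subs_carrier by auto
  have "conj_class Y = subs G 3" using conj_class_eq_subs[of 3 Y] nine Y by simp
  then have oN: "card (subs G 3) * card (normzr Y) = order G" using card_class_mult_card_normzr[OF Y'(3)] by simp
  have "3 dvd card (normzr Y)"
    using card_subgroup_dvd_subgroup[OF Y'(1) normzr_subgroup[OF Y'(3)] subset_normzr[OF Y'(1)]] Y'(2) by simp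
  then obtain k where k: "card (normzr Y) = 3 * k" by blast
  have k0: "k \<noteq> 0"
  proof
    assume "k = 0"
    then have "order G = 0" using k oN by simp
    then show False using order_pos by simp
  qed
  have "card (subs G 3) \<le> 19" using count_bound[of "{}"] subs_2_count by simp
  then have "card (subs G 3) \<in> {4, 7, 10, 13, 16, 19}" using subs_3_count by (simp, presburger)
  moreover have "\<not> r dvd card (subs G 3)" if "prime r" "r \<noteq> 2" "r \<noteq> 3" for r
    using primes_dvd_order[OF that(1)] that oN by (metis dvd_mult2)
  from this[of 7] this[of 5] this[of 13] this[of 19]
  have "card (subs G 3) \<noteq> 7" "card (subs G 3) \<noteq> 10" "card (subs G 3) \<noteq> 13" "card (subs G 3) \<noteq> 19" by auto
  ultimately have "card (subs G 3) = 4 \<or> card (subs G 3) = 16" by auto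
  then show ?thesis
  proof
    assume n4: "card (subs G 3) = 4"
    show ?thesis
    proof (rule ccontr)
      assume "order G \<noteq> 12"
      then have "k \<noteq> 1" using oN n4 k by auto
      then obtain r where r: "prime r" "r dvd k" using prime_factor_nat by blast
      have "r dvd order G" using r(2) k oN by (metis dvd_mult)
      then have "r = 2 \<or> r = 3" using primes_dvd_order r(1) by blast
      moreover have "r \<noteq> 3"
      proof
        assume "r = 3"
        then obtain j where "k = 3 * j" using r(2) by blast
        then have "order G = 9 * (4 * j)" using k oN n4 by simp
        then show False using nine by simp
      qed
      ultimately obtain j where "k = 2 * j" using r(2) by blast
      then have "order G = 24 * j" using k oN n4 by simp
      then show False using not_24_dvd[OF nine n4] by simp
    qed
  next
    assume n16: "card (subs G 3) = 16"
    have o48: "order G = 48 * k" using k oN n16 by simp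
    have s: "1 \<le> card (subs G 4)" "1 \<le> card (subs G 8)" "1 \<le> card (subs G 16)"
      using exists_order_subs[of 2 2] exists_order_subs[of 2 3] exists_order_subs[of 2 4] o48
        dvd_mult2[of 4 48 k] dvd_mult2[of 8 48 k] dvd_mult2[of 16 48 k] by auto
    have "card (subs G 2) + card (subs G 3) + card (commuting_pairs 2 3) + (\<Sum>d\<in>{4, 8, 16}. card (subs G d)) \<le> 22"
      using o48 k0 by (intro count_bound) auto
    then have "card (subs G 2) + card (commuting_pairs 2 3) + card (subs G 4) + card (subs G 8) + card (subs G 16) \<le> 6"
      using n16 by simp
    then have "card (commuting_pairs 2 3) = 0" "card (subs G 8) = 1" using s subs_2_count by linarith+
    then show ?thesis using three_dvd_subs_8 by auto
  qed
qed

end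

section \<open>Sylow 3-subgroups of order at least 9\<close>

context finite_group begin

lemma conj_class_eq:
  assumes X: "X \<subseteq> carrier G" and Z: "Z \<in> conj_class X" shows "conj_class Z = conj_class X"
proof -
  obtain g where g: "g \<in> carrier G" "Z = conjg g X" using Z by (auto simp: conj_class_def)
  have Zc: "Z \<subseteq> carrier G" using g X conjg_carrier by blast
  have "X = conjg (inv g) Z" using g X conjg_inv_cancel by simp
  then have XZ: "X \<in> conj_class Z" using g(1) by (auto simp: conj_class_def)
  show ?thesis
  proof
    show "conj_class Z \<subseteq> conj_class X" using conj_class_conjg[OF Z _ X] by (auto simp: conj_class_def[of Z])
    show "conj_class X \<subseteq> conj_class Z" using conj_class_conjg[OF XZ _ Zc] by (auto simp: conj_class_def[of X])
  qed
qed

lemma normzr_conjg: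
  assumes g: "g \<in> carrier G" and X: "X \<subseteq> carrier G"
  shows "normzr (conjg g X) = conjg g (normzr X)"
proof -
  have le: "conjg g (normzr X) \<subseteq> normzr (conjg g X)" if g: "g \<in> carrier G" and X: "X \<subseteq> carrier G" for g X
  proof
    fix y assume "y \<in> conjg g (normzr X)"
    then obtain h where h: "h \<in> carrier G" "conjg h X = X" "y = g \<otimes> h \<otimes> inv g"
      by (auto simp: conjg_def[of g] normzr_def)
    have "conjg y (conjg g X) = conjg (g \<otimes> h \<otimes> inv g \<otimes> g) X"
      using h g X conjg_mult[of "g \<otimes> h \<otimes> inv g" g X] by simp
    also have "g \<otimes> h \<otimes> inv g \<otimes> g = g \<otimes> h" using g h by (simp add: m_assoc)
    also have "conjg (g \<otimes> h) X = conjg g X" using g h X conjg_mult by simp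
    finally show "y \<in> normzr (conjg g X)" using h g by (simp add: normzr_def)
  qed
  have Nc: "normzr (conjg g X) \<subseteq> carrier G" by (auto simp: normzr_def)
  have "normzr (conjg g X) = conjg g (conjg (inv g) (normzr (conjg g X)))"
    using conjg_inv_cancel(2)[OF g Nc] by simp
  also have "\<dots> \<subseteq> conjg g (normzr (conjg (inv g) (conjg g X)))"
    using le[of "inv g" "conjg g X"] g X conjg_carrier by (intro conjg_mono) auto
  also have "\<dots> = conjg g (normzr X)" using conjg_inv_cancel(1)[OF g X] by simp
  finally show ?thesis using le[OF g X] by blast
qed

lemma involutions_commute_iff:
  assumes "A \<in> subs G 2" "B \<in> subs G 2"
  shows "A \<subseteq> normzr B \<longleftrightarrow> A \<subseteq> centralizer B" "A \<subseteq> normzr B \<longleftrightarrow> B \<subseteq> normzr A"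
proof -
  have c: "A \<subseteq> carrier G" "B \<subseteq> carrier G" using assms subs_carrier by auto
  show 1: "A \<subseteq> normzr B \<longleftrightarrow> A \<subseteq> centralizer B"
    using normalizes_involution[OF assms(2)] centralizer_subset_normzr[OF c(2)] by blast
  have "B \<subseteq> normzr A \<longleftrightarrow> B \<subseteq> centralizer A"
    using normalizes_involution[OF assms(1)] centralizer_subset_normzr[OF c(1)] by blast
  then show "A \<subseteq> normzr B \<longleftrightarrow> B \<subseteq> normzr A" using 1 subset_centralizer_commute[OF c] by blast
qed

end

context few_subgroups begin

lemma normzr_dvd_3_commuting:
  assumes X: "X \<in> subs G 2" and d: "3 dvd card (normzr X)"
  shows "\<exists>Y \<in> subs G 3. X \<subseteq> centralizer Y"
proof -
  obtain Y where Y: "Y \<in> subs G 3" "Y \<subseteq> normzr X"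
    using cauchy_in_subgroup[OF normzr_subgroup[OF subs_carrier[OF X]] _ d] by auto
  then show ?thesis using normalizes_imp_commutes[OF X Y(1)] by auto
qed

lemma count_bound_9_dvd:
  assumes nine: "9 dvd order G" and D: "finite D" "D \<inter> {1, 2, 3, 6, 9, order G} = {}"
  shows "card (subs G 2) + card (subs G 3) + card (commuting_pairs 2 3) + (\<Sum>d\<in>D. card (subs G d)) \<le> 21"
proof -
  have o9: "order G \<noteq> 9" using not_prime_power[of 3 2] by simp
  have ns: "order G \<noteq> 1" "order G \<noteq> 2" "order G \<noteq> 3" "order G \<noteq> 6" using nine by auto
  have "card (subs G 2) + card (subs G 3) + card (commuting_pairs 2 3) + (\<Sum>d\<in>insert 9 D. card (subs G d)) \<le> 22"
    using D o9 by (intro count_bound) auto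
  moreover have "(\<Sum>d\<in>insert 9 D. card (subs G d)) = card (subs G 9) + (\<Sum>d\<in>D. card (subs G d))"
    using D by (intro sum.insert) auto
  moreover have "1 \<le> card (subs G 9)" using exists_order_subs[of 3 2] nine by simp
  ultimately show ?thesis by linarith
qed

text \<open>
  A Sylow 2-subgroup normalizes some subgroup \<open>X\<close> of order 2, because their number is odd. The class
  of this \<open>X\<close> has odd size, and 3 and 9 are the only odd numbers from 3 to 17 that have no prime
  factors beyond 3.
\<close>

lemma odd_class:
  assumes nine: "9 dvd order G"
  obtains X where "X \<in> subs G 2" "card (conj_class X) = 3 \<or> card (conj_class X) = 9"
proof -
  obtain k m where km: "order G = 2 ^ k * m" "\<not> 2 dvd m"
    using prime_power_split[OF two_is_prime_nat order_pos] by blast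
  obtain T where T: "T \<in> subs G (2 ^ k)" using sylow_subs[OF two_is_prime_nat, of k] km by auto
  have T': "subgroup T G" "card T = 2 ^ k" using T subsD by auto
  have "card (subs G 2) mod 2 = card {H \<in> subs G 2. T \<subseteq> normzr H} mod 2"
    by (rule fixed_subsets_cong[OF T' _ subs_in_Pow])
      (use conjg_subs[OF subgroup.mem_carrier[OF T'(1)]] in auto)
  then have "card {H \<in> subs G 2. T \<subseteq> normzr H} \<noteq> 0" using subs_2_count by (metis mod_0 zero_neq_one)
  then obtain X where X: "X \<in> subs G 2" "T \<subseteq> normzr X" by (metis (mono_tags, lifting) card.empty empty_Collect_eq)
  have Xc: "X \<subseteq> carrier G" using X subs_carrier by blast
  have "2 ^ k dvd card (normzr X)"
    using card_subgroup_dvd_subgroup[OF T'(1) normzr_subgroup[OF Xc] X(2)] T'(2) by simp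
  then obtain j where j: "card (normzr X) = 2 ^ k * j" by blast
  have "2 ^ k * (card (conj_class X) * j) = 2 ^ k * m"
    using card_class_mult_card_normzr[OF Xc] km j by (simp add: mult.left_commute)
  then have m: "card (conj_class X) * j = m" by simp
  have cdvd: "r dvd order G" "r \<noteq> 2" if "r dvd card (conj_class X)" for r
  proof -
    have "r dvd m" using that m by (metis dvd_mult2)
    then show "r dvd order G" "r \<noteq> 2" using km by auto
  qed
  have ge: "2 \<le> card (conj_class X)" using conj_class_ge_2 X(1) by simp
  have "card (conj_class X) \<le> card (subs G 2)" using conj_class_subset_subs[OF X(1)] by (simp add: card_mono)
  also have "card (subs G 2) \<le> 17" using count_bound_9_dvd[OF nine, of "{}"] subs_3_count by simp
  finally have le: "card (conj_class X) \<le> 17" .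
  have "odd (card (conj_class X))" using cdvd(2) by blast
  then have "card (conj_class X) \<in> {3, 5, 7, 9, 11, 13, 15, 17}" using ge le by (simp, presburger)
  moreover have "\<not> r dvd card (conj_class X)" if "prime r" "r \<noteq> 2" "r \<noteq> 3" for r
    using primes_dvd_order[OF that(1)] that cdvd(1) by blast
  from this[of 5] this[of 7] this[of 11] this[of 13] this[of 17]
  have "card (conj_class X) \<noteq> 5" "card (conj_class X) \<noteq> 7" "card (conj_class X) \<noteq> 11"
    "card (conj_class X) \<noteq> 13" "card (conj_class X) \<noteq> 15" "card (conj_class X) \<noteq> 17" by auto
  ultimately have "card (conj_class X) = 3 \<or> card (conj_class X) = 9" by auto
  then show thesis using that X(1) by blast
qed

text \<open>
  The orbits of a subgroup of order 3 on the class have length 1 or 3, so if it commutes with \<open>X\<close>, it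
  commutes with all three members. Hence \<open>S\<close> consists of the subgroups of order 3 in the centralizer
  of \<open>X\<close>, and their number is 1 modulo 3. If there were only one, it would be normal in \<open>G\<close>.
\<close>

lemma class_of_3_centralized:
  assumes nine: "9 dvd order G" and X: "X \<in> subs G 2" and c3: "card (conj_class X) = 3"
  defines "S \<equiv> {Y \<in> subs G 3. \<forall>Z\<in>conj_class X. Z \<subseteq> centralizer Y}"
  shows "4 \<le> card S"
proof -
  have Xc: "X \<subseteq> carrier G" using X subs_carrier by blast
  have Xcl: "X \<in> conj_class X" using self_in_class[OF Xc] .
  have clP: "conj_class X \<subseteq> Pow (carrier G)" using conj_class_subset_subs[OF X] subs_in_Pow by blast
  have "3 * card (normzr X) = order G" using card_class_mult_card_normzr[OF Xc] c3 by simp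
  then have "3 dvd card (normzr X)" using nine by presburger
  then obtain Y0 where Y0: "Y0 \<in> subs G 3" "X \<subseteq> centralizer Y0" using normzr_dvd_3_commuting[OF X] by blast
  have all: "Y \<in> S" if Y: "Y \<in> subs G 3" "X \<subseteq> centralizer Y" for Y
  proof -
    have Y': "subgroup Y G" "card Y = 3 ^ 1" using Y subsD by auto
    have "card (conj_class X) mod 3 = card {H \<in> conj_class X. Y \<subseteq> normzr H} mod 3"
      by (rule fixed_subsets_cong[OF Y' _ clP finite_conj_class[OF Xc]])
        (use conj_class_conjg[OF _ subgroup.mem_carrier[OF Y'(1)] Xc] in auto)
    then have "3 dvd card {H \<in> conj_class X. Y \<subseteq> normzr H}" using c3 by presburger
    moreover have "X \<in> {H \<in> conj_class X. Y \<subseteq> normzr H}"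
      using Xcl Y(2) subset_centralizer_commute[OF Xc subs_carrier[OF Y(1)]] centralizer_subset_normzr[OF Xc] by blast
    then have "0 < card {H \<in> conj_class X. Y \<subseteq> normzr H}"
      using finite_conj_class[OF Xc] by (auto simp: card_gt_0_iff)
    ultimately have "card (conj_class X) \<le> card {H \<in> conj_class X. Y \<subseteq> normzr H}"
      unfolding c3 by (rule dvd_imp_le)
    then have "{H \<in> conj_class X. Y \<subseteq> normzr H} = conj_class X"
      using finite_conj_class[OF Xc] by (intro card_seteq) auto
    then have "Y \<subseteq> normzr Z" if "Z \<in> conj_class X" for Z using that by blast
    then have "Z \<subseteq> centralizer Y" if "Z \<in> conj_class X" for Z
      using that conj_class_subset_subs[OF X] normalizes_imp_commutes[OF _ Y(1), of Z 2] by auto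
    then show ?thesis using Y by (simp add: S_def)
  qed
  have "X \<subseteq> centralizer Y \<longleftrightarrow> Y \<subseteq> centralizer X" if "Y \<in> subs G 3" for Y
    using subset_centralizer_commute[OF Xc subs_carrier[OF that]] .
  then have S_eq: "S = {Y \<in> subs G 3. Y \<subseteq> centralizer X}"
    using all Xcl unfolding S_def by blast
  have cX: "subgroup (centralizer X) G" using centralizer_subgroup[OF Xc] .
  have "Y0 \<subseteq> centralizer X" using Y0 subset_centralizer_commute[OF Xc] subs_carrier by blast
  then have "3 dvd card (centralizer X)"
    using card_subgroup_dvd_subgroup[OF subsD(1)[OF Y0(1)] cX] subsD(2)[OF Y0(1)] by simp
  then have m: "card S mod 3 = 1" unfolding S_eq using subs_prime_mod_subgroup[OF cX, of 3] by simp
  have "card S \<noteq> 1"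
  proof
    assume "card S = 1"
    moreover have "Y0 \<in> S" using all Y0 by blast
    ultimately have S1: "S = {Y0}" by (metis card_1_singletonE singletonD)
    have Y0c: "Y0 \<subseteq> carrier G" using Y0 subs_carrier by blast
    have "conjg g Y0 = Y0" if g: "g \<in> carrier G" for g
    proof -
      have "conjg (inv g) X \<in> conj_class X" using conjg_in_class g by simp
      then have "conjg (inv g) X \<subseteq> centralizer Y0" using S1 by (auto simp: S_def)
      then have "conjg g (conjg (inv g) X) \<subseteq> centralizer (conjg g Y0)"
        using g Xc Y0c conjg_carrier by (intro conjg_centralizer) auto
      then have "X \<subseteq> centralizer (conjg g Y0)" using conjg_inv_cancel(2)[OF g Xc] by simp
      then have "conjg g Y0 \<in> S" using all conjg_subs[OF g Y0(1)] by blast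
      then show ?thesis using S1 by simp
    qed
    then have "Y0 \<lhd> G" using subsD(1)[OF Y0(1)] by (simp add: normal_iff_conjg)
    then show False using subs_not_normal[OF Y0(1)] by simp
  qed
  then show ?thesis using m by presburger
qed

text \<open>
  By the preceding lemma there are at least 12 commuting pairs. This leaves 4 subgroups of order 3,
  each of which commutes with the whole class, and 3 or 5 subgroups of order 2. If there are 5, each
  subgroup of order 3 commutes with all of them, which makes 20 pairs. If there are 3, take two of
  them. If they commute, their product is a Klein four-group, which commutes with the subgroups of
  order 3 and yields 4 subgroups of order 12. If not, their involutions \<open>x\<close> and \<open>y\<close> generate a
  symmetric group of degree 3, but \<open>x\<close> would commute with \<open>x \<otimes> y\<close>, which has order 3.
\<close>

lemma no_class_of_3:
  assumes nine: "9 dvd order G" and X: "X \<in> subs G 2"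
  shows "card (conj_class X) \<noteq> 3"
proof
  assume c3: "card (conj_class X) = 3"
  define S where "S = {Y \<in> subs G 3. \<forall>Z\<in>conj_class X. Z \<subseteq> centralizer Y}"
  have S4: "4 \<le> card S" unfolding S_def by (rule class_of_3_centralized[OF nine X c3])
  have Ssub: "S \<subseteq> subs G 3" by (auto simp: S_def)
  have finS: "finite S" by (rule finite_subset[OF Ssub finite_subs])
  have "conj_class X \<times> S \<subseteq> commuting_pairs 2 3"
    using conj_class_subset_subs[OF X] by (auto simp: commuting_pairs_def S_def)
  then have "card (conj_class X \<times> S) \<le> card (commuting_pairs 2 3)" by (intro card_mono) auto
  then have c12: "12 \<le> card (commuting_pairs 2 3)" using S4 c3 by (simp add: card_cartesian_product)
  have b: "card (subs G 2) + card (subs G 3) + card (commuting_pairs 2 3) \<le> 21" using count_bound_9_dvd[OF nine, of "{}"] by simp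
  have n3_4: "card (subs G 3) = 4" using b c12 subs_2_count subs_3_count by presburger
  then have S_all: "S = subs G 3" using S4 Ssub by (intro card_seteq) auto
  have "card (subs G 2) = 3 \<or> card (subs G 2) = 5" using b c12 subs_2_count n3_4 by presburger
  then show False
  proof
    assume n5: "card (subs G 2) = 5"
    have "5 \<le> card {A \<in> subs G 2. A \<subseteq> centralizer Y}" if Y: "Y \<in> subs G 3" for Y
    proof -
      have "card (subs G 2) mod 3 = card {A \<in> subs G 2. A \<subseteq> centralizer Y} mod 3"
        using card_commuting_mod[OF Y, of 2] by simp
      moreover have "conj_class X \<subseteq> {A \<in> subs G 2. A \<subseteq> centralizer Y}"
        using Y S_all conj_class_subset_subs[OF X] by (auto simp: S_def)
      then have "card (conj_class X) \<le> card {A \<in> subs G 2. A \<subseteq> centralizer Y}" by (intro card_mono) auto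
      ultimately show ?thesis using n5 c3 by presburger
    qed
    then have "(\<Sum>Y\<in>subs G 3. 5) \<le> card (commuting_pairs 2 3)" unfolding card_commuting_pairs_sum(1) by (intro sum_mono)
    then show False using b n5 n3_4 by simp
  next
    assume n3': "card (subs G 2) = 3"
    have cl_all: "conj_class X = subs G 2"
      using conj_class_subset_subs[OF X] c3 n3' by (intro card_subset_eq) auto
    have comm: "A \<subseteq> centralizer Y" if "A \<in> subs G 2" "Y \<in> subs G 3" for A Y
      using that S_all cl_all by (auto simp: S_def)
    have "2 \<le> card (subs G 2)" using n3' by simp
    then obtain A B where AB: "A \<in> subs G 2" "B \<in> subs G 2" "A \<noteq> B" using ex_two_elements by metis
    have A': "subgroup A G" "card A = 2" and B': "subgroup B G" "card B = 2"
      by (simp_all add: subsD[OF AB(1)] subsD[OF AB(2)])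
    obtain x where x: "A = {\<one>, x}" "x \<noteq> \<one>" "x \<in> carrier G" "x \<otimes> x = \<one>" using AB(1) by (rule involution_subsE)
    obtain y where y: "B = {\<one>, y}" "y \<noteq> \<one>" "y \<in> carrier G" "y \<otimes> y = \<one>" using AB(2) by (rule involution_subsE)
    show False
    proof (cases "A \<subseteq> normzr B")
      case True
      have "A \<inter> B = {\<one>}" using prime_subs_disjoint[OF AB(1) _ AB(2,3)] by simp
      then have V: "A <#> B \<in> subs G 4"
        using prod_subgroup[OF A'(1) B'(1) True] card_prod[OF A'(1) B'(1)] A' B' by (simp add: subs_def)
      have "A <#> B \<subseteq> centralizer Y" if Y: "Y \<in> subs G 3" for Y
        using comm[OF AB(1) Y] comm[OF AB(2) Y] subgroup.m_closed[OF centralizer_subgroup[OF subs_carrier[OF Y]]]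
        by (auto simp: set_mult_def)
      then have "{A <#> B} \<times> subs G 3 \<subseteq> commuting_pairs 4 3" using V by (auto simp: commuting_pairs_def)
      then have "card ({A <#> B} \<times> subs G 3) \<le> card (commuting_pairs 4 3)" by (intro card_mono) auto
      also have "coprime 4 (3::nat)" using coprime_Suc_left_nat[of 3] by simp
      then have "card (commuting_pairs 4 3) \<le> card (subs G 12)" using card_commuting_pairs_le[of 4 3] by simp
      finally have s12: "4 \<le> card (subs G 12)" using n3_4 by simp
      have s4: "1 \<le> card (subs G 4)" using V by (auto simp: Suc_le_eq card_gt_0_iff)
      have "order G \<noteq> 4" "order G \<noteq> 12" using nine by auto
      then have "card (subs G 2) + card (subs G 3) + card (commuting_pairs 2 3) + (\<Sum>d\<in>{4, 12}. card (subs G d)) \<le> 21"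
        by (intro count_bound_9_dvd[OF nine]) auto
      then show False using s4 s12 c12 n3_4 n3' by simp
    next
      case False
      have xB: "conjg x B \<noteq> B"
      proof
        assume "conjg x B = B"
        then have "A \<subseteq> normzr B" using x B'(1) conjg_one[OF subs_carrier[OF AB(2)]] by (auto simp: normzr_def)
        then show False using False by blast
      qed
      have yA: "conjg y A \<noteq> A"
      proof
        assume "conjg y A = A"
        then have "B \<subseteq> normzr A" using y A'(1) conjg_one[OF subs_carrier[OF AB(1)]] by (auto simp: normzr_def)
        then show False using False involutions_commute_iff(2)[OF AB(1,2)] by blast
      qed
      have inv_xy: "inv x = x" "inv y = y" using x y by (simp_all add: inv_equality)
      have cB: "conjg x B = {\<one>, x \<otimes> y \<otimes> x}" and cA: "conjg y A = {\<one>, y \<otimes> x \<otimes> y}"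
        using x y inv_xy by (auto simp: conjg_def)
      have "conjg x B \<noteq> A"
        using conjg_self[OF A'(1), of x] x AB(3) conjg_inv_cancel(1)[OF x(3)] subs_carrier[OF AB(1)] subs_carrier[OF AB(2)]
        by (metis insertI1 insert_commute)
      moreover have "conjg y A \<noteq> B"
        using conjg_self[OF B'(1), of y] y AB(3) conjg_inv_cancel(1)[OF y(3)] subs_carrier[OF AB(1)] subs_carrier[OF AB(2)]
        by (metis insertI1 insert_commute)
      moreover have "card (subs G 2 - {A, B}) \<le> 1" using n3' AB by simp
      then have "P = Q" if "P \<in> subs G 2 - {A, B}" "Q \<in> subs G 2 - {A, B}" for P Q
        using that by (metis One_nat_def card_le_Suc0_iff_eq finite_Diff finite_subs)
      ultimately have "conjg x B = conjg y A"
        using xB yA conjg_subs[OF x(3) AB(2)] conjg_subs[OF y(3) AB(1)] by blast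
      then have "{\<one>, x \<otimes> y \<otimes> x} = {\<one>, y \<otimes> x \<otimes> y}" using cA cB by simp
      then have e: "x \<otimes> y \<otimes> x = y \<otimes> x \<otimes> y" by (metis doubleton_eq_iff)
      define u where "u = x \<otimes> y"
      have uc: "u \<in> carrier G" using x y by (simp add: u_def)
      have "u [^] (3::nat) = x \<otimes> y \<otimes> (x \<otimes> y) \<otimes> (x \<otimes> y)"
        using uc by (simp add: u_def numeral_3_eq_3)
      also have "\<dots> = (x \<otimes> y \<otimes> x) \<otimes> (y \<otimes> x \<otimes> y)" using x y by (simp add: m_assoc)
      also have "\<dots> = (x \<otimes> y \<otimes> x) \<otimes> (x \<otimes> y \<otimes> x)" using e by simp
      also have "\<dots> = x \<otimes> y \<otimes> (x \<otimes> x) \<otimes> y \<otimes> x" using x(3) y(3) by (simp add: m_assoc)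
      also have "\<dots> = x \<otimes> (y \<otimes> y) \<otimes> x" using x y by (simp add: m_assoc)
      also have "\<dots> = \<one>" using x y by simp
      finally have u3: "u [^] (3::nat) = \<one>" .
      have "u \<noteq> \<one>" using x y AB(3) inv_xy unfolding u_def by (metis inv_equality)
      then have "generate G {u} \<in> subs G 3" using prime_subs_generate uc u3 by simp
      then have "A \<subseteq> centralizer (generate G {u})" using comm AB(1) by blast
      then have "x \<otimes> u = u \<otimes> x" using x(1) mem_generate[of u] by (auto simp: centralizer_def)
      then have "y = x \<otimes> y \<otimes> x"
        using x y unfolding u_def by (metis l_one m_assoc)
      then have "conjg x B = B" using cB y(1) by simp
      then show False using xB by blast
    qed
  qed
qed

lemma card_involutions_outside:
  assumes P: "P \<in> subs G 9"
  shows "card (subs G 2) \<le> card {x \<in> carrier G - P. x \<otimes> x = \<one>}"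
proof -
  have "{X \<in> subs G 2. X \<subseteq> carrier G} = subs G 2" using subs_carrier by blast
  then have "card (subs G 2) \<le> card {x \<in> carrier G. x \<noteq> \<one> \<and> x \<otimes> x = \<one>}"
    using card_subs_2_le_involutions[OF subgroup_self] by simp
  also have "\<dots> \<le> card {x \<in> carrier G - P. x \<otimes> x = \<one>}"
  proof (rule card_mono)
    have "x = \<one>" if "x \<in> P" "x \<otimes> x = \<one>" for x
    proof -
      have xc: "x \<in> carrier G" using that(1) subs_carrier[OF P] by blast
      have "x [^] (9::nat) = \<one>" using pow_card_subgroup[OF subsD(1)[OF P] that(1)] subsD(2)[OF P] by simp
      moreover have "x [^] (2::nat) = \<one>" using that(2) xc by (simp add: numeral_2_eq_2)
      ultimately have "ord x dvd 9" "ord x dvd 2" using pow_eq_id[OF xc] by auto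
      moreover have "coprime 9 (2::nat)" by simp
      ultimately have "ord x = 1" by (metis coprime_common_divisor_nat)
      then show ?thesis using ord_eq_1[OF xc] by simp
    qed
    then show "{x \<in> carrier G. x \<noteq> \<one> \<and> x \<otimes> x = \<one>} \<subseteq> {x \<in> carrier G - P. x \<otimes> x = \<one>}" by blast
  qed (use fin in simp)
  finally show ?thesis .
qed

text \<open>
  If 3 divided the order of the normalizer of \<open>X\<close>, each of the nine members of the class would commute
  with a subgroup of order 3, and 9 subgroups of order 2, 4 of order 3 and 9 pairs are too many. So
  that order is a power of 2. The set \<open>R\<close> of the remaining subgroups of order 2 has at most 8 members;
  the classes in it are too small to be divisible by 9, hence each member commutes with a subgroup of
  order 3. So \<open>R\<close> has at most 4 members, and an even number of them. Two are excluded because 11 is 2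
  modulo 3, which forces 8 commuting pairs. Four would leave no room for a subgroup of order 4, hence
  make the order 18, which is too small for 13 involutions.
\<close>

lemma class_of_9:
  assumes nine: "9 dvd order G" and X: "X \<in> subs G 2" and c9: "card (conj_class X) = 9"
  shows "subs G 2 = conj_class X" "commuting_pairs 2 3 = {}" "\<exists>a. order G = 9 * 2 ^ a"
    "\<And>Z. Z \<in> subs G 2 \<Longrightarrow> 9 * card (normzr Z) = order G"
proof -
  have Xc: "X \<subseteq> carrier G" using X subs_carrier by blast
  have clsub: "conj_class X \<subseteq> subs G 2" using conj_class_subset_subs[OF X] .
  have b: "card (subs G 2) + card (subs G 3) + card (commuting_pairs 2 3) \<le> 21" using count_bound_9_dvd[OF nine, of "{}"] by simp
  have oN: "9 * card (normzr X) = order G" using card_class_mult_card_normzr[OF Xc] c9 by simp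
  have pairs_ge: "card R \<le> card (commuting_pairs 2 3)"
    if R: "R \<subseteq> subs G 2" "\<And>Z. Z \<in> R \<Longrightarrow> \<exists>Y \<in> subs G 3. Z \<subseteq> centralizer Y" for R
  proof -
    have "R \<subseteq> fst ` commuting_pairs 2 3"
    proof
      fix Z assume Z: "Z \<in> R"
      then obtain Y where "Y \<in> subs G 3" "Z \<subseteq> centralizer Y" using R(2) by blast
      then have "(Z, Y) \<in> commuting_pairs 2 3" using R(1) Z by (auto simp: commuting_pairs_def)
      then show "Z \<in> fst ` commuting_pairs 2 3" by (metis fst_conv image_eqI)
    qed
    then show ?thesis by (rule surj_card_le[rotated]) simp
  qed
  have n2_9: "9 \<le> card (subs G 2)" using card_mono[OF finite_subs clsub] c9 by simp
  have not3: "\<not> 3 dvd card (normzr X)"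
  proof
    assume "3 dvd card (normzr X)"
    then obtain Y where Y: "Y \<in> subs G 3" "X \<subseteq> centralizer Y" using normzr_dvd_3_commuting[OF X] by blast
    have "\<exists>Y \<in> subs G 3. Z \<subseteq> centralizer Y" if Z: "Z \<in> conj_class X" for Z
    proof -
      obtain g where "g \<in> carrier G" "Z = conjg g X" using Z by (auto simp: conj_class_def)
      then show ?thesis using conjg_centralizer[OF Xc subs_carrier[OF Y(1)] _ Y(2)] conjg_subs[OF _ Y(1)] by blast
    qed
    then have "9 \<le> card (commuting_pairs 2 3)" using pairs_ge[OF clsub] c9 by simp
    then show False using b n2_9 subs_3_count by linarith
  qed
  obtain a m where am: "card (normzr X) = 2 ^ a * m" "\<not> 2 dvd m"
    using prime_power_split[OF two_is_prime_nat card_subgroup_pos[OF normzr_subgroup[OF Xc]]] by blast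
  have "m = 1"
  proof (rule ccontr)
    assume "m \<noteq> 1"
    then obtain r where r: "prime r" "r dvd m" using prime_factor_nat by blast
    then have "r dvd card (normzr X)" using am by simp
    then have "r dvd order G" "r \<noteq> 3" using oN not3 by (metis dvd_mult, metis)
    then show False using primes_dvd_order r am(2) by blast
  qed
  then have o: "order G = 9 * 2 ^ a" using am oN by simp
  then show "\<exists>a. order G = 9 * 2 ^ a" by blast
  define R where "R = subs G 2 - conj_class X"
  have cR: "card R + 9 = card (subs G 2)"
    using card_Diff_subset[OF finite_subset[OF clsub finite_subs] clsub] c9 n2_9 by (simp add: R_def)
  have Rpairs: "\<exists>Y \<in> subs G 3. Z \<subseteq> centralizer Y" if Z: "Z \<in> R" for Z
  proof -
    have Z2: "Z \<in> subs G 2" "Z \<notin> conj_class X" using Z by (auto simp: R_def)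
    have Zc: "Z \<subseteq> carrier G" using Z2 subs_carrier by blast
    have "conj_class Z \<inter> conj_class X = {}"
      using conj_class_eq[OF Zc] conj_class_eq[OF Xc] self_in_class[OF Zc] Z2(2) by blast
    then have "conj_class Z \<subseteq> R" using conj_class_subset_subs[OF Z2(1)] by (auto simp: R_def)
    then have "card (conj_class Z) \<le> card R" by (intro card_mono) (simp_all add: R_def)
    also have "card R \<le> 8" using b cR subs_3_count by linarith
    finally have le: "card (conj_class Z) \<le> 8" .
    have "3 dvd card (normzr Z)"
    proof (rule ccontr)
      assume "\<not> 3 dvd card (normzr Z)"
      then have "coprime 3 (card (normzr Z))"
        using prime_imp_coprime[of 3 "card (normzr Z)"] by simp
      then have "coprime (3 ^ 2) (card (normzr Z))" by (metis coprime_power_left_iff)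
      moreover have "(3::nat) ^ 2 = 9" by simp
      ultimately have "coprime 9 (card (normzr Z))" by metis
      moreover have "9 dvd card (conj_class Z) * card (normzr Z)"
        using card_class_mult_card_normzr[OF Zc] nine by simp
      ultimately have "9 dvd card (conj_class Z)" by (simp add: coprime_dvd_mult_left_iff)
      then have "9 \<le> card (conj_class Z)"
        using conj_class_ge_2[OF Z2(1)] by (intro dvd_imp_le) auto
      then show False using le by simp
    qed
    then show ?thesis using normzr_dvd_3_commuting[OF Z2(1)] by blast
  qed
  have cR_le: "card R \<le> card (commuting_pairs 2 3)" using pairs_ge[of R] Rpairs by (auto simp: R_def)
  have "card R \<noteq> 2"
  proof
    assume r: "card R = 2"
    then have "card (subs G 2) = 11" using cR by simp
    then have "card (subs G 3) * 2 \<le> card (commuting_pairs 2 3)" using commuting_pairs_ge[of 3 2] by simp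
    then show False using b \<open>card (subs G 2) = 11\<close> subs_3_count by linarith
  qed
  moreover have "card R \<noteq> 4"
  proof
    assume r: "card R = 4"
    show False
    proof (cases "4 dvd order G")
      case True
      then have "1 \<le> card (subs G 4)" using exists_order_subs[of 2 2] by simp
      moreover have "order G \<noteq> 4" using nine by auto
      then have "card (subs G 2) + card (subs G 3) + card (commuting_pairs 2 3) + (\<Sum>d\<in>{4}. card (subs G d)) \<le> 21"
        by (intro count_bound_9_dvd[OF nine]) auto
      ultimately show False using r cR cR_le subs_3_count by simp
    next
      case False
      have "\<not> 2 \<le> a"
      proof
        assume "2 \<le> a"
        then have "(2::nat) ^ 2 dvd 2 ^ a" by (rule le_imp_power_dvd)
        then have "2 ^ 2 dvd order G" unfolding o by (rule dvd_mult)
        then show False using False by simp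
      qed
      then have "(2::nat) ^ a \<le> 2 ^ 1" by (intro power_increasing) auto
      then have o18: "order G \<le> 18" using o by simp
      obtain P where P: "P \<in> subs G 9" using sylow_subs[of 3 2] nine by auto
      have "card (subs G 2) \<le> card {x \<in> carrier G - P. x \<otimes> x = \<one>}" using card_involutions_outside[OF P] .
      also have "\<dots> \<le> card (carrier G - P)" using fin by (intro card_mono) auto
      also have "\<dots> \<le> 9"
        using card_Diff_subset[OF finite_subgroup[OF subsD(1)[OF P]] subs_carrier[OF P]] o18 subsD(2)[OF P]
        by (simp add: order_def)
      finally show False using cR r by simp
    qed
  qed
  moreover have "even (card R)" using cR subs_2_count(2) by presburger
  moreover have "card R \<le> 4" using b cR cR_le subs_3_count by linarith
  ultimately have "card R = 0" by presburger
  then have "R = {}" by (simp add: R_def)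
  then show eq: "subs G 2 = conj_class X" using clsub by (auto simp: R_def)
  show N: "9 * card (normzr Z) = order G" if "Z \<in> subs G 2" for Z
    using that eq conj_class_eq[OF Xc, of Z] card_class_mult_card_normzr[OF subs_carrier[OF that]] c9 by simp
  show "commuting_pairs 2 3 = {}"
  proof (rule ccontr)
    assume "commuting_pairs 2 3 \<noteq> {}"
    then obtain Z Y where ZY: "Z \<in> subs G 2" "Y \<in> subs G 3" "Z \<subseteq> centralizer Y" by (auto simp: commuting_pairs_def)
    have c: "Z \<subseteq> carrier G" "Y \<subseteq> carrier G" using ZY subs_carrier by auto
    have "Y \<subseteq> normzr Z" using ZY(3) subset_centralizer_commute[OF c] centralizer_subset_normzr[OF c(1)] by blast
    then have "3 dvd card (normzr Z)"
      using card_subgroup_dvd_subgroup[OF subsD(1)[OF ZY(2)] normzr_subgroup[OF c(1)]] subsD(2)[OF ZY(2)] by simp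
    moreover have "card (normzr Z) = card (normzr X)" using N[OF ZY(1)] oN by linarith
    ultimately show False using not3 by simp
  qed
qed

text \<open>
  The nine involutions fill the complement of a subgroup \<open>P\<close> of order 9. For \<open>u\<close> in \<open>P\<close> and \<open>t\<close> outside,
  \<open>t\<close> and \<open>t \<otimes> u\<close> are both involutions, which means that \<open>t\<close> inverts \<open>u\<close>. Every element of \<open>P\<close> is a
  product of two elements outside and so centralizes \<open>P\<close>. Hence subgroups of order 3 are normal.
\<close>

lemma order_not_18:
  assumes o: "order G = 18" and n9: "card (subs G 2) = 9" shows False
proof -
  obtain P where P: "P \<in> subs G 9" using sylow_subs[of 3 2] o by auto
  have P': "subgroup P G" "card P = 9" "P \<subseteq> carrier G" using subsD[OF P] subs_carrier[OF P] by auto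
  let ?I = "{x \<in> carrier G - P. x \<otimes> x = \<one>}"
  have c9: "card (carrier G - P) = 9"
    using card_Diff_subset[OF finite_subgroup[OF P'(1)] P'(3)] o P'(2) by (simp add: order_def)
  have "card (carrier G - P) \<le> card ?I" using card_involutions_outside[OF P] n9 c9 by simp
  then have I: "?I = carrier G - P" using fin by (intro card_seteq) auto
  have invert: "t \<otimes> u \<otimes> inv t = inv u" if t: "t \<in> carrier G - P" and u: "u \<in> P" for t u
  proof -
    have uc: "u \<in> carrier G" "t \<in> carrier G" using u t P' by auto
    have "t \<otimes> u \<notin> P"
    proof
      assume "t \<otimes> u \<in> P"
      then have "t \<otimes> u \<otimes> inv u \<in> P" using P'(1) u by (simp add: subgroup.m_closed subgroup.m_inv_closed)
      then show False using uc t by (simp add: m_assoc)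
    qed
    then have "(t \<otimes> u) \<otimes> (t \<otimes> u) = \<one>" "t \<otimes> t = \<one>" using I uc t by blast+
    then have "t \<otimes> u \<otimes> t \<otimes> u = \<one>" "inv t = t" using uc by (simp_all add: m_assoc inv_equality)
    then show ?thesis using uc by (metis inv_equality m_closed)
  qed
  obtain Y where Y: "Y \<in> subs G 3" using sylow_subs[of 3 1] o by auto
  have Yc: "Y \<subseteq> carrier G" "subgroup Y G" using subs_carrier[OF Y] subsD[OF Y] by auto
  have YP: "Y \<subseteq> P"
  proof (rule ccontr)
    assume "\<not> Y \<subseteq> P"
    then obtain y where y: "y \<in> Y" "y \<notin> P" by blast
    then have "y \<otimes> y = \<one>" using I Yc by blast
    moreover have yc: "y \<in> carrier G" using y Yc by blast
    have "y [^] (3::nat) = \<one>" using pow_card_subgroup[OF Yc(2) y(1)] subsD(2)[OF Y] by simp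
    ultimately have "y = \<one>" using yc by (simp add: numeral_3_eq_3)
    then show False using y(2) subgroup.one_closed[OF P'(1)] by simp
  qed
  have "carrier G - P \<noteq> {}" using c9 by (metis card.empty zero_neq_numeral)
  then obtain t where t: "t \<in> carrier G - P" by blast
  have "g \<otimes> y \<otimes> inv g \<in> Y" if g: "g \<in> carrier G" and y: "y \<in> Y" for g y
  proof (cases "g \<in> P")
    case False
    then show ?thesis using invert[of g y] g y YP Yc(2) subgroup.m_inv_closed by fastforce
  next
    case True
    have tc: "t \<in> carrier G" and yc: "y \<in> carrier G" and yP: "y \<in> P" using t y YP Yc by auto
    have tt: "t \<otimes> t = \<one>" using I t by blast
    have "t \<otimes> g \<notin> P"
    proof
      assume "t \<otimes> g \<in> P"
      then have "t \<otimes> g \<otimes> inv g \<in> P" using P'(1) True by (simp add: subgroup.m_closed subgroup.m_inv_closed)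
      then show False using tc t g by (simp add: m_assoc)
    qed
    then have 1: "(t \<otimes> g) \<otimes> y \<otimes> inv (t \<otimes> g) = inv y" using invert[of "t \<otimes> g" y] tc g yP by simp
    have "g = t \<otimes> (t \<otimes> g)" using tt tc g by (simp flip: m_assoc)
    then have "g \<otimes> y \<otimes> inv g = t \<otimes> ((t \<otimes> g) \<otimes> y \<otimes> inv (t \<otimes> g)) \<otimes> inv t"
      using conj_mult[of t "t \<otimes> g" y] tc g yc by simp
    also have "\<dots> = inv (inv y)"
      unfolding 1 by (rule invert[OF t]) (use P'(1) yP in \<open>simp add: subgroup.m_inv_closed\<close>)
    also have "\<dots> = y" using yc by simp
    finally show ?thesis using y by simp
  qed
  then have "Y \<lhd> G" using Yc(2) by (intro normal_invI) auto
  then show False using subs_not_normal[OF Y] by simp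
qed

text \<open>
  The nine involutions would form a subgroup of order 10 together with the neutral element.
\<close>

lemma involutions_not_all_commute:
  assumes n9: "card (subs G 2) = 9"
    and comm: "\<And>A B. A \<in> subs G 2 \<Longrightarrow> B \<in> subs G 2 \<Longrightarrow> A \<subseteq> centralizer B"
  shows False
proof -
  define U where "U = {x \<in> carrier G. x \<otimes> x = \<one>}"
  have gen: "{\<one>, x} \<in> subs G 2" if "x \<in> U" "x \<noteq> \<one>" for x
    using that by (intro involution_subs) (auto simp: U_def)
  have cm: "x \<otimes> y = y \<otimes> x" if "x \<in> U" "y \<in> U" for x y
  proof (cases "x = \<one> \<or> y = \<one>")
    case True then show ?thesis using that by (auto simp: U_def)
  next
    case False
    then show ?thesis using comm[OF gen[OF that(1)] gen[OF that(2)]] by (auto simp: centralizer_def)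
  qed
  have sub: "subgroup U G"
  proof (rule subgroupI)
    show "a \<otimes> b \<in> U" if "a \<in> U" "b \<in> U" for a b
    proof -
      have c: "a \<in> carrier G" "b \<in> carrier G" "a \<otimes> a = \<one>" "b \<otimes> b = \<one>" using that by (auto simp: U_def)
      have "(a \<otimes> b) \<otimes> (a \<otimes> b) = (a \<otimes> b) \<otimes> (b \<otimes> a)" using cm[OF that] by simp
      also have "\<dots> = a \<otimes> (b \<otimes> b) \<otimes> a" using c(1,2) by (simp add: m_assoc)
      also have "\<dots> = \<one>" using c by simp
      finally show ?thesis using c by (simp add: U_def)
    qed
    show "inv a \<in> U" if "a \<in> U" for a using that by (auto simp: U_def inv_equality)
  qed (auto simp: U_def)
  have "card (U - {\<one>}) = 9"
  proof (rule antisym)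
    show "card (U - {\<one>}) \<le> 9"
      unfolding n9[symmetric] by (rule card_involutions_le) (auto simp: U_def)
    have "{X \<in> subs G 2. X \<subseteq> carrier G} = subs G 2" using subs_carrier by blast
    moreover have "{x \<in> carrier G. x \<noteq> \<one> \<and> x \<otimes> x = \<one>} = U - {\<one>}" by (auto simp: U_def)
    ultimately show "9 \<le> card (U - {\<one>})" using card_subs_2_le_involutions[OF subgroup_self] n9 by simp
  qed
  then have "card U = 10"
    using subgroup.one_closed[OF sub] finite_subgroup[OF sub] card_subgroup_pos[OF sub] by (simp add: card_Diff_singleton)
  then have "10 dvd order G" using card_subgroup_dvd[OF sub] by simp
  then have "5 dvd order G" by presburger
  then show False using primes_dvd_order[of 5] by simp
qed

text \<open>
  The normalizers of the nine subgroups of order 2 are conjugate of order \<open>2 ^ a\<close>, and each normalizer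
  arises from the same number \<open>s\<close> of them, so \<open>s\<close> is 1, 3 or 9. For \<open>s = 1\<close>, nine subgroups of order
  \<open>2 ^ a\<close> exceed the bound. For \<open>s = 9\<close>, each of the nine subgroups normalizes all others.

  Let \<open>s = 3\<close>, so that there are three normalizers. If those of \<open>A\<close> and \<open>B\<close> differ, two subgroups \<open>C\<close>
  and \<open>D\<close> with the normalizer of \<open>A\<close> span a Klein four-group, all of whose subgroups of order 2 have
  this normalizer. It permutes the other two normalizers, so the involution \<open>v\<close> of one of its
  subgroups \<open>V\<close> fixes that of \<open>B\<close>. Then \<open>v\<close> permutes the three subgroups with this normalizer and fixes
  one of them, so \<open>V\<close> lies in the normalizer of \<open>B\<close>. Thus \<open>B\<close> lies in the normalizer of \<open>V\<close>, which is
  that of \<open>A\<close>.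
\<close>

lemma class_of_9_commute:
  assumes nine: "9 dvd order G" and X: "X \<in> subs G 2" and c9: "card (conj_class X) = 9"
    and o: "order G = 9 * 2 ^ a" and a: "2 \<le> a"
    and A: "A \<in> subs G 2" and B: "B \<in> subs G 2"
  shows "A \<subseteq> centralizer B"
proof -
  note cl = class_of_9[OF nine X c9]
  define Fib where "Fib Z = {W \<in> subs G 2. normzr W = normzr Z}" for Z
  have Xc: "X \<subseteq> carrier G" using X subs_carrier by blast
  have n9: "card (subs G 2) = 9" using cl(1) c9 by simp
  have cT: "card (normzr Z) = 2 ^ a" if "Z \<in> subs G 2" for Z using cl(4)[OF that] o by simp
  have sT: "subgroup (normzr Z) G" if "Z \<in> subs G 2" for Z using normzr_subgroup subs_carrier that by blast
  have finF: "finite (Fib Z)" for Z by (simp add: Fib_def)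
  have conj_ex: "\<exists>g\<in>carrier G. W = conjg g Z" if "Z \<in> subs G 2" "W \<in> subs G 2" for Z W
  proof -
    have "W \<in> conj_class Z" using that conj_class_eq[OF Xc, of Z] cl(1) by simp
    then show ?thesis by (auto simp: conj_class_def)
  qed
  have Fib_le: "card (Fib Z) \<le> card (Fib W)" if Z: "Z \<in> subs G 2" and W: "W \<in> subs G 2" for Z W
  proof -
    obtain g where g: "g \<in> carrier G" "W = conjg g Z" using conj_ex Z W by blast
    show ?thesis
    proof (rule card_inj_on_le[OF _ _ finF])
      show "inj_on (conjg g) (Fib Z)"
        by (rule inj_on_inverseI[where g = "conjg (inv g)"])
          (use conjg_inv_cancel(1)[OF g(1)] subs_carrier in \<open>auto simp: Fib_def\<close>)
      show "conjg g ` Fib Z \<subseteq> Fib W"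
        using conjg_subs[OF g(1)] normzr_conjg[OF g(1)] subs_carrier Z by (auto simp: Fib_def g(2))
    qed
  qed
  define s where "s = card (Fib X)"
  have s: "card (Fib Z) = s" if "Z \<in> subs G 2" for Z
    using Fib_le[OF that X] Fib_le[OF X that] by (simp add: s_def)
  define Im where "Im = normzr ` subs G 2"
  have "(\<Sum>t\<in>Im. \<Sum>W\<in>{W \<in> subs G 2. normzr W = t}. 1::nat) = (\<Sum>W\<in>subs G 2. 1)"
    by (rule sum.group) (auto simp: Im_def)
  then have "(\<Sum>t\<in>Im. card {W \<in> subs G 2. normzr W = t}) = 9" using n9 by simp
  moreover have "card {W \<in> subs G 2. normzr W = t} = s" if "t \<in> Im" for t
    using that s by (auto simp: Im_def Fib_def)
  ultimately have Im9: "card Im * s = 9" by simp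
  have s1: "s \<noteq> 1"
  proof
    assume "s = 1"
    then have "card Im = 9" using Im9 by simp
    moreover have "Im \<subseteq> subs G (2 ^ a)" using cT sT by (auto simp: Im_def subs_def)
    then have "card Im \<le> card (subs G (2 ^ a))" by (intro card_mono) auto
    moreover obtain k where k: "(2::nat) ^ a = 4 * k"
      using le_imp_power_dvd[OF a, of "2::nat"] by (auto elim: dvdE)
    then have "(2::nat) ^ a \<noteq> 1" "(2::nat) ^ a \<noteq> 2" "(2::nat) ^ a \<noteq> 3" "(2::nat) ^ a \<noteq> 6" "(2::nat) ^ a \<noteq> 9"
      by presburger+
    then have "card (subs G 2) + card (subs G 3) + card (commuting_pairs 2 3) + (\<Sum>d\<in>{2 ^ a}. card (subs G d)) \<le> 21"
      using o by (intro count_bound_9_dvd[OF nine]) auto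
    ultimately show False using n9 subs_3_count by simp
  qed
  have "s dvd 9" using Im9 dvd_triv_right by metis
  then have "s dvd 3 ^ 2" by simp
  then obtain i where i: "i \<le> 2" "s = 3 ^ i" using divides_primepow_nat[of 3 s 2] by auto
  have "i = 0 \<or> i = 1 \<or> i = 2" using i(1) by linarith
  then have "s = 3 \<or> s = 9" using s1 i(2) by auto
  then have "A \<subseteq> normzr B"
  proof
    assume s9: "s = 9"
    have "Fib A = subs G 2" using s[OF A] s9 n9 by (intro card_subset_eq) (auto simp: Fib_def)
    then have "normzr B = normzr A" using B by (auto simp: Fib_def)
    then show ?thesis using subset_normzr subsD(1)[OF A] by simp
  next
    assume s3: "s = 3"
    show ?thesis
    proof (cases "normzr B = normzr A")
      case True
      then show ?thesis using subset_normzr subsD(1)[OF A] by simp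
    next
      case False
      have cIm: "card Im = 3" using Im9 s3 by simp
      have finIm: "finite Im" by (simp add: Im_def)
      have AB_Im: "normzr A \<in> Im" "normzr B \<in> Im" using A B by (auto simp: Im_def)
      have tc: "t \<subseteq> carrier G" if "t \<in> Im" for t using that by (auto simp: Im_def normzr_def)
      have Im_conj: "conjg g t \<in> Im" if g: "g \<in> carrier G" and t: "t \<in> Im" for g t
      proof -
        obtain W where W: "W \<in> subs G 2" "t = normzr W" using t by (auto simp: Im_def)
        then have "conjg g t = normzr (conjg g W)" using normzr_conjg[OF g subs_carrier[OF W(1)]] by simp
        then show ?thesis using conjg_subs[OF g W(1)] by (simp add: Im_def)
      qed
      have inj: "t = u" if "g \<in> carrier G" "t \<in> Im" "u \<in> Im" "conjg g t = conjg g u" for g t u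
        using conjg_inv_cancel(1)[OF that(1)] tc that(2-4) by metis
      obtain C D where CD: "C \<in> Fib A" "D \<in> Fib A" "C \<noteq> D"
      proof -
        have "2 \<le> card (Fib A)" using s[OF A] s3 by simp
        then show thesis using that ex_two_elements by metis
      qed
      have C: "C \<in> subs G 2" "normzr C = normzr A" and D: "D \<in> subs G 2" "normzr D = normzr A"
        using CD by (auto simp: Fib_def)
      obtain x where x: "C = {\<one>, x}" "x \<noteq> \<one>" "x \<in> carrier G" "x \<otimes> x = \<one>" using C(1) by (rule involution_subsE)
      obtain y where y: "D = {\<one>, y}" "y \<noteq> \<one>" "y \<in> carrier G" "y \<otimes> y = \<one>" using D(1) by (rule involution_subsE)
      have "C \<subseteq> normzr D" using subset_normzr[OF subsD(1)[OF C(1)]] C D by simp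
      then have "C \<subseteq> centralizer D" using involutions_commute_iff(1)[OF C(1) D(1)] by simp
      then have xy: "x \<otimes> y = y \<otimes> x" using x y by (auto simp: centralizer_def)
      define z where "z = x \<otimes> y"
      have zc: "z \<in> carrier G" using x y by (simp add: z_def)
      have "inv y = y" using y by (simp add: inv_equality)
      then have z1: "z \<noteq> \<one>" using x y CD(3) unfolding z_def by (metis inv_equality)
      have "z \<otimes> z = (x \<otimes> y) \<otimes> (y \<otimes> x)" using xy by (simp add: z_def)
      also have "\<dots> = x \<otimes> (y \<otimes> y) \<otimes> x" using x(3) y(3) by (simp add: m_assoc)
      finally have "z \<otimes> z = x \<otimes> (y \<otimes> y) \<otimes> x" .
      then have zz: "z \<otimes> z = \<one>" using x y by simp
      have E: "{\<one>, z} \<in> subs G 2" using involution_subs zc z1 zz by blast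
      have NE: "normzr {\<one>, z} = normzr A"
      proof -
        have "normzr A \<subseteq> normzr {\<one>, z}"
        proof
          fix g assume g: "g \<in> normzr A"
          have gc: "g \<in> carrier G" using g by (simp add: normzr_def)
          have "g \<in> centralizer C" "g \<in> centralizer D"
            using normalizes_involution[OF C(1)] normalizes_involution[OF D(1)] g C D by auto
          then have "g \<otimes> x = x \<otimes> g" "g \<otimes> y = y \<otimes> g" using x y by (auto simp: centralizer_def)
          then have "g \<otimes> z = z \<otimes> g" using gc x(3) y(3) unfolding z_def by (metis m_assoc)
          then have "g \<in> centralizer {\<one>, z}" using gc by (simp add: centralizer_def)
          then show "g \<in> normzr {\<one>, z}" using centralizer_subset_normzr[of "{\<one>, z}"] zc by auto
        qed
        then show ?thesis using subgroup_card_eq[OF sT[OF A] sT[OF E]] cT[OF A] cT[OF E] by simp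
      qed
      define Z where "Z = normzr B"
      have Z: "Z \<in> Im" "Z \<noteq> normzr A" using AB_Im False by (auto simp: Z_def)
      \<comment> \<open>If neither \<open>x\<close> nor \<open>y\<close> fixes \<open>Z\<close>, both exchange it with the third normalizer.\<close>
      have fixA: "conjg g (normzr A) = normzr A" if "g \<in> normzr A" for g
        using conjg_self[OF sT[OF A] that] .
      have xA: "x \<in> normzr A" using x C subset_normzr[OF subsD(1)[OF C(1)]] by auto
      have yA: "y \<in> normzr A" using y D subset_normzr[OF subsD(1)[OF D(1)]] by auto
      have "\<exists>V v. V \<in> subs G 2 \<and> normzr V = normzr A \<and> V = {\<one>, v} \<and> v \<in> carrier G \<and> conjg v Z = Z"
      proof (cases "conjg x Z = Z \<or> conjg y Z = Z")
        case True
        then show ?thesis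
        proof
          assume "conjg x Z = Z"
          then show ?thesis using C x(1,3) by (intro exI[of _ C] exI[of _ x]) simp
        next
          assume "conjg y Z = Z"
          then show ?thesis using D y(1,3) by (intro exI[of _ D] exI[of _ y]) simp
        qed
      next
        case False
        have third: "t = u" if "t \<in> Im" "u \<in> Im" "t \<noteq> normzr A" "u \<noteq> normzr A" "t \<noteq> Z" "u \<noteq> Z" for t u
        proof (rule ccontr)
          assume "t \<noteq> u"
          then have "card {normzr A, Z, t, u} = 4" using that Z(2) by auto
          moreover have "card {normzr A, Z, t, u} \<le> card Im"
            by (rule card_mono[OF finIm]) (use that Z AB_Im in blast)
          ultimately show False using cIm by simp
        qed
        have nA: "conjg g t \<noteq> normzr A" if "g \<in> normzr A" "t \<in> Im" "t \<noteq> normzr A" for g t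
          using inj[of g t "normzr A"] fixA[OF that(1)] that AB_Im by (auto simp: normzr_def)
        have xZ: "conjg x Z \<in> Im" "conjg x Z \<noteq> normzr A" "conjg x Z \<noteq> Z"
          using Im_conj x(3) Z nA[OF xA] False by auto
        have yZ: "conjg y Z \<in> Im" "conjg y Z \<noteq> normzr A" "conjg y Z \<noteq> Z"
          using Im_conj y(3) Z nA[OF yA] False by auto
        have "conjg x Z = conjg y Z" using third xZ yZ by blast
        then have "conjg z Z = conjg x (conjg x Z)" using x y conjg_mult[OF x(3) y(3) tc[OF Z(1)]] by (simp add: z_def)
        also have "\<dots> = Z" using conjg_mult[OF x(3) x(3) tc[OF Z(1)]] x(4) conjg_one[OF tc[OF Z(1)]] by simp
        finally have "conjg z Z = Z" .
        then show ?thesis using E NE zc by (intro exI[of _ "{\<one>, z}"] exI[of _ z]) simp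
      qed
      then obtain V v where V: "V \<in> subs G 2" "normzr V = normzr A" "V = {\<one>, v}" "v \<in> carrier G" "conjg v Z = Z"
        by blast
      have V': "subgroup V G" "card V = 2 ^ 1" using subsD[OF V(1)] by auto
      have VZ: "conjg g Z = Z" if "g \<in> V" for g
        using that V conjg_one[OF tc[OF Z(1)]] by auto
      have "card (Fib B) mod 2 = card {H \<in> Fib B. V \<subseteq> normzr H} mod 2"
      proof (rule fixed_subsets_cong[OF V' _ _ finF])
        show "Fib B \<subseteq> Pow (carrier G)" using subs_in_Pow by (auto simp: Fib_def)
        fix g H assume g: "g \<in> V" and H: "H \<in> Fib B"
        have gc: "g \<in> carrier G" using g subs_carrier[OF V(1)] by blast
        show "conjg g H \<in> Fib B"
          using H conjg_subs[OF gc] normzr_conjg[OF gc subs_carrier] VZ[OF g] by (auto simp: Fib_def Z_def)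
      qed simp
      then have "card {H \<in> Fib B. V \<subseteq> normzr H} mod 2 = 1" using s[OF B] s3 by simp
      then obtain H where H: "H \<in> Fib B" "V \<subseteq> normzr H"
        by (metis (mono_tags, lifting) card.empty empty_Collect_eq mod_0 zero_neq_one)
      then have "V \<subseteq> normzr B" by (simp add: Fib_def)
      then have "B \<subseteq> normzr V" using involutions_commute_iff(2)[OF V(1) B] by simp
      then have "B \<subseteq> normzr A" using V(2) by simp
      then show ?thesis using involutions_commute_iff(2)[OF B A] by simp
    qed
  qed
  then show ?thesis using involutions_commute_iff(1)[OF A B] by simp
qed

theorem order_12: "order G = 12"
proof (rule order_12_if_not_9_dvd, rule notI)
  assume nine: "9 dvd order G"
  obtain X where X: "X \<in> subs G 2" "card (conj_class X) = 3 \<or> card (conj_class X) = 9"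
    using odd_class[OF nine] by blast
  then have c9: "card (conj_class X) = 9" using no_class_of_3[OF nine] by blast
  note cl = class_of_9[OF nine X(1) c9]
  have n9: "card (subs G 2) = 9" using cl(1) c9 by simp
  obtain a where a: "order G = 9 * 2 ^ a" using cl(3) by blast
  consider "a = 0" | "a = 1" | "2 \<le> a" by linarith
  then show False
  proof cases
    case 1
    then show False using a two_three_dvd_order(1) by simp
  next
    case 2
    then show False using order_not_18 a n9 by simp
  next
    case 3
    then show False
      using involutions_not_all_commute[OF n9 class_of_9_commute[OF nine X(1) c9 a 3]] by blast
  qed
qed

end

section \<open>Surjections of finite groups\<close>

locale finite_epi = G: finite_group G + H: group H for G (structure) and H (structure) and h +
  assumes hom: "h \<in> hom G H" and surj: "h ` carrier G = carrier H"

sublocale finite_epi \<subseteq> hom: group_hom G H h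
  by unfold_locales (rule hom)

sublocale finite_epi \<subseteq> H: finite_group H
  by unfold_locales (metis surj G.fin finite_imageI)

text \<open>
  For a normal subgroup of order \<open>p\<close>, these subgroups cannot contain it; and they lift along every
  surjection, whatever its kernel. They provide the lower bounds.
\<close>

definition coprime_primepow_subs :: "nat \<Rightarrow> ('a, 'b) monoid_scheme \<Rightarrow> 'a set set"
  where "coprime_primepow_subs p G = {U. subgroup U G \<and> coprime (card U) p \<and> (\<exists>r k. prime r \<and> card U = r ^ k)}"

text \<open>
  These provide the upper bounds: if a central subgroup of order \<open>p\<close> is the only one of its order,
  they account for all subgroups that do not contain it.
\<close>

definition coprime_subs :: "nat \<Rightarrow> ('a, 'b) monoid_scheme \<Rightarrow> 'a set set"
  where "coprime_subs p G = {U. subgroup U G \<and> coprime (card U) p}"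

lemma coprime_primepow_subs_primeI:
  assumes "subgroup U G" "prime r" "card U = r ^ k" "coprime (card U) p" shows "U \<in> coprime_primepow_subs p G"
  using assms unfolding coprime_primepow_subs_def by blast

lemma (in group) coprime_primepow_subs_one: "{\<one>} \<in> coprime_primepow_subs p G"
  by (rule coprime_primepow_subs_primeI[OF triv_subgroup two_is_prime_nat, of 0]) simp_all

context finite_epi begin

abbreviation K where "K \<equiv> kernel G H h"

definition preimage :: "'c set \<Rightarrow> 'a set" where "preimage B = {x \<in> carrier G. h x \<in> B}"

lemma K_normal: "K \<lhd> G" by (rule hom.normal_kernel)
lemma K_subgroup: "subgroup K G" by (rule hom.subgroup_kernel)

lemma image_subgroup: "subgroup U G \<Longrightarrow> subgroup (h ` U) H"
  by (rule hom.subgroup_img_is_subgroup)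

lemma preimage_subgroup:
  assumes "subgroup B H" shows "subgroup (preimage B) G"
proof (rule G.subgroupI)
  have "\<one> \<in> preimage B" using subgroup.one_closed[OF assms] by (simp add: preimage_def)
  then show "preimage B \<noteq> {}" by blast
  show "inv a \<in> preimage B" if "a \<in> preimage B" for a
    using that subgroup.m_inv_closed[OF assms] by (simp add: preimage_def)
  show "a \<otimes> b \<in> preimage B" if "a \<in> preimage B" "b \<in> preimage B" for a b
    using that subgroup.m_closed[OF assms] by (simp add: preimage_def)
qed (auto simp: preimage_def)

lemma image_preimage:
  assumes "B \<subseteq> carrier H" shows "h ` preimage B = B"
proof
  show "h ` preimage B \<subseteq> B" by (auto simp: preimage_def)
  show "B \<subseteq> h ` preimage B"
  proof
    fix b assume b: "b \<in> B"
    then obtain x where "x \<in> carrier G" "b = h x" using assms surj by blast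
    then show "b \<in> h ` preimage B" using b by (auto simp: preimage_def)
  qed
qed

lemma K_le_preimage: "subgroup B H \<Longrightarrow> K \<subseteq> preimage B"
  using subgroup.one_closed[of B H] by (auto simp: preimage_def kernel_def)

lemma preimage_image:
  assumes U: "subgroup U G" and KU: "K \<subseteq> U" shows "preimage (h ` U) = U"
proof
  have Uc: "U \<subseteq> carrier G" using U by (rule subgroup.subset)
  then show "U \<subseteq> preimage (h ` U)" by (auto simp: preimage_def)
  show "preimage (h ` U) \<subseteq> U"
  proof
    fix x assume "x \<in> preimage (h ` U)"
    then obtain u where u: "u \<in> U" "h x = h u" and x: "x \<in> carrier G" by (auto simp: preimage_def)
    have uc: "u \<in> carrier G" using u Uc by blast
    have "inv u \<otimes> x \<in> K" using u x uc by (simp add: kernel_def)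
    then have "u \<otimes> (inv u \<otimes> x) \<in> U" using KU u(1) U by (meson subgroup.m_closed subsetD)
    then show "x \<in> U" using uc x by (simp flip: G.m_assoc)
  qed
qed

lemma card_image_mult:
  assumes U: "subgroup U G" shows "card U = card (h ` U) * card (U \<inter> K)"
proof -
  have Uc: "U \<subseteq> carrier G" using U by (rule subgroup.subset)
  have finU: "finite U" using G.finite_subgroup U by blast
  have "(\<Sum>b\<in>h ` U. \<Sum>u\<in>{u \<in> U. h u = b}. 1::nat) = (\<Sum>u\<in>U. 1)"
    using finU by (intro sum.group) auto
  then have "card U = (\<Sum>b\<in>h ` U. card {u \<in> U. h u = b})" by simp
  also have "\<dots> = (\<Sum>b\<in>h ` U. card (U \<inter> K))"
  proof (rule sum.cong)
    fix b assume "b \<in> h ` U"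
    then obtain u where u: "u \<in> U" "b = h u" by blast
    have uc: "u \<in> carrier G" using u Uc by blast
    have "bij_betw (\<lambda>k. u \<otimes> k) (U \<inter> K) {v \<in> U. h v = b}"
    proof (rule bij_betw_byWitness[where f' = "\<lambda>v. inv u \<otimes> v"])
      show "\<forall>k\<in>U \<inter> K. inv u \<otimes> (u \<otimes> k) = k" using uc Uc by (auto simp flip: G.m_assoc)
      show "\<forall>v\<in>{v \<in> U. h v = b}. u \<otimes> (inv u \<otimes> v) = v" using uc Uc by (auto simp flip: G.m_assoc)
      show "(\<otimes>) u ` (U \<inter> K) \<subseteq> {v \<in> U. h v = b}"
        using u uc U by (auto simp: kernel_def subgroup.m_closed)
      show "(\<otimes>) (inv u) ` {v \<in> U. h v = b} \<subseteq> U \<inter> K"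
        using u uc U Uc by (auto simp: kernel_def subgroup.m_closed subgroup.m_inv_closed)
    qed
    then show "card {v \<in> U. h v = b} = card (U \<inter> K)" by (simp add: bij_betw_same_card)
  qed simp
  finally show ?thesis by simp
qed

lemma card_preimage: "subgroup B H \<Longrightarrow> card (preimage B) = card B * card K"
  using card_image_mult[OF preimage_subgroup] image_preimage[OF subgroup.subset] K_le_preimage by (metis inf.absorb2)

lemma order_mult: "order G = order H * card K"
  using card_image_mult[OF G.subgroup_self] surj K_subgroup subgroup.subset
  by (metis inf.absorb2 order_def)

lemma card_image_trivial:
  assumes "subgroup U G" "U \<inter> K = {\<one>}" shows "card (h ` U) = card U"
  using card_image_mult[OF assms(1)] assms(2) by simp

lemma h_conjg: "g \<in> carrier G \<Longrightarrow> U \<subseteq> carrier G \<Longrightarrow> h ` G.conjg g U = H.conjg (h g) (h ` U)"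
  by (force simp: G.conjg_def H.conjg_def image_image subset_eq intro!: image_cong)

lemma h_class:
  assumes U: "U \<subseteq> carrier G" shows "(\<lambda>V. h ` V) ` G.conj_class U = H.conj_class (h ` U)"
proof -
  have "(\<lambda>V. h ` V) ` G.conj_class U = (\<lambda>g. H.conjg (h g) (h ` U)) ` carrier G"
    using h_conjg[OF _ U] by (force simp: G.conj_class_def image_image intro!: image_cong)
  also have "\<dots> = (\<lambda>y. H.conjg y (h ` U)) ` (h ` carrier G)" by (simp add: image_image)
  finally show ?thesis by (simp add: surj H.conj_class_def)
qed

text \<open>
  A Sylow \<open>r\<close>-subgroup \<open>R\<close> of the preimage of \<open>B\<close> does it: comparing orders, its intersection with the
  kernel accounts for no more than the \<open>r\<close>-part of the kernel, so its image is not smaller than \<open>B\<close>.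
\<close>

lemma lift_prime_power_subgroup:
  assumes B: "subgroup B H" "card B = r ^ k" and r: "prime r"
  obtains R j where "subgroup R G" "card R = r ^ j" "h ` R = B"
proof -
  have P: "subgroup (preimage B) G" using preimage_subgroup B(1) .
  obtain i m where im: "card K = r ^ i * m" "\<not> r dvd m"
    using prime_power_split[OF r G.card_subgroup_pos[OF K_subgroup]] by blast
  have cP: "card (preimage B) = r ^ (k + i) * m" using card_preimage[OF B(1)] B(2) im by (simp add: power_add mult.assoc)
  then obtain R where R: "R \<in> subs G (r ^ (k + i))" "R \<subseteq> preimage B"
    using G.sylow_in_subgroup[OF P r, of "k + i"] by auto
  have R': "subgroup R G" "card R = r ^ (k + i)" using subsD[OF R(1)] by auto
  have sub: "h ` R \<subseteq> B" using R(2) by (auto simp: preimage_def)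
  have hR: "subgroup (h ` R) H" using image_subgroup R'(1) .
  have iK: "subgroup (R \<inter> K) G" using R'(1) K_subgroup by (rule G.subgroups_Inter_pair)
  have "card (R \<inter> K) dvd r ^ (k + i)" using G.card_subgroup_dvd_subgroup[OF iK R'(1)] R'(2) by simp
  then obtain l where l: "card (R \<inter> K) = r ^ l" using divides_primepow_nat r by blast
  have "r ^ l dvd r ^ i * m" using G.card_subgroup_dvd_subgroup[OF iK K_subgroup] l im by simp
  moreover have "coprime (r ^ l) m" using prime_imp_coprime[OF r im(2)] by simp
  ultimately have "r ^ l dvd r ^ i" by (simp add: coprime_dvd_mult_left_iff)
  then have li: "r ^ l \<le> r ^ i" using r by (intro dvd_imp_le) (auto simp: prime_gt_0_nat)
  have "r ^ k * r ^ i = card (h ` R) * r ^ l"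
    using card_image_mult[OF R'(1)] R'(2) l by (simp add: power_add)
  also have "\<dots> \<le> card (h ` R) * r ^ i" using li by simp
  finally have "card B \<le> card (h ` R)" using B(2) prime_gt_0_nat[OF r] by simp
  then have "h ` R = B" using H.subgroup_card_eq[OF hR B(1) sub] by simp
  then show thesis using that R' by blast
qed

lemma lift_coprime:
  assumes B: "subgroup B H" "card B = r ^ k" and r: "prime r" and co: "\<not> r dvd card K"
  obtains R where "subgroup R G" "card R = r ^ k" "h ` R = B"
proof -
  obtain R j where R: "subgroup R G" "card R = r ^ j" "h ` R = B" using lift_prime_power_subgroup[OF B r] by blast
  have "coprime (card R) (card K)" using prime_imp_coprime[OF r co] R(2) by simp
  then have "R \<inter> K = {\<one>}" using G.coprime_Int[OF R(1) K_subgroup] by blast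
  then have "card R = r ^ k" using card_image_trivial[OF R(1)] R(3) B(2) by simp
  then show thesis using that R by blast
qed

lemma lift_coprime_primepow_subs:
  assumes "B \<in> coprime_primepow_subs p H" shows "\<exists>R \<in> coprime_primepow_subs p G. h ` R = B"
proof -
  obtain r k where B: "subgroup B H" "coprime (card B) p" "prime r" "card B = r ^ k"
    using assms by (auto simp: coprime_primepow_subs_def)
  show ?thesis
  proof (cases "k = 0")
    case True
    then have "B = {\<one>\<^bsub>H\<^esub>}" using B H.subs_one by (auto simp: subs_def)
    then show ?thesis by (intro bexI[OF _ G.coprime_primepow_subs_one]) auto
  next
    case False
    obtain R j where R: "subgroup R G" "card R = r ^ j" "h ` R = B" using lift_prime_power_subgroup[OF B(1,4,3)] by blast
    have "coprime r p" using B(2,4) False by simp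
    then have "coprime (card R) p" using R(2) by simp
    then show ?thesis using coprime_primepow_subs_primeI[OF R(1) B(3) R(2)] R(3) by blast
  qed
qed

lemma finite_coprime_primepow_subs [simp]: "finite (coprime_primepow_subs p G)" "finite (coprime_primepow_subs p H)" "finite (coprime_subs p G)" "finite (coprime_subs p H)"
proof -
  show "finite (coprime_primepow_subs p G)" "finite (coprime_subs p G)"
    by (rule finite_subset[OF _ G.finite_subgroups], auto simp: coprime_primepow_subs_def coprime_subs_def)+
  show "finite (coprime_primepow_subs p H)" "finite (coprime_subs p H)"
    by (rule finite_subset[OF _ H.finite_subgroups], auto simp: coprime_primepow_subs_def coprime_subs_def)+
qed

lemma card_coprime_primepow_subs_le: "card (coprime_primepow_subs p H) \<le> card (coprime_primepow_subs p G)"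
proof -
  have "coprime_primepow_subs p H \<subseteq> (\<lambda>R. h ` R) ` coprime_primepow_subs p G" using lift_coprime_primepow_subs by blast
  then show ?thesis by (rule surj_card_le[rotated]) simp
qed

text \<open>
  The kernel itself is among the subgroups on the right; it has the same image as the trivial one.
\<close>

lemma card_coprime_primepow_subs_less:
  assumes K: "prime (card K)" "coprime (card K) p" shows "card (coprime_primepow_subs p H) + 1 \<le> card (coprime_primepow_subs p G)"
proof -
  have KG: "K \<in> coprime_primepow_subs p G"
    by (rule coprime_primepow_subs_primeI[OF K_subgroup K(1) _ K(2), of 1]) simp
  note oneG = G.coprime_primepow_subs_one
  have im: "h ` K = {\<one>\<^bsub>H\<^esub>}" "h ` {\<one>} = {\<one>\<^bsub>H\<^esub>}"
    using subgroup.one_closed[OF K_subgroup] by (auto simp: kernel_def image_iff)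
  have "K \<noteq> {\<one>}" using K(1) by auto
  have "coprime_primepow_subs p H \<subseteq> (\<lambda>R. h ` R) ` (coprime_primepow_subs p G - {K})"
  proof
    fix B assume "B \<in> coprime_primepow_subs p H"
    then obtain R where R: "R \<in> coprime_primepow_subs p G" "h ` R = B" using lift_coprime_primepow_subs by blast
    show "B \<in> (\<lambda>R. h ` R) ` (coprime_primepow_subs p G - {K})"
    proof (cases "R = K")
      case True
      then have "B = h ` {\<one>}" using R im by simp
      then show ?thesis using oneG \<open>K \<noteq> {\<one>}\<close> by blast
    qed (use R in blast)
  qed
  then have "card (coprime_primepow_subs p H) \<le> card (coprime_primepow_subs p G - {K})" by (rule surj_card_le[rotated]) simp
  then show ?thesis using KG card_gt_0_iff[of "coprime_primepow_subs p G"] by auto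
qed

lemma card_containing_K: "card {U. subgroup U G \<and> K \<subseteq> U} = Sub H"
  unfolding Sub_def
proof (rule bij_betw_same_card)
  show "bij_betw (\<lambda>U. h ` U) {U. subgroup U G \<and> K \<subseteq> U} {H'. subgroup H' H}"
  proof (rule bij_betw_byWitness[where f' = preimage])
    show "\<forall>U\<in>{U. subgroup U G \<and> K \<subseteq> U}. preimage (h ` U) = U" using preimage_image by blast
    show "\<forall>B\<in>{H'. subgroup H' H}. h ` preimage B = B" using image_preimage[OF subgroup.subset] by blast
    show "(\<lambda>U. h ` U) ` {U. subgroup U G \<and> K \<subseteq> U} \<subseteq> {H'. subgroup H' H}" using image_subgroup by blast
    show "preimage ` {H'. subgroup H' H} \<subseteq> {U. subgroup U G \<and> K \<subseteq> U}" using preimage_subgroup K_le_preimage by blast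
  qed
qed

definition not_above_K :: "'a set set" where "not_above_K = {U. subgroup U G \<and> \<not> K \<subseteq> U}"

lemma finite_not_above_K [simp]: "finite not_above_K"
  by (rule finite_subset[OF _ G.finite_subgroups]) (auto simp: not_above_K_def)

text \<open>
  By the correspondence theorem, \<open>H\<close> accounts for the subgroups that contain the kernel.
\<close>

lemma Sub_split: "Sub G = Sub H + card not_above_K"
proof -
  have "{U. subgroup U G} = {U. subgroup U G \<and> K \<subseteq> U} \<union> not_above_K" by (auto simp: not_above_K_def)
  then have "Sub G = card ({U. subgroup U G \<and> K \<subseteq> U} \<union> not_above_K)" by (simp add: Sub_def)
  also have "\<dots> = card {U. subgroup U G \<and> K \<subseteq> U} + card not_above_K"
    by (rule card_Un_disjoint) (auto simp: not_above_K_def intro: finite_subset[OF _ G.finite_subgroups])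
  finally show ?thesis using card_containing_K by simp
qed

lemma not_above_K_if_not_dvd:
  assumes "subgroup U G" "\<not> card K dvd card U" shows "U \<in> not_above_K"
  using assms G.card_subgroup_dvd_subgroup[OF K_subgroup] by (auto simp: not_above_K_def)

lemma coprime_primepow_subs_subset_not_above_K:
  assumes "prime (card K)" shows "coprime_primepow_subs (card K) G \<subseteq> not_above_K"
proof
  fix U assume "U \<in> coprime_primepow_subs (card K) G"
  then have U: "subgroup U G" "coprime (card U) (card K)" by (auto simp: coprime_primepow_subs_def)
  have "\<not> card K dvd card U"
    using U(2) assms by (metis coprime_common_divisor_nat dvd_refl not_prime_1)
  then show "U \<in> not_above_K" using not_above_K_if_not_dvd U by blast
qed

lemma other_prime_subs_in_not_above_K: "subs G (card K) - {K} \<subseteq> not_above_K"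
proof
  fix W assume W: "W \<in> subs G (card K) - {K}"
  then have Ws: "subgroup W G" "card W = card K" by (auto simp: subs_def)
  have "\<not> K \<subseteq> W"
  proof
    assume "K \<subseteq> W"
    then have "K = W" by (rule G.subgroup_card_eq[OF K_subgroup Ws(1)]) (simp add: Ws(2))
    then show False using W by blast
  qed
  then show "W \<in> not_above_K" using Ws by (simp add: not_above_K_def)
qed

end

section \<open>The alternating group of degree 4\<close>

text \<open>
  Up to isomorphism there is only one such group. Its subgroups are derived from these two
  properties, so that no isomorphism has to be constructed.
\<close>

locale a4_group = group_no_prime_normal +
  assumes order12: "order G = 12"

context a4_group begin

text \<open>
  Seven subgroups of order 3 would have 14 elements of order 3.
\<close>

lemma card_subs_3: "card (subs G 3) = 4"
proof -
  have "(\<Union>Y\<in>subs G 3. Y - {\<one>}) \<subseteq> carrier G - {\<one>}" using subs_carrier by blast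
  then have "card (\<Union>Y\<in>subs G 3. Y - {\<one>}) \<le> card (carrier G - {\<one>})" using fin by (intro card_mono) auto
  also have "\<dots> = 11" using order12 fin by (simp add: card_Diff_singleton order_def)
  finally have "card (subs G 3) * 2 \<le> 11" using card_prime_subs_elements[of 3] by simp
  then show ?thesis using card_subs_ge[of 3] order12 by simp presburger
qed

lemma class_subs_3: "Y \<in> subs G 3 \<Longrightarrow> conj_class Y = subs G 3"
  using conj_class_eq_subs[of 3] order12 by simp

text \<open>
  The Klein four-group, obtained by removing the elements of order 3.
\<close>

definition "V = carrier G - (\<Union>Y\<in>subs G 3. Y - {\<one>})"

lemma card_V: "card V = 4"
proof -
  have sub: "(\<Union>Y\<in>subs G 3. Y - {\<one>}) \<subseteq> carrier G" using subs_carrier by blast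
  then show ?thesis
    unfolding V_def using card_Diff_subset[OF finite_subset[OF sub fin] sub]
      card_prime_subs_elements[of 3] card_subs_3 order12 by (simp add: order_def)
qed

lemma coprime_3_subset_V:
  assumes "subgroup B G" "\<not> 3 dvd card B" shows "B \<subseteq> V"
proof -
  have "x = \<one>" if "x \<in> B" "x \<in> Y" "Y \<in> subs G 3" for x Y
  proof (rule ccontr)
    assume "x \<noteq> \<one>"
    then have "Y \<subseteq> B" using prime_subs_Int[OF that(3) _ assms(1) that(2,1)] by simp
    then have "3 dvd card B" using card_subgroup_dvd_subgroup[OF subsD(1)[OF that(3)] assms(1)] subsD(2)[OF that(3)] by simp
    then show False using assms(2) by simp
  qed
  then show ?thesis using subgroup.subset[OF assms(1)] by (auto simp: V_def)
qed

lemma finite_V: "finite V" using fin by (simp add: V_def)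

lemma subs_4: "subs G 4 = {V}"
proof -
  have eq: "T = V" if T: "T \<in> subs G 4" for T
  proof -
    have "T \<subseteq> V" using coprime_3_subset_V subsD[OF T] by simp
    then show ?thesis using card_subset_eq[OF finite_V] subsD[OF T] card_V by simp
  qed
  moreover obtain T where "T \<in> subs G 4" using sylow_subs[of 2 2] order12 by auto
  ultimately show ?thesis by blast
qed

lemma V_subgroup: "subgroup V G" using subs_4 subsD(1) by blast

lemma subs_2_in_V: "X \<in> subs G 2 \<Longrightarrow> X \<subseteq> V"
  using coprime_3_subset_V[of X] subsD[of X G 2] by simp

lemma card_subs_2: "card (subs G 2) = 3"
proof -
  have "{X \<in> subs G 2. X \<subseteq> V} = subs G 2" using subs_2_in_V by blast
  then have "card (subs G 2) \<le> 3" using card_subs_2_in[OF V_subgroup] card_V by simp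
  then show ?thesis using card_subs_ge(1)[of 2] order12 by simp
qed

text \<open>
  Each class has at least two members, and there are only three subgroups of order 2.
\<close>

lemma class_subs_2:
  assumes X: "X \<in> subs G 2" shows "conj_class X = subs G 2"
proof (rule ccontr)
  assume ne: "conj_class X \<noteq> subs G 2"
  have sub: "conj_class X \<subseteq> subs G 2" using conj_class_subset_subs[OF X] .
  then obtain Z where Z: "Z \<in> subs G 2" "Z \<notin> conj_class X" using ne by blast
  have c: "X \<subseteq> carrier G" "Z \<subseteq> carrier G" using X Z subs_carrier by auto
  have "conj_class Z \<inter> conj_class X = {}"
    using conj_class_eq[OF c(2)] conj_class_eq[OF c(1)] self_in_class[OF c(2)] Z(2) by blast
  then have "card (conj_class Z \<union> conj_class X) = card (conj_class Z) + card (conj_class X)"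
    using finite_conj_class c by (intro card_Un_disjoint) auto
  moreover have "card (conj_class Z \<union> conj_class X) \<le> card (subs G 2)"
    using sub conj_class_subset_subs[OF Z(1)] by (intro card_mono) auto
  ultimately show False using conj_class_ge_2[OF X] conj_class_ge_2[OF Z(1)] card_subs_2 by simp
qed

text \<open>
  Two subgroups of order 3 do not fit into a group of order 6, so a subgroup of order 6 would
  normalize one of order 3, whose normalizer has order 3 only.
\<close>

lemma subs_6: "subs G 6 = {}"
proof (rule ccontr)
  assume "subs G 6 \<noteq> {}"
  then obtain K where K: "K \<in> subs G 6" by blast
  have K': "subgroup K G" "card K = 6" using subsD[OF K] by auto
  obtain Y where Y: "Y \<in> subs G 3" "Y \<subseteq> K" using cauchy_in_subgroup[OF K'(1), of 3] K'(2) by auto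
  have Yc: "Y \<subseteq> carrier G" using subs_carrier Y by blast
  have "4 * card (normzr Y) = 12"
    using card_class_mult_card_normzr[OF Yc] class_subs_3[OF Y(1)] card_subs_3 order12 by simp
  then have N: "card (normzr Y) = 3" by simp
  have "K \<subseteq> normzr Y"
  proof
    fix k assume k: "k \<in> K"
    have kc: "k \<in> carrier G" using k subs_carrier[OF K] by blast
    have "conjg k Y \<subseteq> K" using conjg_mono[OF Y(2)] conjg_self[OF K'(1) k] by blast
    have "conjg k Y = Y"
    proof (rule ccontr)
      assume ne: "conjg k Y \<noteq> Y"
      have Z: "conjg k Y \<in> subs G 3" using conjg_subs[OF kc Y(1)] .
      have "Y <#> conjg k Y \<subseteq> K"
        using Y(2) \<open>conjg k Y \<subseteq> K\<close> subgroup.m_closed[OF K'(1)] by (auto simp: set_mult_def)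
      then have "card (Y <#> conjg k Y) \<le> 6" using K'(2) finite_subgroup[OF K'(1)] card_mono by metis
      moreover have "card (Y <#> conjg k Y) = 3 * 3"
        using card_prod[OF subsD(1)[OF Y(1)] subsD(1)[OF Z] prime_subs_disjoint[OF Y(1) _ Z]] ne
          subsD(2)[OF Y(1)] subsD(2)[OF Z] by simp
      ultimately show False by simp
    qed
    then show "k \<in> normzr Y" using kc by (simp add: normzr_def)
  qed
  then have "6 dvd card (normzr Y)"
    using card_subgroup_dvd_subgroup[OF K'(1) normzr_subgroup[OF Yc]] K'(2) by simp
  then show False using N by simp
qed

lemma subgroup_cases:
  assumes "subgroup U G" shows "U \<in> subs G 1 \<or> U \<in> subs G 2 \<or> U \<in> subs G 3 \<or> U \<in> subs G 4 \<or> U \<in> subs G 12"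
proof -
  have "card U dvd 12" using card_subgroup_dvd[OF assms] order12 by simp
  then have "card U \<in> {d. d dvd 12}" by simp
  also have "{d. d dvd (12::nat)} = {1, 2, 3, 4, 6, 12}"
  proof -
    have "d \<in> {1, 2, 3, 4, 6, 12}" if "d dvd (12::nat)" for d
    proof -
      have "d \<le> 12" using that by (intro dvd_imp_le) auto
      then have "d = 0 \<or> d = 1 \<or> d = 2 \<or> d = 3 \<or> d = 4 \<or> d = 5 \<or> d = 6 \<or> d = 7 \<or> d = 8 \<or> d = 9 \<or> d = 10 \<or> d = 11 \<or> d = 12"
        by presburger
      then show ?thesis using that by (elim disjE) simp_all
    qed
    then show ?thesis by auto
  qed
  finally have "card U \<in> {1, 2, 3, 4, 6, 12}" .
  then show ?thesis using assms subs_6 by (auto simp: subs_def)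
qed

lemma card_subs_small: "card (subs G 1) = 1" "card (subs G 4) = 1" "card (subs G 12) = 1"
proof -
  show "card (subs G 1) = 1" unfolding subs_one by simp
  show "card (subs G 4) = 1" "card (subs G 12) = 1" using subs_4 subs_order order12 by auto
qed

lemma card_families:
  "card (subs G 1 \<union> subs G 3) = 5" "card (subs G 1 \<union> subs G 2 \<union> subs G 4) = 5"
  "card (subs G 1 \<union> subs G 2 \<union> subs G 3 \<union> subs G 4) = 9"
  "card (subs G 1 \<union> subs G 2 \<union> subs G 3 \<union> subs G 4 \<union> subs G 12) = 10"
proof -
  have [simp]: "subs G m \<inter> subs G n = {}" if "m \<noteq> n" for m n using that by (auto simp: subs_def)
  note Int_Un_distrib2[simp] card_subs_small[simp] card_subs_small[simplified, simp] card_subs_2[simp] card_subs_3[simp]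
  show "card (subs G 1 \<union> subs G 3) = 5" by (subst card_Un_disjoint) auto
  show 2: "card (subs G 1 \<union> subs G 2 \<union> subs G 4) = 5" by (subst card_Un_disjoint; simp)+
  show "card (subs G 1 \<union> subs G 2 \<union> subs G 3 \<union> subs G 4) = 9" by (subst card_Un_disjoint; simp)+
  show "card (subs G 1 \<union> subs G 2 \<union> subs G 3 \<union> subs G 4 \<union> subs G 12) = 10" by (subst card_Un_disjoint; simp)+
qed

lemma Sub_eq: "Sub G = 10"
proof -
  have "{U. subgroup U G} = subs G 1 \<union> subs G 2 \<union> subs G 3 \<union> subs G 4 \<union> subs G 12"
    using subgroup_cases by (auto simp: subs_def)
  then show ?thesis using card_families(4) by (simp add: Sub_def)
qed

lemma finite_families [simp]: "finite (coprime_primepow_subs p G)" "finite (coprime_subs p G)"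
  by (rule finite_subset[OF _ finite_subgroups], auto simp: coprime_primepow_subs_def coprime_subs_def)+

lemma subs_coprime_primepow_subs: "prime r \<Longrightarrow> coprime (r ^ k) p \<Longrightarrow> subs G (r ^ k) \<subseteq> coprime_primepow_subs p G"
  by (auto simp: subs_def coprime_primepow_subs_def)

lemma card_coprime_primepow_subs_ge:
  assumes p: "prime p" shows "5 \<le> card (coprime_primepow_subs p G)" "5 \<le> p \<Longrightarrow> 9 \<le> card (coprime_primepow_subs p G)"
proof -
  have 1: "subs G 1 \<subseteq> coprime_primepow_subs p G" using subs_coprime_primepow_subs[of 2 0] by simp
  have 2: "subs G 2 \<union> subs G 4 \<subseteq> coprime_primepow_subs p G" if "p \<noteq> 2"
  proof -
    have "coprime 2 p" using primes_coprime[of 2 p] p that by auto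
    then show ?thesis using subs_coprime_primepow_subs[of 2 1] subs_coprime_primepow_subs[of 2 2] by (auto simp: coprime_power_left_iff[of 2 2 p, simplified])
  qed
  have 3: "subs G 3 \<subseteq> coprime_primepow_subs p G" if "p \<noteq> 3"
  proof -
    have "coprime 3 p" using primes_coprime[of 3 p] p that by auto
    then show ?thesis using subs_coprime_primepow_subs[of 3 1] by auto
  qed
  show "5 \<le> card (coprime_primepow_subs p G)"
  proof (cases "p = 2")
    case True
    have "card (subs G 1 \<union> subs G 3) \<le> card (coprime_primepow_subs p G)" using 1 3 True by (intro card_mono) auto
    then show ?thesis using card_families(1) by simp
  next
    case False
    have "card (subs G 1 \<union> subs G 2 \<union> subs G 4) \<le> card (coprime_primepow_subs p G)" using 1 2 False by (intro card_mono) auto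
    then show ?thesis using card_families(2) by simp
  qed
  assume "5 \<le> p"
  then have "card (subs G 1 \<union> subs G 2 \<union> subs G 3 \<union> subs G 4) \<le> card (coprime_primepow_subs p G)" using 1 2 3 by (intro card_mono) auto
  then show "9 \<le> card (coprime_primepow_subs p G)" using card_families(3) by simp
qed

lemma card_coprime_subs_le: "card (coprime_subs p G) \<le> 10" "card (coprime_subs 2 G) \<le> 5" "card (coprime_subs 3 G) \<le> 5"
proof -
  have "card (coprime_subs p G) \<le> card {U. subgroup U G}"
    using finite_subgroups by (intro card_mono) (auto simp: coprime_subs_def)
  then show "card (coprime_subs p G) \<le> 10" using Sub_eq by (simp add: Sub_def)
  have "coprime_subs 2 G \<subseteq> subs G 1 \<union> subs G 3"
  proof
    fix U assume "U \<in> coprime_subs 2 G"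
    then show "U \<in> subs G 1 \<union> subs G 3" using subgroup_cases[of U] by (auto simp: coprime_subs_def subs_def)
  qed
  then have "card (coprime_subs 2 G) \<le> card (subs G 1 \<union> subs G 3)" by (intro card_mono) auto
  then show "card (coprime_subs 2 G) \<le> 5" using card_families(1) by simp
  have "\<not> coprime (12::nat) 3" using coprime_common_divisor_nat[of 12 3 3] by auto
  then have "coprime_subs 3 G \<subseteq> subs G 1 \<union> subs G 2 \<union> subs G 4"
  proof -
    assume not_above_K: "\<not> coprime (12::nat) 3"
    show ?thesis
    proof
      fix U assume "U \<in> coprime_subs 3 G"
      then show "U \<in> subs G 1 \<union> subs G 2 \<union> subs G 4"
        using subgroup_cases[of U] not_above_K by (auto simp: coprime_subs_def subs_def)
    qed
  qed
  then have "card (coprime_subs 3 G) \<le> card (subs G 1 \<union> subs G 2 \<union> subs G 4)" by (intro card_mono) auto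
  then show "card (coprime_subs 3 G) \<le> 5" using card_families(2) by simp
qed

lemma V_square: "x \<in> V \<Longrightarrow> x \<otimes> x = \<one>"
proof -
  assume x: "x \<in> V"
  have "{X \<in> subs G 2. X \<subseteq> V} = subs G 2" using subs_2_in_V by blast
  then have "3 \<le> card {x \<in> V. x \<noteq> \<one> \<and> x \<otimes> x = \<one>}"
    using card_subs_2_le_involutions[OF V_subgroup] card_subs_2 by simp
  then have "card (V - {\<one>}) \<le> card {x \<in> V. x \<noteq> \<one> \<and> x \<otimes> x = \<one>}"
    using card_V subgroup.one_closed[OF V_subgroup] finite_V by (simp add: card_Diff_singleton)
  then have "{x \<in> V. x \<noteq> \<one> \<and> x \<otimes> x = \<one>} = V - {\<one>}" using finite_V by (intro card_seteq) auto
  then show ?thesis using x by (cases "x = \<one>") auto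
qed

lemma element_in_subs:
  assumes "x \<in> carrier G" "x \<noteq> \<one>"
  shows "\<exists>r\<in>{2, 3}. generate G {x} \<in> subs G r"
proof (cases "x \<in> V")
  case True
  then have "x [^] (2::nat) = \<one>" using V_square assms(1) by (simp add: numeral_2_eq_2)
  then show ?thesis using prime_subs_generate[OF assms, of 2] by simp
next
  case False
  then obtain Y where Y: "Y \<in> subs G 3" "x \<in> Y" using assms by (auto simp: V_def)
  then have "x [^] (3::nat) = \<one>" using pow_card_subgroup[of Y x] subsD[OF Y(1)] by simp
  then show ?thesis using prime_subs_generate[OF assms, of 3] by simp
qed

end

section \<open>Kernels of prime order\<close>

text \<open>
  A subgroup of order 3 has only one non-trivial automorphism. When it is normal, its centralizer has
  index 1 or 2, and the absence of subgroups of index 2 makes it central.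
\<close>

definition no_index_2 :: "('a, 'b) monoid_scheme \<Rightarrow> bool"
  where "no_index_2 G \<longleftrightarrow> (\<forall>U. subgroup U G \<longrightarrow> 2 * card U \<noteq> order G)"

context finite_epi begin

lemma prime_subs_image:
  assumes p: "prime (card K)" and Y: "Y \<in> subs G (card K)" "Y \<noteq> K"
  shows "Y \<inter> K = {\<one>}" "h ` Y \<in> subs H (card K)"
proof -
  have "K \<in> subs G (card K)" using K_subgroup by (simp add: subs_def)
  then show i: "Y \<inter> K = {\<one>}" using G.prime_subs_disjoint[OF Y(1) p] Y(2) by blast
  show "h ` Y \<in> subs H (card K)"
    using image_subgroup[OF subsD(1)[OF Y(1)]] card_image_trivial[OF subsD(1)[OF Y(1)] i] subsD(2)[OF Y(1)]
    by (simp add: subs_def)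
qed

lemma conjg_K: "g \<in> carrier G \<Longrightarrow> G.conjg g K = K"
  using K_normal G.normal_iff_conjg by blast

text \<open>
  The preimage of \<open>B\<close> contains \<open>K\<close> and a conjugate of \<open>Y\<close>, so the number of its subgroups of order
  \<open>card K\<close>, being 1 modulo \<open>card K\<close>, is at least \<open>card K + 1\<close>. All of them except \<open>K\<close> map onto \<open>B\<close>.
\<close>

lemma card_fibre_ge:
  assumes p: "prime (card K)" and Y: "Y \<in> subs G (card K)" "Y \<noteq> K"
    and B: "B \<in> H.conj_class (h ` Y)"
  shows "card K \<le> card {Z \<in> subs G (card K). Z \<noteq> K \<and> h ` Z = B}"
proof -
  have Yc: "Y \<subseteq> carrier G" using G.subs_carrier Y(1) .
  have "B \<in> (\<lambda>V. h ` V) ` G.conj_class Y" using B h_class[OF Yc] by simp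
  then obtain g where g: "g \<in> carrier G" "B = h ` G.conjg g Y" by (auto simp: G.conj_class_def)
  let ?Z = "G.conjg g Y"
  have Z: "?Z \<in> subs G (card K)" using G.conjg_subs[OF g(1) Y(1)] .
  have ZK: "?Z \<noteq> K"
  proof
    assume "?Z = K"
    then have "G.conjg (inv g) ?Z = K" using conjg_K g(1) by simp
    then show False using G.conjg_inv_cancel(1)[OF g(1) Yc] Y(2) by simp
  qed
  have Bs: "B \<in> subs H (card K)" using prime_subs_image(2)[OF p Z ZK] g(2) by simp
  have P: "subgroup (preimage B) G" using preimage_subgroup subsD(1)[OF Bs] .
  have KP: "K \<subseteq> preimage B" using K_le_preimage subsD(1)[OF Bs] .
  have ZP: "?Z \<subseteq> preimage B" using g(2) G.subs_carrier[OF Z] by (auto simp: preimage_def)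
  let ?M = "{Z \<in> subs G (card K). Z \<subseteq> preimage B}"
  have "card K dvd card (preimage B)" using card_preimage[OF subsD(1)[OF Bs]] by simp
  then have m: "card ?M mod card K = 1" using G.subs_prime_mod_subgroup[OF P p] by blast
  have KM: "K \<in> ?M" using KP K_subgroup by (simp add: subs_def)
  have "{K, ?Z} \<subseteq> ?M" using KM Z ZP by blast
  then have "card {K, ?Z} \<le> card ?M" by (intro card_mono) auto
  then have "card K + 1 \<le> card ?M" using mod_eq_1_ge[OF _ m] ZK by auto
  moreover have "card (?M - {K}) = card ?M - 1" using KM by (simp add: card_Diff_singleton)
  moreover have "?M - {K} \<subseteq> {Z \<in> subs G (card K). Z \<noteq> K \<and> h ` Z = B}"
  proof
    fix W assume W: "W \<in> ?M - {K}"
    then have W': "h ` W \<in> subs H (card K)" using prime_subs_image(2)[OF p] by blast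
    have "h ` W \<subseteq> B" using W by (auto simp: preimage_def)
    then have "h ` W = B"
      using H.subgroup_card_eq[OF subsD(1)[OF W'] subsD(1)[OF Bs]] subsD(2)[OF W'] subsD(2)[OF Bs] by simp
    then show "W \<in> {Z \<in> subs G (card K). Z \<noteq> K \<and> h ` Z = B}" using W by blast
  qed
  then have "card (?M - {K}) \<le> card {Z \<in> subs G (card K). Z \<noteq> K \<and> h ` Z = B}" by (intro card_mono) auto
  ultimately show ?thesis by linarith
qed

lemma card_fibres_ge:
  assumes p: "prime (card K)" and Y: "Y \<in> subs G (card K)" "Y \<noteq> K"
  shows "card K * card (H.conj_class (h ` Y)) \<le> card (subs G (card K) - {K})"
proof -
  let ?F = "\<lambda>B. {Z \<in> subs G (card K). Z \<noteq> K \<and> h ` Z = B}"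
  have fin: "finite (H.conj_class (h ` Y))"
    using H.finite_conj_class image_subgroup[OF subsD(1)[OF Y(1)]] subgroup.subset by blast
  have "(\<Sum>B\<in>H.conj_class (h ` Y). card K) \<le> (\<Sum>B\<in>H.conj_class (h ` Y). card (?F B))"
    using card_fibre_ge[OF p Y] by (intro sum_mono)
  also have "\<dots> = card (\<Union>B\<in>H.conj_class (h ` Y). ?F B)"
    using fin by (intro card_UN_disjoint[symmetric]) auto
  also have "\<dots> \<le> card (subs G (card K) - {K})" by (intro card_mono) auto
  finally show ?thesis by (simp add: mult.commute)
qed

text \<open>
  By Cauchy's theorem a subgroup that does not contain \<open>K\<close> has order coprime to \<open>card K\<close>. Such
  subgroups are determined by their images: if \<open>x\<close> and \<open>y\<close> in two of them differ by \<open>k\<close> in the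
  central subgroup \<open>K\<close>, then a power that kills \<open>x\<close> and \<open>y\<close> and is coprime to \<open>card K\<close> kills \<open>k\<close>.
\<close>

lemma not_above_K_le_coprime_subs:
  assumes central: "carrier G \<subseteq> G.centralizer K" and p: "prime (card K)" and uniq: "subs G (card K) = {K}"
  shows "card not_above_K \<le> card (coprime_subs (card K) H)"
proof (rule card_inj_on_le)
  have nd: "\<not> card K dvd card U" if U: "U \<in> not_above_K" for U
  proof
    assume "card K dvd card U"
    then obtain P where "P \<in> subs G (card K)" "P \<subseteq> U"
      using G.cauchy_in_subgroup[OF _ p] U by (auto simp: not_above_K_def)
    then show False using uniq U by (auto simp: not_above_K_def)
  qed
  have co: "coprime (card U) (card K)" if U: "U \<in> not_above_K" for U
    using prime_imp_coprime[OF p nd[OF U]] by (simp add: coprime_commute)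
  have sub: "subgroup U G" if "U \<in> not_above_K" for U using that by (simp add: not_above_K_def)
  show "(\<lambda>U. h ` U) ` not_above_K \<subseteq> coprime_subs (card K) H"
  proof clarify
    fix U assume U: "U \<in> not_above_K"
    have "card (h ` U) = card U"
      using card_image_trivial[OF sub[OF U] G.coprime_Int[OF sub[OF U] K_subgroup co[OF U]]] .
    then show "h ` U \<in> coprime_subs (card K) H" using co[OF U] image_subgroup[OF sub[OF U]] by (simp add: coprime_subs_def)
  qed
  have le: "U \<subseteq> W" if UW: "U \<in> not_above_K" "W \<in> not_above_K" "h ` U = h ` W" for U W
  proof
    fix x assume x: "x \<in> U"
    then obtain y where y: "y \<in> W" "h x = h y" using UW(3) by blast
    have c: "x \<in> carrier G" "y \<in> carrier G"
      using x y subgroup.mem_carrier[OF sub[OF UW(1)]] subgroup.mem_carrier[OF sub[OF UW(2)]] by auto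
    define k where "k = inv y \<otimes> x"
    have kc: "k \<in> carrier G" and kK: "k \<in> K" using c y(2) by (auto simp: k_def kernel_def)
    have xk: "x = y \<otimes> k" using c by (simp add: k_def flip: G.m_assoc)
    have comm: "y \<otimes> k = k \<otimes> y" using central c kK by (auto simp: G.centralizer_def)
    define n where "n = card U * card W"
    have "x [^] n = \<one>" "y [^] n = \<one>"
      using G.pow_card_subgroup[OF sub[OF UW(1)] x] G.pow_card_subgroup[OF sub[OF UW(2)] y(1)] c
      by (simp_all add: n_def G.nat_pow_pow[symmetric] mult.commute[of "card U"] flip: G.nat_pow_pow)
        (metis G.nat_pow_one G.nat_pow_pow mult.commute)+
    then have "k [^] n = \<one>" using xk G.pow_mult_distrib[OF comm c(2) kc, of n] kc by simp
    moreover have "k [^] card K = \<one>" using G.pow_card_subgroup[OF K_subgroup kK] .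
    ultimately have "G.ord k dvd n" "G.ord k dvd card K" using G.pow_eq_id[OF kc] by auto
    moreover have "coprime n (card K)" using co[OF UW(1)] co[OF UW(2)] by (simp add: n_def)
    ultimately have "G.ord k = 1" by (metis coprime_common_divisor_nat)
    then have "k = \<one>" using G.ord_eq_1[OF kc] by simp
    then show "x \<in> W" using xk y(1) c by simp
  qed
  show "inj_on (\<lambda>U. h ` U) not_above_K" using le by (intro inj_onI) blast
qed simp

text \<open>
  A normal subgroup of order 2 is always central. In one of order 3 a generator has at most two
  conjugates; if there are two, its centralizer has index 2 and contains \<open>K\<close>, so
  that its image in \<open>H\<close> has index 2 as well.
\<close>

lemma K_central:
  assumes K: "card K = 2 \<or> card K = 3" and ni: "no_index_2 H"
  shows "carrier G \<subseteq> G.centralizer K"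
proof -
  have Ks: "K \<in> subs G (card K)" using K_subgroup by (simp add: subs_def)
  have Kc: "K \<subseteq> carrier G" using G.subs_carrier[OF Ks] .
  have KN: "carrier G \<subseteq> G.normzr K" using conjg_K by (auto simp: G.normzr_def)
  from K show ?thesis
  proof
    assume "card K = 2"
    then show ?thesis using G.normalizes_involution[of K] Ks KN by auto
  next
    assume c3: "card K = 3"
    have "card (K - {\<one>}) = 2"
      using c3 subgroup.one_closed[OF K_subgroup] G.finite_subgroup[OF K_subgroup] by (simp add: card_Diff_singleton)
    then obtain l where l: "l \<in> K" "l \<noteq> \<one>" by (metis Diff_iff card_2_iff insertI1 singletonI)
    have lc: "l \<in> carrier G" using l Kc by blast
    let ?S = "{g \<in> carrier G. g \<otimes> l \<otimes> inv g = l}"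
    let ?O = "(\<lambda>g. g \<otimes> l \<otimes> inv g) ` carrier G"
    have eq: "card ?O * card ?S = order G"
    proof (rule G.card_orbit_mult_card_stabilizer[where E = "carrier G" and f = "\<lambda>g x. g \<otimes> x \<otimes> inv g"])
      show "g \<otimes> k \<otimes> x \<otimes> inv (g \<otimes> k) = g \<otimes> (k \<otimes> x \<otimes> inv k) \<otimes> inv g"
        if "g \<in> carrier G" "k \<in> carrier G" "x \<in> carrier G" for g k x using that by (rule G.conj_mult)
    qed (use lc in auto)
    have S_eq: "?S = G.centralizer {l}" using lc G.conj_eq_iff_commute by (auto simp: G.centralizer_def)
    have Ssub: "subgroup ?S G" unfolding S_eq using G.centralizer_subgroup lc by simp
    have ScK: "?S \<subseteq> G.centralizer K"
    proof
      fix g assume g: "g \<in> ?S"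
      then have gc: "g \<in> carrier G" by simp
      have "l \<in> G.centralizer {g}" using g lc unfolding S_eq by (auto simp: G.centralizer_def)
      then have "K \<subseteq> G.centralizer {g}"
        using G.prime_subs_Int[OF Ks _ G.centralizer_subgroup l(1) _ l(2)] gc c3 by simp
      then show "g \<in> G.centralizer K" using gc by (auto simp: G.centralizer_def)
    qed
    have "?O \<subseteq> K - {\<one>}"
    proof clarify
      fix g assume g: "g \<in> carrier G"
      have "g \<otimes> l \<otimes> inv g \<in> K" using normal.inv_op_closed2[OF K_normal g l(1)] .
      moreover have "g \<otimes> l \<otimes> inv g \<noteq> \<one>"
        using g lc l(2) by (metis G.inv_solve_right' G.l_one G.l_cancel_one G.m_closed G.one_closed)
      ultimately show "g \<otimes> l \<otimes> inv g \<in> K - {\<one>}" by blast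
    qed
    then have "card ?O \<le> card (K - {\<one>})" using G.finite_subgroup[OF K_subgroup] by (intro card_mono) auto
    then have "card ?O \<le> 2" using \<open>card (K - {\<one>}) = 2\<close> by simp
    moreover have "card ?O \<noteq> 0" using eq G.order_pos by (metis mult_0 less_nat_zero_code)
    moreover have "card ?O \<noteq> 2"
    proof
      assume "card ?O = 2"
      then have e2: "2 * card ?S = order G" using eq by simp
      have "K \<subseteq> ?S" using G.prime_subs_abelian[OF Ks] c3 l(1) Kc unfolding S_eq by (auto simp: G.centralizer_def)
      then have "card ?S = card (h ` ?S) * 3" using card_image_mult[OF Ssub] c3 by (simp add: inf.absorb2)
      then have "2 * card (h ` ?S) = order H" using e2 order_mult c3 by simp
      then show False using ni image_subgroup[OF Ssub] by (auto simp: no_index_2_def)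
    qed
    ultimately have "card ?O = 1" by linarith
    then have "card ?S = order G" using eq by simp
    then have "?S = carrier G" using G.fin by (intro card_subset_eq) (auto simp: order_def)
    then show ?thesis using ScK by simp
  qed
qed

text \<open>
  A subgroup \<open>U\<close> of index 2 that contains \<open>K\<close> has an image of index 2. Otherwise \<open>U\<close> meets \<open>K\<close>
  trivially and embeds into \<open>H\<close>, which forces \<open>card K = 2\<close> and makes the order of \<open>U\<close> that of \<open>H\<close>, an
  even number. So \<open>U\<close> contains a subgroup of order 2, but \<open>K\<close> is the only one.
\<close>

lemma no_index_2_lift:
  assumes ni: "no_index_2 H" and p: "prime (card K)"
    and two: "card K = 2 \<Longrightarrow> even (order H) \<and> subs G 2 = {K}"
  shows "no_index_2 G"
  unfolding no_index_2_def
proof (intro allI impI notI)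
  fix U assume U: "subgroup U G" and e: "2 * card U = order G"
  have hU: "subgroup (h ` U) H" using image_subgroup U .
  show False
  proof (cases "K \<subseteq> U")
    case True
    then have "card U = card (h ` U) * card K" using card_image_mult[OF U] by (simp add: inf.absorb2)
    then have "(2 * card (h ` U)) * card K = order H * card K" using e order_mult by (metis mult.assoc)
    then have "2 * card (h ` U) = order H" using prime_gt_0_nat[OF p] by simp
    then show False using ni hU by (auto simp: no_index_2_def)
  next
    case False
    have "x = \<one>" if "x \<in> U" "x \<in> K" for x
    proof (rule ccontr)
      assume "x \<noteq> \<one>"
      then have "K \<subseteq> U" using G.prime_subs_Int[of K "card K" U x] that U K_subgroup p by (simp add: subs_def)
      then show False using False by simp
    qed
    then have "U \<inter> K = {\<one>}" using subgroup.one_closed[OF U] subgroup.one_closed[OF K_subgroup] by blast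
    then have cU: "card (h ` U) = card U" by (rule card_image_trivial[OF U])
    then have "card U \<le> order H" using H.card_subgroup_dvd[OF hU] H.order_pos by (metis dvd_imp_le)
    then have "order H * card K \<le> order H * 2" using e order_mult by linarith
    then have "card K \<le> 2" using H.order_pos by (metis mult_le_cancel1)
    then have K2: "card K = 2" using prime_ge_2_nat[OF p] by simp
    then have "card U = order H" using e order_mult by simp
    then have "2 dvd card U" using two[OF K2] by simp
    then obtain P where "P \<in> subs G 2" "P \<subseteq> U" using G.cauchy_in_subgroup[OF U, of 2] by auto
    then show False using two[OF K2] False by simp
  qed
qed

lemma card_subs_prime_le:
  assumes r: "prime r" "\<not> r dvd card K" shows "card (subs H r) \<le> card (subs G r)"
proof (rule surj_card_le)
  show "subs H r \<subseteq> (\<lambda>R. h ` R) ` subs G r"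
  proof
    fix B assume B: "B \<in> subs H r"
    obtain R where "subgroup R G" "card R = r ^ 1" "h ` R = B"
      by (rule lift_coprime[of B r 1]) (use subsD[OF B] r in auto)
    then show "B \<in> (\<lambda>R. h ` R) ` subs G r" by (auto simp: subs_def)
  qed
qed simp

lemma coprime_primepow_subs_disjoint_subs:
  assumes "prime r" "r dvd n" "r dvd p" shows "coprime_primepow_subs p G \<inter> subs G n = {}"
proof -
  have "\<not> coprime n p" using assms by (metis coprime_common_divisor_nat not_prime_1)
  then show ?thesis by (auto simp: coprime_primepow_subs_def subs_def)
qed

end

lemma (in a4_group) no_index_2: "no_index_2 G"
  using subs_6 order12 by (auto simp: no_index_2_def subs_def)

section \<open>Extensions of the alternating group by a group of prime order\<close>

locale a4_extension = finite_epi G H h + H: a4_group H for G (structure) and H (structure) and h +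
  assumes prime_K: "prime (card K)"

context a4_extension begin

lemma order_G: "order G = 12 * card K" using order_mult H.order12 by simp

lemma Sub_G: "Sub G = 10 + card not_above_K" using Sub_split H.Sub_eq by simp

lemma coprime_primepow_subs_ge: "5 \<le> card (coprime_primepow_subs p G)" if "prime p" for p
  using H.card_coprime_primepow_subs_ge(1)[OF that] card_coprime_primepow_subs_le[of p] by linarith

lemma unique_small:
  assumes K: "card K = 2 \<or> card K = 3" and uniq: "subs G (card K) = {K}"
  shows "carrier G \<subseteq> G.centralizer K" "card not_above_K \<le> 5" "no_index_2 G"
proof -
  show c: "carrier G \<subseteq> G.centralizer K" using K_central[OF K H.no_index_2] .
  have "card not_above_K \<le> card (coprime_subs (card K) H)" using not_above_K_le_coprime_subs[OF c prime_K uniq] .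
  then show "card not_above_K \<le> 5" using K H.card_coprime_subs_le by auto
  show "no_index_2 G"
    by (rule no_index_2_lift[OF H.no_index_2 prime_K]) (use uniq H.order12 in auto)
qed

lemma class_image_subs:
  assumes Y: "Y \<in> subs H r" "r = 2 \<or> r = 3" shows "card (H.conj_class Y) = (if r = 2 then 3 else 4)"
  using Y H.class_subs_2 H.class_subs_3 H.card_subs_2 H.card_subs_3 by auto

text \<open>
  The preimage of each of the three subgroups of order 2 of \<open>H\<close> contains \<open>K\<close> and at least two other
  subgroups of order 2, so that all its elements, and hence those of the preimage of the Klein
  four-group, have square \<open>\<one>\<close>. Choose such other subgroups \<open>X1\<close> and \<open>X2\<close> above two different subgroups
  of order 2. The product \<open>X1 <#> X2\<close> has order 4, does not contain \<open>K\<close> and determines the choice.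
\<close>

lemma four_complements:
  assumes K2: "card K = 2" and Y: "Y \<in> subs G 2" "Y \<noteq> K"
  shows "4 \<le> card {F \<in> subs G 4. \<not> K \<subseteq> F}"
proof -
  let ?P = "\<lambda>B. {Z \<in> subs G 2. Z \<noteq> K \<and> h ` Z = B}"
  have hY: "h ` Y \<in> subs H 2" using prime_subs_image(2)[OF prime_K] Y K2 by simp
  have P2: "2 \<le> card (?P B)" if "B \<in> subs H 2" for B
    using card_fibre_ge[OF prime_K, of Y B] Y K2 that H.class_subs_2[OF hY] by simp
  have Ks: "K \<in> subs G 2" using K_subgroup K2 by (simp add: subs_def)
  have sq: "w \<otimes> w = \<one>" if w: "w \<in> preimage H.V" for w
  proof (cases "w \<in> K")
    case True
    then show ?thesis using G.pow_card_subgroup[OF K_subgroup True] K2 w by (simp add: numeral_2_eq_2 preimage_def)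
  next
    case False
    have wc: "w \<in> carrier G" and hw: "h w \<in> H.V" "h w \<in> carrier H" "h w \<noteq> \<one>\<^bsub>H\<^esub>"
      using w False by (auto simp: preimage_def kernel_def)
    define B where "B = generate H {h w}"
    have "h w [^]\<^bsub>H\<^esub> (2::nat) = \<one>\<^bsub>H\<^esub>" using H.V_square[OF hw(1)] hw(2) by (simp add: numeral_2_eq_2)
    then have B: "B \<in> subs H 2" using H.prime_subs_generate[OF hw(2,3)] by (simp add: B_def)
    have PB: "subgroup (preimage B) G" using preimage_subgroup subsD(1)[OF B] .
    have cPB: "card (preimage B) = 4" using card_preimage[OF subsD(1)[OF B]] subsD(2)[OF B] K2 by simp
    have "insert K (?P B) \<subseteq> {X \<in> subs G 2. X \<subseteq> preimage B}"
      using Ks K_le_preimage[OF subsD(1)[OF B]] G.subs_carrier by (auto simp: preimage_def)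
    then have "card (insert K (?P B)) \<le> card {X \<in> subs G 2. X \<subseteq> preimage B}" by (intro card_mono) auto
    then have "3 \<le> card {X \<in> subs G 2. X \<subseteq> preimage B}" using P2[OF B] by simp
    then have "card (preimage B - {\<one>}) \<le> card {x \<in> preimage B. x \<noteq> \<one> \<and> x \<otimes> x = \<one>}"
      using G.card_subs_2_le_involutions[OF PB] cPB subgroup.one_closed[OF PB] G.finite_subgroup[OF PB]
      by (simp add: card_Diff_singleton)
    then have "{x \<in> preimage B. x \<noteq> \<one> \<and> x \<otimes> x = \<one>} = preimage B - {\<one>}"
      using G.finite_subgroup[OF PB] by (intro card_seteq) auto
    moreover have "w \<in> preimage B" "w \<noteq> \<one>" using wc hw(3) H.mem_generate by (auto simp: preimage_def B_def)
    ultimately show ?thesis by blast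
  qed
  obtain B1 B2 where B: "B1 \<in> subs H 2" "B2 \<in> subs H 2" "B1 \<noteq> B2"
  proof -
    have "2 \<le> card (subs H 2)" using H.card_subs_2 by simp
    then show thesis using that ex_two_elements by metis
  qed
  have BV: "B1 \<subseteq> H.V" "B2 \<subseteq> H.V" using H.subs_2_in_V B by auto
  have Bi: "B1 \<inter> B2 = {\<one>\<^bsub>H\<^esub>}" using H.prime_subs_disjoint[OF B(1) _ B(2,3)] by simp
  have key: "X1 <#> X2 \<in> subs G 4 \<and> \<not> K \<subseteq> X1 <#> X2 \<and> X1 = {z \<in> X1 <#> X2. h z \<in> B1} \<and> X2 = {z \<in> X1 <#> X2. h z \<in> B2}"
    if X1: "X1 \<in> ?P B1" and X2: "X2 \<in> ?P B2" for X1 X2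
  proof -
    have s1: "subgroup X1 G" "card X1 = 2" "X1 \<subseteq> carrier G" and s2: "subgroup X2 G" "card X2 = 2" "X2 \<subseteq> carrier G"
      using X1 X2 subgroup.subset by (auto simp: subs_def)
    have i1: "X1 \<inter> K = {\<one>}" and i2: "X2 \<inter> K = {\<one>}"
      using prime_subs_image(1)[OF prime_K] X1 X2 K2 by auto
    have triv: "a = \<one> \<and> b = \<one>" if a: "a \<in> X1" and b: "b \<in> X2" and hab: "h a \<in> B2 \<and> h b \<in> B1" for a b
    proof -
      have "h a \<in> B1" "h b \<in> B2" using a b X1 X2 by auto
      then have "h a = \<one>\<^bsub>H\<^esub>" "h b = \<one>\<^bsub>H\<^esub>" using Bi hab by auto
      then have "a \<in> K" "b \<in> K" using a b s1 s2 by (auto simp: kernel_def)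
      then show ?thesis using i1 i2 a b by blast
    qed
    have comm: "a \<otimes> b = b \<otimes> a" if a: "a \<in> X1" and b: "b \<in> X2" for a b
    proof -
      have c: "a \<in> carrier G" "b \<in> carrier G" using a b s1 s2 by auto
      have V: "h a \<in> H.V" "h b \<in> H.V" using a b X1 X2 BV by auto
      then have "h (a \<otimes> b) \<in> H.V" using c subgroup.m_closed[OF H.V_subgroup] by simp
      then have "(a \<otimes> b) \<otimes> (a \<otimes> b) = \<one>" "a \<otimes> a = \<one>" "b \<otimes> b = \<one>"
        using sq c V by (simp_all add: preimage_def)
      then have "inv (a \<otimes> b) = a \<otimes> b" "inv a = a" "inv b = b" using c by (simp_all add: G.inv_equality)
      then show ?thesis using G.inv_mult_group[OF c] by simp
    qed
    have norm: "X1 \<subseteq> G.normzr X2"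
    proof -
      have "X1 \<subseteq> G.centralizer X2" using comm s1 by (auto simp: G.centralizer_def)
      then show ?thesis using G.centralizer_subset_normzr[OF s2(3)] by blast
    qed
    have "X1 \<noteq> X2" using X1 X2 B(3) by auto
    then have "X1 \<inter> X2 = {\<one>}" using G.prime_subs_disjoint[of X1 2 X2] X1 X2 by simp
    then have F4: "X1 <#> X2 \<in> subs G 4"
      using G.prod_subgroup[OF s1(1) s2(1) norm] G.card_prod[OF s1(1) s2(1)] s1 s2 by (simp add: subs_def)
    have hprod: "\<exists>a b. a \<in> X1 \<and> b \<in> X2 \<and> z = a \<otimes> b \<and> h a \<in> B1 \<and> h b \<in> B2 \<and> h z = h a \<otimes>\<^bsub>H\<^esub> h b"
      if zF: "z \<in> X1 <#> X2" for z
    proof -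
      obtain a b where ab: "a \<in> X1" "b \<in> X2" "z = a \<otimes> b" using zF by (auto simp: set_mult_def)
      then have "a \<in> carrier G" "b \<in> carrier G" using s1(3) s2(3) by auto
      moreover have "h a \<in> B1" "h b \<in> B2" using ab X1 X2 by auto
      ultimately show ?thesis using ab by (intro exI[of _ a] exI[of _ b]) simp
    qed
    have Bs: "subgroup B1 H" "subgroup B2 H" using B subsD by auto
    have cancel: "v \<in> C" if "subgroup C H" "u \<in> C" "u \<otimes>\<^bsub>H\<^esub> v \<in> C" "v \<in> carrier H" for C u v
    proof -
      have "inv\<^bsub>H\<^esub> u \<otimes>\<^bsub>H\<^esub> (u \<otimes>\<^bsub>H\<^esub> v) \<in> C" using that by (meson subgroup.m_closed subgroup.m_inv_closed)
      then show ?thesis using that subgroup.mem_carrier[OF that(1,2)] by (simp flip: H.m_assoc)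
    qed
    have cancel': "u \<in> C" if "subgroup C H" "v \<in> C" "u \<otimes>\<^bsub>H\<^esub> v \<in> C" "u \<in> carrier H" for C u v
    proof -
      have "(u \<otimes>\<^bsub>H\<^esub> v) \<otimes>\<^bsub>H\<^esub> inv\<^bsub>H\<^esub> v \<in> C" using that by (meson subgroup.m_closed subgroup.m_inv_closed)
      then show ?thesis using that subgroup.mem_carrier[OF that(1,2)] by (simp add: H.m_assoc)
    qed
    have one_prod: "\<one> \<in> X1" "\<one> \<in> X2" using s1 s2 subgroup.one_closed by auto
    have b_triv: "b = \<one>" if "b \<in> X2" "h b \<in> B1" for b
      using triv[OF one_prod(1) that(1)] that(2) subgroup.one_closed[OF Bs(2)] by simp
    have a_triv: "a = \<one>" if "a \<in> X1" "h a \<in> B2" for a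
      using triv[OF that(1) one_prod(2)] that(2) subgroup.one_closed[OF Bs(1)] by simp
    have r1: "{z \<in> X1 <#> X2. h z \<in> B1} = X1"
    proof
      show "X1 \<subseteq> {z \<in> X1 <#> X2. h z \<in> B1}" using G.subset_prod(1)[OF s1(1) s2(1)] X1 by auto
      show "{z \<in> X1 <#> X2. h z \<in> B1} \<subseteq> X1"
      proof clarify
        fix z assume z: "z \<in> X1 <#> X2" "h z \<in> B1"
        obtain a b where ab: "a \<in> X1" "b \<in> X2" "z = a \<otimes> b" "h a \<in> B1" "h b \<in> B2" "h z = h a \<otimes>\<^bsub>H\<^esub> h b"
          using hprod[OF z(1)] by blast
        have "h b \<in> B1" using cancel[OF Bs(1) ab(4)] z(2) ab(5,6) H.subs_carrier[OF B(2)] by auto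
        then have "b = \<one>" using b_triv ab(2) by blast
        then show "z \<in> X1" using ab s1 by auto
      qed
    qed
    have r2: "{z \<in> X1 <#> X2. h z \<in> B2} = X2"
    proof
      show "X2 \<subseteq> {z \<in> X1 <#> X2. h z \<in> B2}" using G.subset_prod(2)[OF s1(1) s2(1)] X2 by auto
      show "{z \<in> X1 <#> X2. h z \<in> B2} \<subseteq> X2"
      proof clarify
        fix z assume z: "z \<in> X1 <#> X2" "h z \<in> B2"
        obtain a b where ab: "a \<in> X1" "b \<in> X2" "z = a \<otimes> b" "h a \<in> B1" "h b \<in> B2" "h z = h a \<otimes>\<^bsub>H\<^esub> h b"
          using hprod[OF z(1)] by blast
        have "h a \<in> B2" using cancel'[OF Bs(2) ab(5)] z(2) ab(4,6) H.subs_carrier[OF B(1)] by auto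
        then have "a = \<one>" using a_triv ab(1) by blast
        then show "z \<in> X2" using ab s2 by auto
      qed
    qed
    have "\<not> K \<subseteq> X1 <#> X2"
    proof
      assume KF: "K \<subseteq> X1 <#> X2"
      have "K \<subseteq> {z \<in> X1 <#> X2. h z \<in> B1}" using KF subgroup.one_closed[OF Bs(1)] by (auto simp: kernel_def)
      then have "K \<subseteq> X1" using r1 by simp
      then have "K = {\<one>}" using i1 by blast
      then show False using K2 by simp
    qed
    then show ?thesis using F4 r1 r2 by simp
  qed
  have "card (?P B1 \<times> ?P B2) \<le> card {F \<in> subs G 4. \<not> K \<subseteq> F}"
  proof (rule card_inj_on_le[where f = "\<lambda>(X1, X2). X1 <#> X2"])
    show "inj_on (\<lambda>(X1, X2). X1 <#> X2) (?P B1 \<times> ?P B2)"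
    proof (rule inj_onI, clarify)
      fix X1 X2 Z1 Z2
      assume 1: "X1 \<in> subs G 2" "X1 \<noteq> K" "B1 = h ` X1" "X2 \<in> subs G 2" "X2 \<noteq> K" "B2 = h ` X2"
        "Z1 \<in> subs G 2" "Z1 \<noteq> K" "h ` Z1 = h ` X1" "Z2 \<in> subs G 2" "Z2 \<noteq> K" "h ` Z2 = h ` X2"
        and e: "X1 <#> X2 = Z1 <#> Z2"
      show "X1 = Z1 \<and> X2 = Z2"
        using key[of X1 X2] key[of Z1 Z2] 1 e by simp
    qed
    show "(\<lambda>(X1, X2). X1 <#> X2) ` (?P B1 \<times> ?P B2) \<subseteq> {F \<in> subs G 4. \<not> K \<subseteq> F}" using key by auto
  qed simp
  moreover have "2 * 2 \<le> card (?P B1) * card (?P B2)" using P2 B by (intro mult_le_mono) auto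
  ultimately show ?thesis by (simp add: card_cartesian_product)
qed

text \<open>
  Besides the 10 subgroups that contain \<open>K\<close> and at least 5 of order coprime to \<open>card K\<close>, there are
  at least 12 further subgroups of order 3 if \<open>card K = 3\<close>, and 6 of order 2 and 4 of order 4 if \<open>card K = 2\<close>.
\<close>

lemma not_unique_small:
  assumes K: "card K = 2 \<or> card K = 3" and Y: "Y \<in> subs G (card K)" "Y \<noteq> K"
  shows "25 \<le> Sub G"
proof -
  have f: "card K * card (H.conj_class (h ` Y)) \<le> card (subs G (card K) - {K})"
    using card_fibres_ge[OF prime_K Y] .
  have cl: "card (H.conj_class (h ` Y)) = (if card K = 2 then 3 else 4)"
    using class_image_subs[OF prime_subs_image(2)[OF prime_K Y] K] .
  have dis: "coprime_primepow_subs (card K) G \<inter> (subs G (card K) - {K}) = {}"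
    using coprime_primepow_subs_disjoint_subs[OF prime_K dvd_refl dvd_refl] by blast
  have U: "coprime_primepow_subs (card K) G \<union> (subs G (card K) - {K}) \<subseteq> not_above_K" using other_prime_subs_in_not_above_K coprime_primepow_subs_subset_not_above_K[OF prime_K] by blast
  have cU: "card (coprime_primepow_subs (card K) G \<union> (subs G (card K) - {K})) = card (coprime_primepow_subs (card K) G) + card (subs G (card K) - {K})"
    using dis by (intro card_Un_disjoint) auto
  have pp5: "5 \<le> card (coprime_primepow_subs (card K) G)" using coprime_primepow_subs_ge prime_K by blast
  show ?thesis
  proof (cases "card K = 2")
    case False
    then have "12 \<le> card (subs G (card K) - {K})" using f cl K by simp
    moreover have "card (coprime_primepow_subs (card K) G \<union> (subs G (card K) - {K})) \<le> card not_above_K" using U by (intro card_mono) auto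
    ultimately show ?thesis using cU pp5 Sub_G by linarith
  next
    case True
    have "6 \<le> card (subs G (card K) - {K})" using f cl True by simp
    let ?F = "{F \<in> subs G 4. \<not> K \<subseteq> F}"
    have four: "4 \<le> card ?F" using four_complements Y True by simp
    have "coprime_primepow_subs (card K) G \<inter> subs G 4 = {}"
      by (rule coprime_primepow_subs_disjoint_subs[of 2]) (simp_all add: True)
    moreover have "subs G (card K) \<inter> subs G 4 = {}" unfolding True by (auto simp: subs_def)
    ultimately have "(coprime_primepow_subs (card K) G \<union> (subs G (card K) - {K})) \<inter> ?F = {}" by blast
    then have "card (coprime_primepow_subs (card K) G \<union> (subs G (card K) - {K}) \<union> ?F)
        = card (coprime_primepow_subs (card K) G \<union> (subs G (card K) - {K})) + card ?F"
      by (intro card_Un_disjoint) auto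
    moreover have "?F \<subseteq> not_above_K" by (auto simp: not_above_K_def subs_def)
    then have "card (coprime_primepow_subs (card K) G \<union> (subs G (card K) - {K}) \<union> ?F) \<le> card not_above_K"
      using U by (intro card_mono) auto
    ultimately show ?thesis using \<open>6 \<le> card (subs G (card K) - {K})\<close> four pp5 cU Sub_G by linarith
  qed
qed

text \<open>
  \<open>K\<close> is the only subgroup of its order, as the square of a prime above 3 would otherwise divide
  \<open>12 * card K\<close>. If \<open>K\<close> is central, at most 10 subgroups do not contain it. If not, some \<open>R\<close> of order 2 or
  3 does not centralize it, as \<open>G\<close> is generated by \<open>K\<close> and such subgroups. The normalizer of \<open>R\<close> meets
  \<open>K\<close> trivially, since it would otherwise contain \<open>K\<close>, and commutators of \<open>K\<close> and \<open>R\<close> lie in \<open>K \<inter> R\<close>.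
  So it embeds into the normalizer of the image of \<open>R\<close>, which has at most 4 elements, and \<open>R\<close> has at
  least \<open>3 * card K\<close> conjugates.
\<close>

lemma large_kernel:
  assumes K5: "5 \<le> card K" shows "Sub G \<le> 20 \<or> 25 \<le> Sub G"
proof -
  have nd12: "\<not> card K dvd 12"
  proof
    assume "card K dvd 12"
    then have "card K dvd 2 * 2 * 3" by simp
    then have "card K dvd 2 \<or> card K dvd 3" using prime_K by (metis prime_dvd_mult_iff)
    then show False using K5 by (auto dest!: dvd_imp_le)
  qed
  have Ks: "K \<in> subs G (card K)" using K_subgroup by (simp add: subs_def)
  have Kc: "K \<subseteq> carrier G" using G.subs_carrier[OF Ks] .
  have uniq: "subs G (card K) = {K}"
  proof (rule ccontr)
    assume "subs G (card K) \<noteq> {K}"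
    then obtain Y where Y: "Y \<in> subs G (card K)" "Y \<noteq> K" using Ks by blast
    have "Y \<subseteq> G.normzr K" using G.subs_carrier[OF Y(1)] conjg_K by (auto simp: G.normzr_def)
    then have "card K * card K dvd 12 * card K"
      using G.normalizes_distinct_dvd[OF Y(1) Ks prime_K Y(2)] order_G by simp
    then show False using nd12 K5 by simp
  qed
  show ?thesis
  proof (cases "carrier G \<subseteq> G.centralizer K")
    case True
    then have "card not_above_K \<le> card (coprime_subs (card K) H)" using not_above_K_le_coprime_subs[OF _ prime_K uniq] by blast
    then show ?thesis using H.card_coprime_subs_le(1)[of "card K"] Sub_G by linarith
  next
    case False
    have cK: "subgroup (G.centralizer K) G" using G.centralizer_subgroup[OF Kc] .
    have "\<exists>r\<in>{2, 3}. \<exists>R \<in> subs G r. \<not> R \<subseteq> G.centralizer K"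
    proof (rule ccontr)
      assume "\<not> ?thesis"
      then have all: "R \<subseteq> G.centralizer K" if "R \<in> subs G r" "r = 2 \<or> r = 3" for r R using that by blast
      have "g \<in> G.centralizer K" if g: "g \<in> carrier G" for g
      proof (cases "h g = \<one>\<^bsub>H\<^esub>")
        case True
        then have "g \<in> K" using g by (simp add: kernel_def)
        then show ?thesis using G.prime_subs_abelian[OF Ks prime_K] by blast
      next
        case False
        obtain r where r: "r = 2 \<or> r = 3" "generate H {h g} \<in> subs H r"
          using H.element_in_subs[of "h g"] g False by auto
        have "prime r" using r(1) by auto
        then have pr: "prime r" "\<not> r dvd card K"
          using primes_dvd_imp_eq[OF _ prime_K, of r] r(1) K5 by auto
        obtain R where R: "subgroup R G" "card R = r ^ 1" "h ` R = generate H {h g}"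
          by (rule lift_coprime[of "generate H {h g}" r 1]) (use subsD[OF r(2)] pr in auto)
        then have "R \<in> subs G r" by (simp add: subs_def)
        then have Rc: "R \<subseteq> G.centralizer K" using all r(1) by blast
        obtain x where x: "x \<in> R" "h x = h g" using R(3) H.mem_generate[of "h g"] by (metis imageE)
        have xc: "x \<in> carrier G" using x R(1) subgroup.mem_carrier by metis
        have "inv x \<otimes> g \<in> K" using x xc g by (simp add: kernel_def)
        then have "inv x \<otimes> g \<in> G.centralizer K" using G.prime_subs_abelian[OF Ks prime_K] by blast
        then have "x \<otimes> (inv x \<otimes> g) \<in> G.centralizer K" using Rc x(1) subgroup.m_closed[OF cK] by blast
        then show ?thesis using xc g by (simp flip: G.m_assoc)
      qed
      then show False using False by blast
    qed
    then obtain r R where r: "r = 2 \<or> r = 3" and R: "R \<in> subs G r" "\<not> R \<subseteq> G.centralizer K" by blast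
    have pr: "prime r" "\<not> card K dvd r" "coprime r (card K)"
    proof -
      show "prime r" using r by auto
      show "\<not> card K dvd r" using r K5 by (auto dest!: dvd_imp_le)
      then show "coprime r (card K)" using prime_imp_coprime[OF prime_K] by (simp add: coprime_commute)
    qed
    have R': "subgroup R G" "card R = r" "R \<subseteq> carrier G" using subsD[OF R(1)] G.subs_carrier[OF R(1)] by auto
    have RK: "R \<inter> K = {\<one>}" using G.coprime_Int[OF R'(1) K_subgroup] R'(2) pr(3) by simp
    have hR: "h ` R \<in> subs H r"
      using image_subgroup[OF R'(1)] card_image_trivial[OF R'(1) RK] R'(2) by (simp add: subs_def)
    define N where "N = G.normzr R"
    have N: "subgroup N G" "N \<subseteq> carrier G" using G.normzr_subgroup[OF R'(3)] subgroup.subset by (auto simp: N_def)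
    have NK: "N \<inter> K = {\<one>}"
    proof (rule ccontr)
      assume "N \<inter> K \<noteq> {\<one>}"
      moreover have "\<one> \<in> N \<inter> K" using subgroup.one_closed[OF N(1)] subgroup.one_closed[OF K_subgroup] by simp
      ultimately obtain k where k: "k \<in> N" "k \<in> K" "k \<noteq> \<one>" by blast
      have KN: "K \<subseteq> N" using G.prime_subs_Int[OF Ks prime_K N(1) k(2,1,3)] .
      have "x \<otimes> y = y \<otimes> x" if x: "x \<in> R" and y: "y \<in> K" for x y
      proof -
        have c: "x \<in> carrier G" "y \<in> carrier G" using x y R' Kc by auto
        have "inv y \<in> K" using y K_subgroup by (simp add: subgroup.m_inv_closed)
        have "x \<otimes> inv y \<otimes> inv x \<in> K" using normal.inv_op_closed2[OF K_normal c(1) \<open>inv y \<in> K\<close>] .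
        then have 1: "y \<otimes> (x \<otimes> inv y \<otimes> inv x) \<in> K" using y K_subgroup by (simp add: subgroup.m_closed)
        have "y \<in> N" using KN y by blast
        then have "y \<otimes> x \<otimes> inv y \<in> R" using x by (auto simp: N_def G.normzr_def G.conjg_def)
        then have 2: "(y \<otimes> x \<otimes> inv y) \<otimes> inv x \<in> R" using x R'(1) by (simp add: subgroup.m_closed subgroup.m_inv_closed)
        have "y \<otimes> (x \<otimes> inv y \<otimes> inv x) = (y \<otimes> x \<otimes> inv y) \<otimes> inv x" using c by (simp add: G.m_assoc)
        then have "(y \<otimes> x \<otimes> inv y) \<otimes> inv x \<in> R \<inter> K" using 1 2 by simp
        then have "(y \<otimes> x \<otimes> inv y) \<otimes> inv x = \<one>" using RK by blast
        then have "y \<otimes> x \<otimes> inv y = x" using c by (metis G.inv_closed G.inv_equality G.inv_inv G.m_closed)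
        then show ?thesis using G.conj_eq_iff_commute[OF c(2,1)] by simp
      qed
      then have "R \<subseteq> G.centralizer K" using R'(3) by (auto simp: G.centralizer_def)
      then show False using R(2) by blast
    qed
    have hN: "h ` N \<subseteq> H.normzr (h ` R)"
    proof clarify
      fix g assume g: "g \<in> N"
      then have "g \<in> carrier G" "G.conjg g R = R" by (auto simp: N_def G.normzr_def)
      then show "h g \<in> H.normzr (h ` R)" using h_conjg[of g R] R'(3) by (simp add: H.normzr_def)
    qed
    have hRc: "h ` R \<subseteq> carrier H" using H.subs_carrier[OF hR] .
    have cN: "card N \<le> card (H.normzr (h ` R))"
      using card_image_trivial[OF N(1) NK] card_mono[OF H.finite_subgroup[OF H.normzr_subgroup[OF hRc]] hN] by simp
    have n3: "3 \<le> card (H.conj_class (h ` R))" using class_image_subs[OF hR r] by auto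
    have "3 * card N \<le> card (H.conj_class (h ` R)) * card (H.normzr (h ` R))"
      using n3 cN by (rule mult_le_mono)
    then have N12: "3 * card N \<le> 12" using H.card_class_mult_card_normzr[OF hRc] H.order12 by simp
    have "card (G.conj_class R) * card N = 12 * card K"
      using G.card_class_mult_card_normzr[OF R'(3)] order_G by (simp add: N_def)
    moreover have "card (G.conj_class R) * card N \<le> card (G.conj_class R) * 4" using N12 by simp
    ultimately have "15 \<le> card (G.conj_class R)" using K5 by linarith
    moreover have "G.conj_class R \<subseteq> not_above_K"
    proof
      fix W assume "W \<in> G.conj_class R"
      then have "W \<in> subs G r" using G.conj_class_subset_subs[OF R(1)] by blast
      then show "W \<in> not_above_K" using not_above_K_if_not_dvd pr(2) by (simp add: subs_def)
    qed
    then have "card (G.conj_class R) \<le> card not_above_K" by (intro card_mono) auto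
    ultimately show ?thesis using Sub_G by linarith
  qed
qed

end

theorem (in a4_extension) not_21_to_24: "Sub G \<le> 20 \<or> 25 \<le> Sub G"
proof (cases "5 \<le> card K")
  case True
  then show ?thesis using large_kernel by blast
next
  case False
  then have K: "card K = 2 \<or> card K = 3" using prime_less_5[OF prime_K] by linarith
  show ?thesis
  proof (cases "subs G (card K) = {K}")
    case True
    then show ?thesis using unique_small(2)[OF K] Sub_G by linarith
  next
    case False
    then obtain Y where "Y \<in> subs G (card K)" "Y \<noteq> K" using K_subgroup by (auto simp: subs_def)
    then show ?thesis using not_unique_small[OF K] by blast
  qed
qed

section \<open>Two successive kernels of prime order\<close>

locale a4_double_extension = E: finite_epi G H e + A: a4_extension H A f
  for G (structure) and H (structure) and A (structure) and e and f +
  assumes prime_L: "prime (card E.K)"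

context a4_double_extension begin

abbreviation L where "L \<equiv> E.K"
abbreviation M where "M \<equiv> A.K"

lemma Sub_G_eq: "Sub G = Sub H + card E.not_above_K" by (rule E.Sub_split)

lemma coprime_primepow_subs_le_not_above_K: "card (coprime_primepow_subs (card L) H) \<le> card E.not_above_K"
proof -
  have "card (coprime_primepow_subs (card L) H) \<le> card (coprime_primepow_subs (card L) G)" by (rule E.card_coprime_primepow_subs_le)
  also have "\<dots> \<le> card E.not_above_K" using E.coprime_primepow_subs_subset_not_above_K[OF prime_L] by (intro card_mono) auto
  finally show ?thesis .
qed

lemma ge_15: "15 \<le> Sub H"
proof -
  have "card (coprime_primepow_subs (card M) H) \<le> card A.not_above_K" using A.coprime_primepow_subs_subset_not_above_K[OF A.prime_K] by (intro card_mono) auto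
  then show ?thesis using A.coprime_primepow_subs_ge[OF A.prime_K] A.Sub_G by linarith
qed

text \<open>
  Nine subgroups of \<open>A\<close> have prime power order coprime to \<open>card M\<close>. Hence \<open>H\<close> has at least 19
  subgroups, and six of its subgroups have prime power order coprime to \<open>card L\<close>.
\<close>

lemma large_M: assumes M5: "5 \<le> card M" shows "25 \<le> Sub G"
proof -
  have "9 \<le> card (coprime_primepow_subs (card M) A)" using A.H.card_coprime_primepow_subs_ge(2)[OF A.prime_K M5] .
  also have "\<dots> \<le> card (coprime_primepow_subs (card M) H)" by (rule A.card_coprime_primepow_subs_le)
  finally have pM: "9 \<le> card (coprime_primepow_subs (card M) H)" .
  also have "\<dots> \<le> card A.not_above_K" using A.coprime_primepow_subs_subset_not_above_K[OF A.prime_K] by (intro card_mono) auto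
  finally have "19 \<le> Sub H" using A.Sub_G by linarith
  moreover have "6 \<le> card (coprime_primepow_subs (card L) H)"
  proof (cases "card L = card M")
    case True
    then show ?thesis using pM by simp
  next
    case False
    then have "coprime (card M) (card L)" using primes_coprime[OF A.prime_K prime_L] by auto
    then show ?thesis using A.card_coprime_primepow_subs_less[OF A.prime_K] A.H.card_coprime_primepow_subs_ge(1)[OF prime_L] by force
  qed
  ultimately show ?thesis using coprime_primepow_subs_le_not_above_K Sub_G_eq by linarith
qed

context
  assumes M: "card M = 2 \<or> card M = 3" and Muniq: "subs H (card M) = {M}"
begin

lemma Sub_H_eq: "Sub H \<le> 15"
  using A.unique_small(2)[OF M Muniq] A.Sub_G by simp

lemma large_L: assumes L5: "5 \<le> card L" shows "25 \<le> Sub G"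
proof -
  have "card L \<noteq> card M" using M L5 by auto
  then have "coprime (card M) (card L)" using primes_coprime[OF A.prime_K prime_L] by auto
  then have "card (coprime_primepow_subs (card L) A) + 1 \<le> card (coprime_primepow_subs (card L) H)" by (rule A.card_coprime_primepow_subs_less[OF A.prime_K])
  then have "10 \<le> card (coprime_primepow_subs (card L) H)" using A.H.card_coprime_primepow_subs_ge(2)[OF prime_L L5] by linarith
  then show ?thesis using coprime_primepow_subs_le_not_above_K ge_15 Sub_G_eq by linarith
qed

text \<open>
  In the case of different primes, a subgroup of order coprime to \<open>card L\<close> that contains \<open>M\<close> comes from
  one of the at most five such subgroups of \<open>A\<close>. One that does not contain \<open>M\<close> has order coprime to
  both 2 and 3, and is trivial.
\<close>

lemma coprime_subs_H: assumes L: "card L = 2 \<or> card L = 3" shows "card (coprime_subs (card L) H) \<le> 6"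
proof (cases "card L = card M")
  case True
  have "coprime_subs (card M) H \<subseteq> A.not_above_K"
  proof
    fix U assume "U \<in> coprime_subs (card M) H"
    then have U: "subgroup U H" "coprime (card U) (card M)" by (auto simp: coprime_subs_def)
    have "\<not> card M dvd card U"
      using U(2) A.prime_K by (metis coprime_common_divisor_nat dvd_refl not_prime_1)
    then show "U \<in> A.not_above_K" using A.not_above_K_if_not_dvd U by blast
  qed
  then have "card (coprime_subs (card M) H) \<le> card A.not_above_K" by (intro card_mono) auto
  then show ?thesis using A.unique_small(2)[OF M Muniq] True by simp
next
  case False
  have sub: "coprime_subs (card L) H \<subseteq> insert {\<one>\<^bsub>H\<^esub>} (A.preimage ` coprime_subs (card L) A)"
  proof
    fix U assume "U \<in> coprime_subs (card L) H"
    then have U: "subgroup U H" "coprime (card U) (card L)" by (auto simp: coprime_subs_def)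
    show "U \<in> insert {\<one>\<^bsub>H\<^esub>} (A.preimage ` coprime_subs (card L) A)"
    proof (cases "M \<subseteq> U")
      case True
      have "card (f ` U) dvd card U" using A.card_image_mult[OF U(1)] by (metis dvd_triv_left)
      then have "coprime (card (f ` U)) (card L)" using U(2) coprime_divisors[OF _ dvd_refl] by blast
      then have "f ` U \<in> coprime_subs (card L) A" using A.image_subgroup[OF U(1)] by (simp add: coprime_subs_def)
      moreover have "U = A.preimage (f ` U)" using A.preimage_image[OF U(1) True] by simp
      ultimately show ?thesis by blast
    next
      case notM: False
      have "card U = 1"
      proof (rule ccontr)
        assume "card U \<noteq> 1"
        then obtain r where r: "prime r" "r dvd card U" using prime_factor_nat by blast
        have "r \<noteq> card L" using r U(2) by (metis coprime_common_divisor_nat dvd_refl not_prime_1)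
        moreover have "r \<noteq> card M"
        proof
          assume "r = card M"
          then obtain P where "P \<in> subs H (card M)" "P \<subseteq> U"
            using E.H.cauchy_in_subgroup[OF U(1) A.prime_K] r by blast
          then show False using Muniq notM by simp
        qed
        moreover have "r dvd order H" using r(2) E.H.card_subgroup_dvd[OF U(1)] dvd_trans by blast
        then have "r dvd 12 * card M" using A.order_G by simp
        then have "r dvd 2 * 2 * 3 * card M" by simp
        then have "r dvd 2 \<or> r dvd 3 \<or> r dvd card M" using r(1) by (metis prime_dvd_mult_iff)
        then have "r = 2 \<or> r = 3 \<or> r = card M"
          using primes_dvd_imp_eq[OF r(1), of 2] primes_dvd_imp_eq[OF r(1), of 3]
            primes_dvd_imp_eq[OF r(1) A.prime_K] by auto
        ultimately show False using M L False by auto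
      qed
      then have "U \<in> subs H 1" using U(1) by (simp add: subs_def)
      then show ?thesis using E.H.subs_one by simp
    qed
  qed
  have "card (coprime_subs (card L) A) \<le> 5" using L A.H.card_coprime_subs_le by auto
  then have "card (A.preimage ` coprime_subs (card L) A) \<le> 5" using card_image_le[of "coprime_subs (card L) A" A.preimage] by simp
  then have "card (insert {\<one>\<^bsub>H\<^esub>} (A.preimage ` coprime_subs (card L) A)) \<le> 6"
    using card_insert_le_m1[of 6 "A.preimage ` coprime_subs (card L) A" "{\<one>\<^bsub>H\<^esub>}"] by simp
  moreover have "card (coprime_subs (card L) H) \<le> card (insert {\<one>\<^bsub>H\<^esub>} (A.preimage ` coprime_subs (card L) A))"
    using sub by (intro card_mono) auto
  ultimately show ?thesis by linarith
qed

lemma L_central: assumes L: "card L = 2 \<or> card L = 3" shows "carrier G \<subseteq> E.G.centralizer L"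
  by (rule E.K_central[OF L A.unique_small(3)[OF M Muniq]])

lemma unique_L:
  assumes L: "card L = 2 \<or> card L = 3" and uniq: "subs G (card L) = {L}"
  shows "Sub G \<le> 21"
proof -
  have "card E.not_above_K \<le> card (coprime_subs (card L) H)" using E.not_above_K_le_coprime_subs[OF L_central[OF L] prime_L uniq] .
  then show ?thesis using coprime_subs_H[OF L] Sub_H_eq Sub_G_eq by linarith
qed

text \<open>
  If the image of \<open>Y\<close> in \<open>H\<close> is not \<open>M\<close>, its image in \<open>A\<close> still has order \<open>card L\<close> and hence at least three
  conjugates, each of which accounts for \<open>card L\<close> subgroups of that order other than \<open>L\<close>. With the 15
  subgroups of \<open>H\<close> and 5 more of order coprime to \<open>card L\<close>, this makes at least 26.

  If the image is \<open>M\<close>, then \<open>card L = card M\<close>; let \<open>r\<close> be the other one of 2 and 3. At least \<open>card L\<close>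
  subgroups \<open>Z\<close> of order \<open>card L\<close> map onto \<open>M\<close>, and they commute with every subgroup \<open>R\<close> of order \<open>r\<close>.
  Indeed for \<open>y\<close> in \<open>Z\<close> and \<open>x\<close> in \<open>R\<close> the commutator \<open>l\<close> of \<open>x\<close> and \<open>y\<close> lies in \<open>L\<close>, because \<open>M\<close> is central
  in \<open>H\<close>. As \<open>L\<close> is central too, conjugating \<open>y\<close> with the powers of \<open>x\<close> multiplies it by the powers of
  \<open>l\<close>; so the order of \<open>l\<close> divides both \<open>r\<close> and \<open>card L\<close>. The products \<open>Z <#> R\<close> give at least 8
  subgroups of order \<open>card L * r\<close> that do not contain \<open>L\<close>.
\<close>

lemma not_unique_L:
  assumes L: "card L = 2 \<or> card L = 3" and Y: "Y \<in> subs G (card L)" "Y \<noteq> L"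
  shows "25 \<le> Sub G"
proof -
  have eY: "e ` Y \<in> subs H (card L)" using E.prime_subs_image(2)[OF prime_L Y] .
  have pp5: "5 \<le> card (coprime_primepow_subs (card L) G)"
    using A.coprime_primepow_subs_ge[OF prime_L] E.card_coprime_primepow_subs_le[of "card L"] by linarith
  have disj: "coprime_primepow_subs (card L) G \<inter> subs G n = {}" if "card L dvd n" for n
    using E.coprime_primepow_subs_disjoint_subs[OF prime_L that] by simp
  show ?thesis
  proof (cases "e ` Y = M")
    case False
    have "f ` e ` Y \<in> subs A (card L)"
    proof (cases "card L = card M")
      case True
      then show ?thesis using A.prime_subs_image(2)[OF A.prime_K, of "e ` Y"] eY False by simp
    next
      case ne: False
      have "coprime (card (e ` Y)) (card M)"
        using primes_coprime[OF prime_L A.prime_K ne] subsD(2)[OF eY] by simp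
      then have "e ` Y \<inter> M = {\<one>\<^bsub>H\<^esub>}"
        using E.H.coprime_Int[OF subsD(1)[OF eY] A.K_subgroup] by simp
      then show ?thesis
        using A.card_image_trivial[OF subsD(1)[OF eY]] A.image_subgroup[OF subsD(1)[OF eY]] subsD(2)[OF eY]
        by (simp add: subs_def)
    qed
    then have c3: "3 \<le> card (A.H.conj_class (f ` e ` Y))" using A.class_image_subs L by auto
    have eYc: "e ` Y \<subseteq> carrier H" using E.H.subs_carrier[OF eY] .
    have "A.H.conj_class (f ` e ` Y) = (\<lambda>V. f ` V) ` E.H.conj_class (e ` Y)" using A.h_class[OF eYc] by simp
    then have "card (A.H.conj_class (f ` e ` Y)) \<le> card (E.H.conj_class (e ` Y))"
      using card_image_le[OF E.H.finite_conj_class[OF eYc]] by metis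
    then have "2 * 3 \<le> card L * card (E.H.conj_class (e ` Y))"
      using c3 L by (intro mult_le_mono) auto
    then have six: "6 \<le> card (subs G (card L) - {L})" using E.card_fibres_ge[OF prime_L Y] by linarith
    have "card (coprime_primepow_subs (card L) G \<union> (subs G (card L) - {L})) = card (coprime_primepow_subs (card L) G) + card (subs G (card L) - {L})"
      using disj[of "card L"] by (intro card_Un_disjoint) auto
    moreover have "card (coprime_primepow_subs (card L) G \<union> (subs G (card L) - {L})) \<le> card E.not_above_K"
      using E.other_prime_subs_in_not_above_K E.coprime_primepow_subs_subset_not_above_K[OF prime_L] by (intro card_mono) auto
    ultimately show ?thesis using pp5 six ge_15 Sub_G_eq by linarith
  next
    case eYM: True
    have LM: "card L = card M" using subsD(2)[OF eY] eYM by simp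
    \<comment> \<open>\<open>card L\<close> is 2 or 3, and the two add up to 5.\<close>
    define r where "r = 5 - card L"
    have r: "prime r" "r \<noteq> card L" "r = 2 \<or> r = 3" using L by (auto simp: r_def)
    have rL: "\<not> r dvd card L" using primes_dvd_imp_eq[OF r(1) prime_L] r(2) by blast
    have co: "coprime (card L) r" using primes_coprime[OF prime_L r(1)] r(2) by auto
    let ?P = "{Z \<in> subs G (card L). Z \<noteq> L \<and> e ` Z = M}"
    have "M \<in> E.H.conj_class (e ` Y)" using eYM E.H.self_in_class[OF E.H.subs_carrier[OF eY]] by simp
    then have P: "card L \<le> card ?P" using E.card_fibre_ge[OF prime_L Y] by blast
    have Lc: "L \<subseteq> carrier G" using subgroup.subset[OF E.K_subgroup] .
    have comm: "Z \<subseteq> E.G.centralizer R" if Z: "Z \<in> ?P" and R: "R \<in> subs G r" for Z R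
    proof -
      have Zs: "subgroup Z G" "Z \<subseteq> carrier G" and Rs: "subgroup R G" "card R = r" "R \<subseteq> carrier G"
        using Z R subgroup.subset by (auto simp: subs_def)
      have "y \<otimes> x = x \<otimes> y" if y: "y \<in> Z" and x: "x \<in> R" for x y
      proof -
        have c: "x \<in> carrier G" "y \<in> carrier G" using x y Zs Rs by auto
        have "e y \<in> M" using y Z by blast
        moreover have "e x \<in> carrier H" using c by simp
        ultimately have exy: "e x \<otimes>\<^bsub>H\<^esub> e y = e y \<otimes>\<^bsub>H\<^esub> e x"
          using A.unique_small(1)[OF M Muniq] by (auto simp: E.H.centralizer_def)
        define l where "l = inv y \<otimes> (x \<otimes> y \<otimes> inv x)"
        have lc: "l \<in> carrier G" using c by (simp add: l_def)
        have "e (x \<otimes> y \<otimes> inv x) = e y" using c exy E.H.conj_eq_iff_commute[of "e x" "e y"] by simp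
        then have "e l = \<one>\<^bsub>H\<^esub>" using c by (simp add: l_def)
        then have lL: "l \<in> L" using lc by (simp add: kernel_def)
        have xl: "x \<otimes> l \<otimes> inv x = l"
        proof -
          have "x \<otimes> l = l \<otimes> x" using L_central[OF L] c lL by (auto simp: E.G.centralizer_def)
          then show ?thesis using E.G.conj_eq_iff_commute c lc by blast
        qed
        have base: "x \<otimes> y \<otimes> inv x = y \<otimes> l" using c by (simp add: l_def flip: E.G.m_assoc)
        have iter: "x [^] n \<otimes> y \<otimes> inv (x [^] n) = y \<otimes> l [^] n" for n :: nat
        proof (induction n)
          case (Suc n)
          have lnc: "l [^] n \<in> carrier G" using lc by simp
          have xln: "x \<otimes> l [^] n \<otimes> inv x = l [^] n"
          proof -
            have "l [^] n \<in> L" using lL E.K_subgroup by (induction n) (auto simp: subgroup.one_closed subgroup.m_closed)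
            then have "x \<otimes> l [^] n = l [^] n \<otimes> x" using L_central[OF L] c by (auto simp: E.G.centralizer_def)
            then show ?thesis using E.G.conj_eq_iff_commute c lnc by blast
          qed
          have "x [^] Suc n = x \<otimes> x [^] n" using c E.G.nat_pow_Suc2 by simp
          then have "x [^] Suc n \<otimes> y \<otimes> inv (x [^] Suc n) = x \<otimes> (x [^] n \<otimes> y \<otimes> inv (x [^] n)) \<otimes> inv x"
            using c E.G.conj_mult[of x "x [^] n" y] by simp
          also have "\<dots> = x \<otimes> (y \<otimes> l [^] n) \<otimes> inv x" using Suc by simp
          also have "\<dots> = (x \<otimes> y \<otimes> inv x) \<otimes> (x \<otimes> l [^] n \<otimes> inv x)" using E.G.conj_hom[OF c lnc] .
          also have "\<dots> = y \<otimes> (l \<otimes> l [^] n)" using base xln c lc lnc by (simp add: E.G.m_assoc)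
          also have "\<dots> = y \<otimes> l [^] Suc n" using lc E.G.nat_pow_Suc2 by simp
          finally show ?case .
        qed (use c in simp)
        have "x [^] r = \<one>" using E.G.pow_card_subgroup[OF Rs(1) x] Rs(2) by simp
        then have "y \<otimes> l [^] r = y" using iter[of r] c by simp
        then have "l [^] r = \<one>" using c lc by simp
        moreover have "l [^] card L = \<one>" using E.G.pow_card_subgroup[OF E.K_subgroup lL] .
        ultimately have "E.G.ord l dvd r" "E.G.ord l dvd card L" using E.G.pow_eq_id[OF lc] by auto
        then have "E.G.ord l = 1" using co by (metis coprime_common_divisor_nat)
        then have "l = \<one>" using E.G.ord_eq_1[OF lc] by simp
        then have "x \<otimes> y \<otimes> inv x = y" using base c by simp
        then show ?thesis using E.G.conj_eq_iff_commute[OF c] by simp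
      qed
      then show ?thesis using Zs by (auto simp: E.G.centralizer_def)
    qed
    have nr: "(if r = 2 then 3 else 4) \<le> card (subs G r)"
    proof -
      have rM: "\<not> r dvd card M" using rL LM by simp
      have "card (subs A r) \<le> card (subs G r)"
        using A.card_subs_prime_le[OF r(1) rM] E.card_subs_prime_le[OF r(1) rL] by linarith
      then show ?thesis using r(3) A.H.card_subs_2 A.H.card_subs_3 by auto
    qed
    let ?N = "(\<lambda>(Z, R). Z <#> R) ` (?P \<times> subs G r)"
    have key: "Z <#> R \<in> subs G (card L * r) \<and> Z = {z \<in> Z <#> R. z [^] card L = \<one>} \<and> R = {z \<in> Z <#> R. z [^] r = \<one>}"
      if "Z \<in> ?P" "R \<in> subs G r" for Z R
      using E.G.commuting_prod_subs[of Z "card L" R r] that comm co by blast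
    have inj: "inj_on (\<lambda>(Z, R). Z <#> R) (?P \<times> subs G r)"
    proof (rule inj_onI)
      fix a b assume ab: "a \<in> ?P \<times> subs G r" "b \<in> ?P \<times> subs G r"
        and eq: "(\<lambda>(Z, R). Z <#> R) a = (\<lambda>(Z, R). Z <#> R) b"
      obtain Z R where a: "a = (Z, R)" "Z \<in> ?P" "R \<in> subs G r" using ab(1) by (rule SigmaE) simp
      obtain Z' R' where b: "b = (Z', R')" "Z' \<in> ?P" "R' \<in> subs G r" using ab(2) by (rule SigmaE) simp
      have "Z <#> R = Z' <#> R'" using eq a(1) b(1) by simp
      then have "Z = Z'" "R = R'" using key[OF a(2,3)] key[OF b(2,3)] by simp_all
      then show "a = b" using a(1) b(1) by simp
    qed
    have "card ?N = card ?P * card (subs G r)" using card_image[OF inj] by (simp add: card_cartesian_product)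
    moreover have "8 \<le> card L * (if r = 2 then 3 else 4)" using L by (auto simp: r_def)
    moreover have "card L * (if r = 2 then 3 else 4) \<le> card ?P * card (subs G r)"
      using P nr by (rule mult_le_mono)
    ultimately have N8: "8 \<le> card ?N" by linarith
    have "?N \<subseteq> E.not_above_K"
    proof
      fix U assume "U \<in> ?N"
      then obtain Z R where U: "U = Z <#> R" and ZP: "Z \<in> ?P" and R: "R \<in> subs G r" by auto
      have Z: "Z \<in> subs G (card L)" "Z \<noteq> L" using ZP by auto
      have "\<not> L \<subseteq> Z <#> R"
      proof
        assume "L \<subseteq> Z <#> R"
        then have "L \<subseteq> {z \<in> Z <#> R. z [^] card L = \<one>}" using E.G.pow_card_subgroup[OF E.K_subgroup] by blast
        then have "L \<subseteq> Z" using key[OF ZP R] by simp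
        then have "L = Z" by (rule E.G.subgroup_card_eq[OF E.K_subgroup subsD(1)[OF Z(1)]]) (simp add: subsD(2)[OF Z(1)])
        then show False using Z(2) by simp
      qed
      moreover have "subgroup (Z <#> R) G" using key[OF ZP R] subsD(1) by blast
      ultimately show "U \<in> E.not_above_K" by (simp add: E.not_above_K_def U)
    qed
    moreover have "coprime_primepow_subs (card L) G \<inter> ?N = {}"
    proof -
      have "?N \<subseteq> subs G (card L * r)" using key by auto
      then show ?thesis using disj[of "card L * r"] by auto
    qed
    then have "card (coprime_primepow_subs (card L) G \<union> ?N) = card (coprime_primepow_subs (card L) G) + card ?N" by (intro card_Un_disjoint) auto
    moreover have "card (coprime_primepow_subs (card L) G \<union> ?N) \<le> card E.not_above_K"
      using \<open>?N \<subseteq> E.not_above_K\<close> E.coprime_primepow_subs_subset_not_above_K[OF prime_L] by (intro card_mono) auto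
    ultimately show ?thesis using pp5 N8 ge_15 Sub_G_eq by linarith
  qed
qed

end

theorem not_22_to_24: "Sub G \<le> 21 \<or> 25 \<le> Sub G"
proof -
  have small: "p = 2 \<or> p = 3 \<or> 5 \<le> p" if "prime p" for p :: nat
    using prime_less_5[OF that] by linarith
  have Ms: "M \<in> subs H (card M)" and Ls: "L \<in> subs G (card L)"
    using A.K_subgroup E.K_subgroup by (auto simp: subs_def)
  show ?thesis
  proof (cases "5 \<le> card M")
    case True
    then show ?thesis using large_M by blast
  next
    case False
    then have M: "card M = 2 \<or> card M = 3" using small[OF A.prime_K] by simp
    show ?thesis
    proof (cases "subs H (card M) = {M}")
      case False
      then obtain Y where "Y \<in> subs H (card M)" "Y \<noteq> M" using Ms by blast
      then have "25 \<le> Sub H" using A.not_unique_small[OF M] by blast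
      then show ?thesis using Sub_G_eq by linarith
    next
      case Muniq: True
      show ?thesis
      proof (cases "5 \<le> card L")
        case True
        then show ?thesis using large_L[OF M Muniq] by blast
      next
        case False
        then have L: "card L = 2 \<or> card L = 3" using small[OF prime_L] by simp
        show ?thesis
        proof (cases "subs G (card L) = {L}")
          case True
          then show ?thesis using unique_L[OF M Muniq L] by blast
        next
          case False
          then obtain Y where "Y \<in> subs G (card L)" "Y \<noteq> L" using Ls by blast
          then show ?thesis using not_unique_L[OF M Muniq L] by blast
        qed
      qed
    qed
  qed
qed

end

section \<open>Series of normal subgroups\<close>

lemma (in finite_group) quotient_epi:
  assumes N: "N \<lhd> G"
  shows "finite_epi G (G Mod N) (\<lambda>x. N #> x)" "kernel G (G Mod N) (\<lambda>x. N #> x) = N"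
proof -
  interpret N: normal N G by (rule N)
  have Ns: "subgroup N G" using N by (rule normal_imp_subgroup)
  show "finite_epi G (G Mod N) (\<lambda>x. N #> x)"
    unfolding finite_epi_def finite_epi_axioms_def
    using finite_group_axioms N.factorgroup_is_group N.r_coset_hom_Mod by (simp add: carrier_FactGroup)
  have "N #> x = N \<longleftrightarrow> x \<in> N" if "x \<in> carrier G" for x
    using coset_join1[OF _ that Ns] N.rcos_const[of x] by blast
  then show "kernel G (G Mod N) (\<lambda>x. N #> x) = N"
    using subgroup.subset[OF Ns] by (simp add: kernel_def) blast
qed

lemma (in finite_group) prime_order_cyclic:
  assumes "prime (order G)" shows "cyclic_group G"
proof -
  have "carrier G \<noteq> {\<one>}" using assms by (auto simp: order_def)
  then obtain x where x: "x \<in> carrier G" "x \<noteq> \<one>" using one_closed by blast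
  have gen: "subgroup (generate G {x}) G" using generate_is_subgroup x(1) by simp
  have "card (generate G {x}) dvd order G" using card_subgroup_dvd[OF gen] .
  moreover have "x \<in> generate G {x}" by (rule generate.incl) simp
  then have "card (generate G {x}) \<noteq> 1"
    using subgroup.one_closed[OF gen] x(2) by (auto simp: card_1_singleton_iff)
  ultimately have "card (generate G {x}) = order G" using assms by (metis prime_nat_iff)
  then have "generate G {x} = carrier G"
    using subgroup_card_eq[OF gen subgroup_self] subgroup.subset[OF gen] by (simp add: order_def)
  then have "carrier G = range (\<lambda>n::int. x [^] n)" using generate_pow[OF x(1)] by (simp add: full_SetCompr_eq)
  then show ?thesis using cyclic_group x(1) by blast
qed

lemma (in finite_epi) preimage_normal:
  assumes "B \<lhd> H" shows "preimage B \<lhd> G"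
proof (rule G.normal_invI[OF preimage_subgroup[OF normal_imp_subgroup[OF assms]]])
  fix x k assume "x \<in> carrier G" "k \<in> preimage B"
  then show "x \<otimes> k \<otimes> inv x \<in> preimage B"
    using normal.inv_op_closed2[OF assms] by (auto simp: preimage_def)
qed

text \<open>
  The condition in \<^const>\<open>supersolvable\<close>, for a series that ends in \<open>N\<close> instead of the whole group.
\<close>

definition (in group) reachable :: "'a set \<Rightarrow> bool"
  where "reachable N \<longleftrightarrow>
    (\<exists>(n::nat) (H :: nat \<Rightarrow> 'a set).
       H 0 = {\<one>} \<and> H n = N \<and> (\<forall>i\<le>n. H i \<lhd> G) \<and>
       (\<forall>i<n. H i \<subseteq> H (Suc i) \<and> cyclic_group ((G\<lparr>carrier := H (Suc i)\<rparr>) Mod H i)))"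

lemma (in group) reachable_step:
  assumes "reachable N" "N \<subseteq> M" "M \<lhd> G" "cyclic_group ((G\<lparr>carrier := M\<rparr>) Mod N)"
  shows "reachable M"
proof -
  obtain n H where H: "H 0 = {\<one>}" "H n = N" "\<forall>i\<le>n. H i \<lhd> G"
    "\<forall>i<n. H i \<subseteq> H (Suc i) \<and> cyclic_group ((G\<lparr>carrier := H (Suc i)\<rparr>) Mod H i)"
    using assms(1) by (auto simp: reachable_def)
  define H' where "H' i = (if i \<le> n then H i else M)" for i
  have "H' 0 = {\<one>} \<and> H' (Suc n) = M \<and> (\<forall>i\<le>Suc n. H' i \<lhd> G) \<and>
       (\<forall>i<Suc n. H' i \<subseteq> H' (Suc i) \<and> cyclic_group ((G\<lparr>carrier := H' (Suc i)\<rparr>) Mod H' i))"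
  proof (intro conjI allI impI)
    fix i assume i: "i < Suc n"
    show "H' i \<subseteq> H' (Suc i)" "cyclic_group ((G\<lparr>carrier := H' (Suc i)\<rparr>) Mod H' i)"
      using H i assms(2,4) by (cases "i = n"; simp add: H'_def)+
  qed (use H assms(3) in \<open>auto simp: H'_def\<close>)
  then show ?thesis unfolding reachable_def by blast
qed

text \<open>
  Let \<open>N\<close> be reachable of maximal order. If \<open>B\<close> is a normal subgroup of prime order of the quotient,
  its preimage is reachable by one more step, with a factor of the same prime order as \<open>B\<close>.
\<close>

lemma (in finite_group) not_supersolvable_quotient:
  assumes "\<not> supersolvable G"
  shows "\<exists>N. N \<lhd> G \<and> group_no_prime_normal (G Mod N)"
proof -
  let ?R = "{N. N \<lhd> G \<and> reachable N}"
  have "finite ?R" by (rule finite_subset[OF _ finite_subgroups]) (auto intro: normal_imp_subgroup)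
  moreover have "reachable {\<one>}"
    unfolding reachable_def by (rule exI[of _ 0], rule exI[of _ "\<lambda>_. {\<one>}"]) (simp add: one_is_normal)
  then have "{\<one>} \<in> ?R" using one_is_normal by simp
  ultimately have "Max (card ` ?R) \<in> card ` ?R" by (intro Max_in) auto
  then obtain N where N: "N \<lhd> G" "reachable N" "card N = Max (card ` ?R)" by auto
  have max: "card M \<le> card N" if "M \<lhd> G" "reachable M" for M
    using that \<open>finite ?R\<close> unfolding N(3) by (intro Max_ge) auto
  interpret Q: finite_epi G "G Mod N" "\<lambda>x. N #> x" using quotient_epi(1)[OF N(1)] .
  have K: "kernel G (G Mod N) (\<lambda>x. N #> x) = N" using quotient_epi(2)[OF N(1)] .
  have "N \<noteq> carrier G" using assms N(2) unfolding reachable_def supersolvable_def by meson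
  have "group_no_prime_normal (G Mod N)"
  proof (unfold_locales)
    show "order (G Mod N) \<noteq> 1"
    proof
      assume "order (G Mod N) = 1"
      then have "card N = card (carrier G)" using Q.order_mult K by (simp add: order_def)
      then have "N = carrier G"
        using card_subset_eq[OF fin subgroup.subset[OF normal_imp_subgroup[OF N(1)]]] by simp
      then show False using \<open>N \<noteq> carrier G\<close> by blast
    qed
  next
    fix B :: "'a set set" assume B: "prime (card B)"
    show "\<not> B \<lhd> (G Mod N)"
    proof
      assume Bn: "B \<lhd> (G Mod N)"
      have Bs: "subgroup B (G Mod N)" using Bn by (rule normal_imp_subgroup)
      let ?M = "Q.preimage B"
      have M: "?M \<lhd> G" using Q.preimage_normal[OF Bn] .
      have Ms: "subgroup ?M G" using M by (rule normal_imp_subgroup)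
      have NM: "N \<subseteq> ?M" using Q.K_le_preimage[OF Bs] K by simp
      have cM: "card ?M = card B * card N" using Q.card_preimage[OF Bs] K by simp
      interpret S: finite_group "G\<lparr>carrier := ?M\<rparr>" using finite_group_subgroup[OF Ms] .
      have NS: "N \<lhd> (G\<lparr>carrier := ?M\<rparr>)" using normal_restrict_supergroup[OF Ms N(1) NM] .
      interpret R: finite_epi "G\<lparr>carrier := ?M\<rparr>" "(G\<lparr>carrier := ?M\<rparr>) Mod N" "\<lambda>x. N #>\<^bsub>G\<lparr>carrier := ?M\<rparr>\<^esub> x"
        using S.quotient_epi(1)[OF NS] .
      have KS: "kernel (G\<lparr>carrier := ?M\<rparr>) ((G\<lparr>carrier := ?M\<rparr>) Mod N) (\<lambda>x. N #>\<^bsub>G\<lparr>carrier := ?M\<rparr>\<^esub> x) = N"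
        using S.quotient_epi(2)[OF NS] .
      have "card ?M = order ((G\<lparr>carrier := ?M\<rparr>) Mod N) * card N"
        using R.order_mult unfolding KS by (simp add: order_def)
      moreover have Npos: "0 < card N" using card_subgroup_pos[OF normal_imp_subgroup[OF N(1)]] .
      ultimately have "order ((G\<lparr>carrier := ?M\<rparr>) Mod N) = card B" using cM by simp
      then have "cyclic_group ((G\<lparr>carrier := ?M\<rparr>) Mod N)" using R.H.prime_order_cyclic B by simp
      then have "reachable ?M" using reachable_step[OF N(2) NM M] by blast
      then have "card B * card N \<le> card N" using max[OF M] cM by simp
      then have "card B \<le> 1" using Npos by simp
      then show False using prime_gt_1_nat[OF B] by simp
    qed
  qed
  then show ?thesis using N(1) by blast
qed

section \<open>Groups that map onto the alternating group\<close>

text \<open>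
  The image of \<open>N\<close> in \<open>A\<close> is normal and its order divides a prime, so it is trivial and \<open>h\<close> factors
  through the quotient.
\<close>

lemma epi_factor:
  assumes h: "finite_epi G A h" and A: "group_no_prime_normal A" and N: "N \<lhd> G" "prime (card N)"
  shows "\<exists>k. finite_epi (G Mod N) A k"
proof -
  interpret h: finite_epi G A h by (rule h)
  interpret A: group_no_prime_normal A by (rule A)
  interpret q: finite_epi G "G Mod N" "\<lambda>x. N #>\<^bsub>G\<^esub> x" using h.G.quotient_epi(1)[OF N(1)] .
  have Ns: "subgroup N G" using N(1) by (rule normal_imp_subgroup)
  have hN: "subgroup (h ` N) A" using h.image_subgroup[OF Ns] .
  have "h ` N \<lhd> A"
    unfolding h.H.normal_iff_conjg
  proof (intro conjI ballI hN)
    fix a assume "a \<in> carrier A"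
    then obtain g where g: "g \<in> carrier G" "a = h g" using h.surj by blast
    have "h.H.conjg a (h ` N) = h ` h.G.conjg g N"
      using h.h_conjg[OF g(1) subgroup.subset[OF Ns]] g(2) by simp
    also have "h.G.conjg g N = N" using N(1) g(1) h.G.normal_iff_conjg by blast
    finally show "h.H.conjg a (h ` N) = h ` N" .
  qed
  then have "\<not> prime (card (h ` N))" using A.no_prime_normal by blast
  moreover have "card (h ` N) dvd card N" using h.card_image_mult[OF Ns] by (metis dvd_triv_left)
  ultimately have "card (h ` N) = 1" using N(2) by (metis prime_nat_iff)
  then have "h ` N \<in> subs A 1" using hN by (simp add: subs_def)
  then have hN1: "h ` N = {\<one>\<^bsub>A\<^esub>}" using h.H.subs_one by simp
  have eq: "h x = h y" if "x \<in> carrier G" "y \<in> carrier G" "N #>\<^bsub>G\<^esub> x = N #>\<^bsub>G\<^esub> y" for x y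
  proof -
    have "x \<in> N #>\<^bsub>G\<^esub> y" using h.G.rcos_self[OF that(1) Ns] that(3) by simp
    then obtain n where n: "n \<in> N" "x = n \<otimes>\<^bsub>G\<^esub> y" by (auto simp: r_coset_def)
    have "h n = \<one>\<^bsub>A\<^esub>" using hN1 n(1) by blast
    then show ?thesis using n that(2) subgroup.mem_carrier[OF Ns] by simp
  qed
  obtain k where k: "k \<in> hom (G Mod N) A" "\<And>x. x \<in> carrier G \<Longrightarrow> k (N #>\<^bsub>G\<^esub> x) = h x"
    using FactGroup_universal[OF h.hom N(1) eq] by blast
  have "k ` carrier (G Mod N) = h ` carrier G"
    using k(2) by (force simp: carrier_FactGroup image_image)
  then have "finite_epi (G Mod N) A k"
    using k(1) h.surj q.H.finite_group_axioms h.H.is_group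
    by (simp add: finite_epi_def finite_epi_axioms_def)
  then show ?thesis by blast
qed

lemma epi_a4:
  assumes h: "finite_epi G A h" and A: "a4_group A"
  shows "finite_group G" "order G \<noteq> 1" "10 \<le> Sub G" "prime p \<Longrightarrow> 5 \<le> card (coprime_primepow_subs p G)"
proof -
  interpret h: finite_epi G A h by (rule h)
  interpret A: a4_group A by (rule A)
  show "finite_group G" by unfold_locales
  show "order G \<noteq> 1" using h.order_mult A.order12 by simp
  show "10 \<le> Sub G" using h.Sub_split A.Sub_eq by simp
  show "5 \<le> card (coprime_primepow_subs p G)" if "prime p" using h.card_coprime_primepow_subs_le[of p] A.card_coprime_primepow_subs_ge(1)[OF that] by linarith
qed

lemma Sub_quotient_plus_5:
  assumes h: "finite_epi G A h" and A: "a4_group A" and N: "N \<lhd> G" "prime (card N)"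
  shows "Sub (G Mod N) + 5 \<le> Sub G"
proof -
  interpret G: finite_group G using epi_a4(1)[OF h A] .
  interpret q: finite_epi G "G Mod N" "\<lambda>x. N #>\<^bsub>G\<^esub> x" using G.quotient_epi(1)[OF N(1)] .
  have K: "q.K = N" using G.quotient_epi(2)[OF N(1)] .
  have "5 \<le> card (coprime_primepow_subs (card N) G)" using epi_a4(4)[OF h A N(2)] .
  also have "\<dots> \<le> card q.not_above_K" using q.coprime_primepow_subs_subset_not_above_K N(2) K by (intro card_mono) auto
  finally show ?thesis using q.Sub_split by linarith
qed

lemma a4_or_prime_normal:
  assumes G: "finite_group G" "order G \<noteq> 1" "Sub G \<le> 24"
  shows "a4_group G \<or> (\<exists>N. N \<lhd> G \<and> prime (card N))"
proof (rule disjCI)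
  assume no: "\<nexists>N. N \<lhd> G \<and> prime (card N)"
  interpret finite_group G by (rule G(1))
  interpret few_subgroups G by unfold_locales (use G no in auto)
  show "a4_group G" by unfold_locales (rule order_12)
qed

lemma quotient_a4_extension:
  assumes "finite_group G" "N \<lhd> G" "prime (card N)" "a4_group (G Mod N)"
  shows "a4_extension G (G Mod N) (\<lambda>x. N #>\<^bsub>G\<^esub> x)"
  using finite_group.quotient_epi[OF assms(1,2)] assms(3,4)
  by (simp add: a4_extension_def a4_extension_axioms_def)

text \<open>
  Pass to quotients by normal subgroups of prime order until the alternating group is reached. If this
  takes more than two steps, each of the first three adds at least five subgroups to at least ten.
\<close>

theorem a4_image_not_22_to_24:
  assumes h: "finite_epi G A h" and A: "a4_group A"
  shows "Sub G \<le> 21 \<or> 25 \<le> Sub G"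
proof (rule ccontr)
  assume n: "\<not> ?thesis"
  have npn: "group_no_prime_normal A" using A by (simp add: a4_group_def)
  note G = epi_a4[OF h A]
  have "\<not> a4_group G" using a4_group.Sub_eq n by fastforce
  then obtain N1 where N1: "N1 \<lhd> G" "prime (card N1)"
    using a4_or_prime_normal[OF G(1,2)] n by auto
  obtain h1 where h1: "finite_epi (G Mod N1) A h1" using epi_factor[OF h npn N1] by blast
  note G1 = epi_a4[OF h1 A]
  have s1: "Sub (G Mod N1) + 5 \<le> Sub G" using Sub_quotient_plus_5[OF h A N1] .
  have "\<not> a4_group (G Mod N1)"
    using a4_extension.not_21_to_24[OF quotient_a4_extension[OF G(1) N1]] n by linarith
  then obtain N2 where N2: "N2 \<lhd> (G Mod N1)" "prime (card N2)"
    using a4_or_prime_normal[OF G1(1,2)] s1 n by auto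
  obtain h2 where h2: "finite_epi (G Mod N1 Mod N2) A h2" using epi_factor[OF h1 npn N2] by blast
  note G2 = epi_a4[OF h2 A]
  have s2: "Sub (G Mod N1 Mod N2) + 5 \<le> Sub (G Mod N1)" using Sub_quotient_plus_5[OF h1 A N2] .
  have "\<not> a4_group (G Mod N1 Mod N2)"
  proof
    assume a4: "a4_group (G Mod N1 Mod N2)"
    have "a4_double_extension G (G Mod N1) (G Mod N1 Mod N2) (\<lambda>x. N1 #>\<^bsub>G\<^esub> x) (\<lambda>x. N2 #>\<^bsub>G Mod N1\<^esub> x)"
      using finite_group.quotient_epi[OF G(1) N1(1)] quotient_a4_extension[OF G1(1) N2 a4] N1(2)
      by (simp add: a4_double_extension_def a4_double_extension_axioms_def)
    then show False using a4_double_extension.not_22_to_24 n by blast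
  qed
  then obtain N3 where N3: "N3 \<lhd> (G Mod N1 Mod N2)" "prime (card N3)"
    using a4_or_prime_normal[OF G2(1,2)] s1 s2 n by auto
  obtain h3 where h3: "finite_epi (G Mod N1 Mod N2 Mod N3) A h3" using epi_factor[OF h2 npn N3] by blast
  have "Sub (G Mod N1 Mod N2 Mod N3) + 5 \<le> Sub (G Mod N1 Mod N2)" using Sub_quotient_plus_5[OF h2 A N3] .
  then show False using epi_a4(3)[OF h3 A] s1 s2 n by linarith
qed

theorem theorem3p3:
  fixes G :: "('a, 'b) monoid_scheme"
  assumes "group G"
    and "finite (carrier G)"
    and "22 \<le> Sub G"
    and "Sub G \<le> 24"
  shows "supersolvable G"
proof (rule ccontr)
  assume ns: "\<not> supersolvable G"
  interpret finite_group G using assms(1,2) by (simp add: finite_group_def finite_group_axioms_def)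
  obtain N where N: "N \<lhd> G" "group_no_prime_normal (G Mod N)" using not_supersolvable_quotient[OF ns] by blast
  interpret q: finite_epi G "G Mod N" "\<lambda>x. N #>\<^bsub>G\<^esub> x" using quotient_epi(1)[OF N(1)] .
  interpret A: group_no_prime_normal "G Mod N" by (rule N(2))
  have "Sub (G Mod N) \<le> 24" using q.Sub_split assms(4) by linarith
  then have "a4_group (G Mod N)"
    using a4_or_prime_normal[of "G Mod N"] q.H.finite_group_axioms A.nontrivial A.no_prime_normal by blast
  then have "Sub G \<le> 21 \<or> 25 \<le> Sub G" using a4_image_not_22_to_24[OF q.finite_epi_axioms] by blast
  then show False using assms(3,4) by linarith
qed

end
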